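(* Let $\Bbbk$ be a field, let $H$ be a finite-dimensional $\Bbbk$-linear bialgebra, and let $M_1,\dots,M_r$ be Yetter-Drinfel'd module algebras over $H$. Then the system $(H,M_1,\dots,M_r,H^* )$ can be endowed with the following braiding (making it a rank $r+2$ braided system in the category of $\Bbbk$-vector spaces): $$\sigma_{H,H}:h_1\otimes h_2\mapsto h_1h_2\otimes 1_H,\qquad \sigma_{H^*,H^*}:l_1\otimes l_2\mapsto\varepsilon_H\otimes l_1l_2,$$ $$\sigma_{H,H^*}:h\otimes l\mapsto l_{(1)}(h_{(2)})\,l_{(2)}\otimes h_{(1)},$$ $$\sigma_{M_i,M_i}:m_1\otimes m_2\mapsto 1_{M_i}\otimes m_1m_2\quad(1\le i\le r),$$ $$\sigma_{M_i,M_j}:m\otimes n\mapsto m_{(1)}n\otimes m_{(0)}\quad(1\le i<j\le r),$$ $$\sigma_{H,M_i}:h\otimes m\mapsto h_{(2)}m\otimes h_{(1)},\qquad \sigma_{M_i,H^*}:m\otimes l\mapsto l_{(1)}(m_{(1)})\,l_{(2)}\otimes m_{(0)}\quad(1\le i\le r).$$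
   Context: Sweedler notation: $\Delta_H(h)=h_{(1)}\otimes h_{(2)}$, $\delta(v)=v_{(0)}\otimes v_{(1)}\in V\otimes H$ for coactions. Structures on $H^*$ are dual to those of $H$ with the "rainbow" convention: $(l_1l_2)(h)=l_1(h_{(2)})\,l_2(h_{(1)})$, the unit of $H^*$ is $\varepsilon_H$, and the comultiplication $l\mapsto l_{(1)}\otimes l_{(2)}$ is determined by $l(hh')=l_{(1)}(h')\,l_{(2)}(h)$. A Yetter-Drinfel'd module algebra over $H$ is a vector space $V$ with a unital associative algebra structure, a left $H$-module structure and a right $H$-comodule structure such that for all $h\in H$, $v,w\in V$: $(h_{(2)}v)_{(0)}\otimes(h_{(2)}v)_{(1)}h_{(1)}=h_{(1)}v_{(0)}\otimes h_{(2)}v_{(1)}$; $\delta(vw)=v_{(0)}w_{(0)}\otimes v_{(1)}w_{(1)}$; $h(vw)=(h_{(2)}v)(h_{(1)}w)$; $\delta(1_V)=1_V\otimes 1_H$; $h1_V=\varepsilon_H(h)1_V$. A braided system of rank $t$ in a monoidal category is an ordered family $V_1,\dots,V_t$ with morphisms (not necessarily invertible) $\sigma_{i,j}:V_i\otimes V_j\to V_j\otimes V_i$ for $1\le i\le j\le t$ (together called a braiding) satisfying, for all $1\le i\le j\le k\le t$, the colored Yang-Baxter equation on $V_i\otimes V_j\otimes V_k$: $$(\sigma_{j,k}\otimes\mathrm{Id}_i)(\mathrm{Id}_j\otimes\sigma_{i,k})(\sigma_{i,j}\otimes\mathrm{Id}_k)=(\mathrm{Id}_k\otimes\sigma_{i,j})(\sigma_{i,k}\otimes\mathrm{Id}_j)(\mathrm{Id}_i\otimes\sigma_{j,k}).$$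 *)

theory Defs
  imports "HOL-Algebra.Module" "HOL-Algebra.Weak_Morphisms"
begin

section \<open>Vector spaces and linear maps\<close>

text \<open>
  A vector space over \<open>K\<close> is a \<^locale>\<open>module\<close> over a \<^locale>\<open>field\<close>.  Records of type
  \<^type>\<open>module\<close> inherit multiplicative fields from \<^type>\<open>ring\<close>; these carry no meaning
  for bare vector spaces, and are left \<^const>\<open>undefined\<close> in the constructions below.
\<close>

definition lin_maps ::
    "('k, 'c) ring_scheme \<Rightarrow> ('k, 'v, 'x) module_scheme \<Rightarrow> ('k, 'w, 'y) module_scheme \<Rightarrow> ('v \<Rightarrow> 'w) set"
  where "lin_maps K V W =
    {f \<in> carrier V \<rightarrow> carrier W.
      (\<forall>x\<in>carrier V. \<forall>y\<in>carrier V. f (x \<oplus>\<^bsub>V\<^esub> y) = f x \<oplus>\<^bsub>W\<^esub> f y) \<and>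
      (\<forall>c\<in>carrier K. \<forall>x\<in>carrier V. f (c \<odot>\<^bsub>V\<^esub> x) = c \<odot>\<^bsub>W\<^esub> f x)}"

definition self_module :: "('k, 'c) ring_scheme \<Rightarrow> ('k, 'k) module"
  where "self_module K =
    \<lparr>carrier = carrier K, monoid.mult = (\<otimes>\<^bsub>K\<^esub>), one = \<one>\<^bsub>K\<^esub>,
     zero = \<zero>\<^bsub>K\<^esub>, add = (\<oplus>\<^bsub>K\<^esub>), smult = (\<otimes>\<^bsub>K\<^esub>)\<rparr>"

definition lin_span :: "('k, 'c) ring_scheme \<Rightarrow> ('k, 'v, 'x) module_scheme \<Rightarrow> 'v set \<Rightarrow> 'v set"
  where "lin_span K V S = \<Inter>{N. submodule N K V \<and> S \<subseteq> N}"

definition finite_dimensional :: "('k, 'c) ring_scheme \<Rightarrow> ('k, 'v, 'x) module_scheme \<Rightarrow> bool"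
  where "finite_dimensional K V \<longleftrightarrow>
    (\<exists>B. finite B \<and> B \<subseteq> carrier V \<and> lin_span K V B = carrier V)"

definition quotient_module ::
    "('k, 'c) ring_scheme \<Rightarrow> ('k, 'v, 'x) module_scheme \<Rightarrow> 'v set \<Rightarrow> ('k, 'v set) module"
  where "quotient_module K V N =
    \<lparr>carrier = a_rcosets\<^bsub>V\<^esub> N, monoid.mult = undefined, one = undefined, zero = N,
     add = (\<lambda>X Y. X <+>\<^bsub>V\<^esub> Y), smult = (\<lambda>c X. \<Union>x\<in>X. N +>\<^bsub>V\<^esub> (c \<odot>\<^bsub>V\<^esub> x))\<rparr>"

definition image_module :: "('v \<Rightarrow> 'w) \<Rightarrow> ('k, 'v, 'x) module_scheme \<Rightarrow> ('k, 'w) module"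
  where "image_module f V =
    ring.extend (image_ring f V)
      \<lparr>smult = (\<lambda>c w. f (c \<odot>\<^bsub>V\<^esub> inv_into (carrier V) f w))\<rparr>"


section \<open>Tensor products\<close>

text \<open>
  The tensor product \<open>V \<otimes> W\<close> is the free vector space on the set \<open>V \<times> W\<close>, modulo the
  subspace spanned by the bilinearity relators.
\<close>

definition free_module :: "('k, 'c) ring_scheme \<Rightarrow> 'i set \<Rightarrow> ('k, 'i \<Rightarrow> 'k) module"
  where "free_module K I =
    \<lparr>carrier = {\<phi>. (\<forall>i. \<phi> i \<in> carrier K) \<and> finite {i. \<phi> i \<noteq> \<zero>\<^bsub>K\<^esub>} \<and> {i. \<phi> i \<noteq> \<zero>\<^bsub>K\<^esub>} \<subseteq> I},
     monoid.mult = undefined, one = undefined, zero = (\<lambda>_. \<zero>\<^bsub>K\<^esub>),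
     add = (\<lambda>\<phi> \<psi> i. \<phi> i \<oplus>\<^bsub>K\<^esub> \<psi> i), smult = (\<lambda>c \<phi> i. c \<otimes>\<^bsub>K\<^esub> \<phi> i)\<rparr>"

definition free_gen :: "('k, 'c) ring_scheme \<Rightarrow> 'i \<Rightarrow> 'i \<Rightarrow> 'k"
  where "free_gen K i = (\<lambda>j. if j = i then \<one>\<^bsub>K\<^esub> else \<zero>\<^bsub>K\<^esub>)"

definition tensor_relators ::
    "('k, 'c) ring_scheme \<Rightarrow> ('k, 'v, 'x) module_scheme \<Rightarrow> ('k, 'w, 'y) module_scheme
      \<Rightarrow> ('v \<times> 'w \<Rightarrow> 'k) set"
  where "tensor_relators K V W =
    (let F = free_module K (carrier V \<times> carrier W); g = (\<lambda>v w. free_gen K (v, w)) in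
      {g (v \<oplus>\<^bsub>V\<^esub> v') w \<ominus>\<^bsub>F\<^esub> (g v w \<oplus>\<^bsub>F\<^esub> g v' w) | v v' w.
         v \<in> carrier V \<and> v' \<in> carrier V \<and> w \<in> carrier W} \<union>
      {g v (w \<oplus>\<^bsub>W\<^esub> w') \<ominus>\<^bsub>F\<^esub> (g v w \<oplus>\<^bsub>F\<^esub> g v w') | v w w'.
         v \<in> carrier V \<and> w \<in> carrier W \<and> w' \<in> carrier W} \<union>
      {g (c \<odot>\<^bsub>V\<^esub> v) w \<ominus>\<^bsub>F\<^esub> (c \<odot>\<^bsub>F\<^esub> g v w) | c v w.
         c \<in> carrier K \<and> v \<in> carrier V \<and> w \<in> carrier W} \<union>
      {g v (c \<odot>\<^bsub>W\<^esub> w) \<ominus>\<^bsub>F\<^esub> (c \<odot>\<^bsub>F\<^esub> g v w) | c v w.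
         c \<in> carrier K \<and> v \<in> carrier V \<and> w \<in> carrier W})"

definition tensor_null ::
    "('k, 'c) ring_scheme \<Rightarrow> ('k, 'v, 'x) module_scheme \<Rightarrow> ('k, 'w, 'y) module_scheme
      \<Rightarrow> ('v \<times> 'w \<Rightarrow> 'k) set"
  where "tensor_null K V W =
    lin_span K (free_module K (carrier V \<times> carrier W)) (tensor_relators K V W)"

type_synonym ('k, 'v, 'w) tensor = "('v \<times> 'w \<Rightarrow> 'k) set"

definition tensor ::
    "('k, 'c) ring_scheme \<Rightarrow> ('k, 'v, 'x) module_scheme \<Rightarrow> ('k, 'w, 'y) module_scheme
      \<Rightarrow> ('k, ('k, 'v, 'w) tensor) module"
  where "tensor K V W =
    quotient_module K (free_module K (carrier V \<times> carrier W)) (tensor_null K V W)"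

definition pure_tensor ::
    "('k, 'c) ring_scheme \<Rightarrow> ('k, 'v, 'x) module_scheme \<Rightarrow> ('k, 'w, 'y) module_scheme
      \<Rightarrow> 'v \<Rightarrow> 'w \<Rightarrow> ('k, 'v, 'w) tensor"
  where "pure_tensor K V W v w =
    tensor_null K V W +>\<^bsub>free_module K (carrier V \<times> carrier W)\<^esub> free_gen K (v, w)"

text \<open>
  \<open>tensor_lift K U f\<close> is the linear map \<open>v \<otimes> w \<mapsto> f v w\<close> into \<open>U\<close> induced by a bilinear
  \<open>f\<close>: evaluate \<open>f\<close> on any representative of the class.  It also renders Sweedler notation:
  for \<open>\<Delta>(h) = h\<^sub>(\<^sub>1\<^sub>) \<otimes> h\<^sub>(\<^sub>2\<^sub>)\<close>, the element \<open>f(h\<^sub>(\<^sub>1\<^sub>), h\<^sub>(\<^sub>2\<^sub>))\<close> of \<open>U\<close> is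
  \<open>tensor_lift K U f (\<Delta> h)\<close>.
\<close>

definition tensor_lift ::
    "('k, 'c) ring_scheme \<Rightarrow> ('k, 'u, 'x) module_scheme \<Rightarrow> ('v \<Rightarrow> 'w \<Rightarrow> 'u)
      \<Rightarrow> ('k, 'v, 'w) tensor \<Rightarrow> 'u"
  where "tensor_lift K U f X =
    (let \<phi> = (SOME \<phi>. \<phi> \<in> X) in
      \<Oplus>\<^bsub>U\<^esub>p\<in>{p. \<phi> p \<noteq> \<zero>\<^bsub>K\<^esub>}. \<phi> p \<odot>\<^bsub>U\<^esub> f (fst p) (snd p))"

text \<open>\<open>tensor_map K V' W' f g\<close> is \<open>f \<otimes> g\<close>, with target \<open>V' \<otimes> W'\<close>.\<close>

definition tensor_map ::
    "('k, 'c) ring_scheme \<Rightarrow> ('k, 'v2, 'x) module_scheme \<Rightarrow> ('k, 'w2, 'y) module_scheme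
      \<Rightarrow> ('v1 \<Rightarrow> 'v2) \<Rightarrow> ('w1 \<Rightarrow> 'w2) \<Rightarrow> ('k, 'v1, 'w1) tensor \<Rightarrow> ('k, 'v2, 'w2) tensor"
  where "tensor_map K V' W' f g =
    tensor_lift K (tensor K V' W') (\<lambda>v w. pure_tensor K V' W' (f v) (g w))"

definition tensor_assoc ::
    "('k, 'c) ring_scheme \<Rightarrow> ('k, 'u, 'x) module_scheme \<Rightarrow> ('k, 'v, 'y) module_scheme
      \<Rightarrow> ('k, 'w, 'z) module_scheme
      \<Rightarrow> ('k, ('k, 'u, 'v) tensor, 'w) tensor \<Rightarrow> ('k, 'u, ('k, 'v, 'w) tensor) tensor"
  where "tensor_assoc K U V W =
    (let T = tensor K U (tensor K V W) in
      tensor_lift K T (\<lambda>t w. tensor_lift K T (\<lambda>u v.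
        pure_tensor K U (tensor K V W) u (pure_tensor K V W v w)) t))"

definition tensor_assoc_inv ::
    "('k, 'c) ring_scheme \<Rightarrow> ('k, 'u, 'x) module_scheme \<Rightarrow> ('k, 'v, 'y) module_scheme
      \<Rightarrow> ('k, 'w, 'z) module_scheme
      \<Rightarrow> ('k, 'u, ('k, 'v, 'w) tensor) tensor \<Rightarrow> ('k, ('k, 'u, 'v) tensor, 'w) tensor"
  where "tensor_assoc_inv K U V W =
    (let T = tensor K (tensor K U V) W in
      tensor_lift K T (\<lambda>u t. tensor_lift K T (\<lambda>v w.
        pure_tensor K (tensor K U V) W (pure_tensor K U V u v) w) t))"


section \<open>Bialgebras\<close>

text \<open>The \<^locale>\<open>algebra\<close> locale of the library is restricted to commutative algebras.\<close>

locale unital_algebra = K?: field K + A?: module K A + ring A for K (structure) and A (structure) +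
  assumes smult_mult_left:
      "\<lbrakk>c \<in> carrier K; x \<in> carrier A; y \<in> carrier A\<rbrakk>
        \<Longrightarrow> (c \<odot>\<^bsub>A\<^esub> x) \<otimes>\<^bsub>A\<^esub> y = c \<odot>\<^bsub>A\<^esub> (x \<otimes>\<^bsub>A\<^esub> y)"
    and smult_mult_right:
      "\<lbrakk>c \<in> carrier K; x \<in> carrier A; y \<in> carrier A\<rbrakk>
        \<Longrightarrow> x \<otimes>\<^bsub>A\<^esub> (c \<odot>\<^bsub>A\<^esub> y) = c \<odot>\<^bsub>A\<^esub> (x \<otimes>\<^bsub>A\<^esub> y)"

record ('k, 'h) bialgebra = "('k, 'h) module" +
  comult :: "'h \<Rightarrow> ('k, 'h, 'h) tensor"
  counit :: "'h \<Rightarrow> 'k"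

locale bialgebra = unital_algebra K H for K (structure) and H :: "('k, 'h, 'x) bialgebra_scheme" (structure) +
  assumes comult_linear: "comult H \<in> lin_maps K H (tensor K H H)"
    and counit_linear: "counit H \<in> lin_maps K H (self_module K)"
    and coassoc: "h \<in> carrier H \<Longrightarrow>
      tensor_assoc K H H H (tensor_map K (tensor K H H) H (comult H) (\<lambda>x. x) (comult H h)) =
      tensor_map K H (tensor K H H) (\<lambda>x. x) (comult H) (comult H h)"
    and counit_left: "h \<in> carrier H \<Longrightarrow>
      tensor_lift K H (\<lambda>h1 h2. counit H h1 \<odot>\<^bsub>H\<^esub> h2) (comult H h) = h"
    and counit_right: "h \<in> carrier H \<Longrightarrow>
      tensor_lift K H (\<lambda>h1 h2. counit H h2 \<odot>\<^bsub>H\<^esub> h1) (comult H h) = h"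
    and comult_mult: "\<lbrakk>h \<in> carrier H; g \<in> carrier H\<rbrakk> \<Longrightarrow>
      comult H (h \<otimes>\<^bsub>H\<^esub> g) =
      tensor_lift K (tensor K H H) (\<lambda>h1 h2. tensor_lift K (tensor K H H) (\<lambda>g1 g2.
        pure_tensor K H H (h1 \<otimes>\<^bsub>H\<^esub> g1) (h2 \<otimes>\<^bsub>H\<^esub> g2)) (comult H g)) (comult H h)"
    and comult_one: "comult H \<one>\<^bsub>H\<^esub> = pure_tensor K H H \<one>\<^bsub>H\<^esub> \<one>\<^bsub>H\<^esub>"
    and counit_mult: "\<lbrakk>h \<in> carrier H; g \<in> carrier H\<rbrakk> \<Longrightarrow>
      counit H (h \<otimes>\<^bsub>H\<^esub> g) = counit H h \<otimes>\<^bsub>K\<^esub> counit H g"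
    and counit_one: "counit H \<one>\<^bsub>H\<^esub> = \<one>\<^bsub>K\<^esub>"

text \<open>
  The dual \<open>H\<^sup>*\<close> as an algebra, with \<open>(l\<^sub>1 l\<^sub>2)(h) = l\<^sub>1(h\<^sub>(\<^sub>2\<^sub>)) l\<^sub>2(h\<^sub>(\<^sub>1\<^sub>))\<close> and unit \<open>\<epsilon>\<close>.  Functionals
  are made extensional (\<^const>\<open>undefined\<close> outside \<open>carrier H\<close>) so that distinct elements of the
  record are distinct functionals.
\<close>

definition dual_algebra ::
    "('k, 'c) ring_scheme \<Rightarrow> ('k, 'h, 'x) bialgebra_scheme \<Rightarrow> ('k, 'h \<Rightarrow> 'k) module"
  where "dual_algebra K H =
    \<lparr>carrier = lin_maps K H (self_module K) \<inter> extensional (carrier H),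
     monoid.mult = (\<lambda>l m. \<lambda>h\<in>carrier H.
       tensor_lift K (self_module K) (\<lambda>h1 h2. l h2 \<otimes>\<^bsub>K\<^esub> m h1) (comult H h)),
     one = restrict (counit H) (carrier H),
     zero = (\<lambda>h\<in>carrier H. \<zero>\<^bsub>K\<^esub>),
     add = (\<lambda>l m. \<lambda>h\<in>carrier H. l h \<oplus>\<^bsub>K\<^esub> m h),
     smult = (\<lambda>c l. \<lambda>h\<in>carrier H. c \<otimes>\<^bsub>K\<^esub> l h)\<rparr>"

text \<open>
  The comultiplication \<open>l \<mapsto> l\<^sub>(\<^sub>1\<^sub>) \<otimes> l\<^sub>(\<^sub>2\<^sub>)\<close> of \<open>H\<^sup>*\<close> is determined by
  \<open>l(h h') = l\<^sub>(\<^sub>1\<^sub>)(h') l\<^sub>(\<^sub>2\<^sub>)(h)\<close>.  Uniqueness always holds; existence uses that \<open>H\<close> is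
  finite-dimensional.
\<close>

definition dual_comult ::
    "('k, 'c) ring_scheme \<Rightarrow> ('k, 'h, 'x) bialgebra_scheme \<Rightarrow> ('h \<Rightarrow> 'k)
      \<Rightarrow> ('k, 'h \<Rightarrow> 'k, 'h \<Rightarrow> 'k) tensor"
  where "dual_comult K H l =
    (THE D. D \<in> carrier (tensor K (dual_algebra K H) (dual_algebra K H)) \<and>
      (\<forall>h\<in>carrier H. \<forall>h'\<in>carrier H.
        l (h \<otimes>\<^bsub>H\<^esub> h') = tensor_lift K (self_module K) (\<lambda>l1 l2. l1 h' \<otimes>\<^bsub>K\<^esub> l2 h) D))"


section \<open>Yetter-Drinfel'd module algebras\<close>

record ('k, 'h, 'v) yd_module_algebra = "('k, 'v) module" +
  act :: "'h \<Rightarrow> 'v \<Rightarrow> 'v"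
  coact :: "'v \<Rightarrow> ('k, 'v, 'h) tensor"

locale yd_module_algebra = H?: bialgebra K H + V?: unital_algebra K V
  for K (structure) and H (structure) and V :: "('k, 'h, 'v, 'y) yd_module_algebra_scheme" (structure) +
  assumes act_linear: "h \<in> carrier H \<Longrightarrow> act V h \<in> lin_maps K V V"
    and act_add: "\<lbrakk>h \<in> carrier H; g \<in> carrier H; v \<in> carrier V\<rbrakk> \<Longrightarrow>
      act V (h \<oplus>\<^bsub>H\<^esub> g) v = act V h v \<oplus>\<^bsub>V\<^esub> act V g v"
    and act_smult: "\<lbrakk>c \<in> carrier K; h \<in> carrier H; v \<in> carrier V\<rbrakk> \<Longrightarrow>
      act V (c \<odot>\<^bsub>H\<^esub> h) v = c \<odot>\<^bsub>V\<^esub> act V h v"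
    and act_mult: "\<lbrakk>h \<in> carrier H; g \<in> carrier H; v \<in> carrier V\<rbrakk> \<Longrightarrow>
      act V (h \<otimes>\<^bsub>H\<^esub> g) v = act V h (act V g v)"
    and act_one: "v \<in> carrier V \<Longrightarrow> act V \<one>\<^bsub>H\<^esub> v = v"
    and coact_linear: "coact V \<in> lin_maps K V (tensor K V H)"
    and coact_coassoc: "v \<in> carrier V \<Longrightarrow>
      tensor_assoc K V H H (tensor_map K (tensor K V H) H (coact V) (\<lambda>x. x) (coact V v)) =
      tensor_map K V (tensor K H H) (\<lambda>x. x) (comult H) (coact V v)"
    and coact_counit: "v \<in> carrier V \<Longrightarrow>
      tensor_lift K V (\<lambda>v0 v1. counit H v1 \<odot>\<^bsub>V\<^esub> v0) (coact V v) = v"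
    and yetter_drinfeld: "\<lbrakk>h \<in> carrier H; v \<in> carrier V\<rbrakk> \<Longrightarrow>
      tensor_lift K (tensor K V H) (\<lambda>h1 h2. tensor_lift K (tensor K V H) (\<lambda>w0 w1.
        pure_tensor K V H w0 (w1 \<otimes>\<^bsub>H\<^esub> h1)) (coact V (act V h2 v))) (comult H h) =
      tensor_lift K (tensor K V H) (\<lambda>h1 h2. tensor_lift K (tensor K V H) (\<lambda>v0 v1.
        pure_tensor K V H (act V h1 v0) (h2 \<otimes>\<^bsub>H\<^esub> v1)) (coact V v)) (comult H h)"
    and coact_mult: "\<lbrakk>v \<in> carrier V; w \<in> carrier V\<rbrakk> \<Longrightarrow>
      coact V (v \<otimes>\<^bsub>V\<^esub> w) =
      tensor_lift K (tensor K V H) (\<lambda>v0 v1. tensor_lift K (tensor K V H) (\<lambda>w0 w1.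
        pure_tensor K V H (v0 \<otimes>\<^bsub>V\<^esub> w0) (v1 \<otimes>\<^bsub>H\<^esub> w1)) (coact V w)) (coact V v)"
    and act_alg_mult: "\<lbrakk>h \<in> carrier H; v \<in> carrier V; w \<in> carrier V\<rbrakk> \<Longrightarrow>
      act V h (v \<otimes>\<^bsub>V\<^esub> w) =
      tensor_lift K V (\<lambda>h1 h2. act V h2 v \<otimes>\<^bsub>V\<^esub> act V h1 w) (comult H h)"
    and coact_alg_one: "coact V \<one>\<^bsub>V\<^esub> = pure_tensor K V H \<one>\<^bsub>V\<^esub> \<one>\<^bsub>H\<^esub>"
    and act_alg_one: "h \<in> carrier H \<Longrightarrow> act V h \<one>\<^bsub>V\<^esub> = counit H h \<odot>\<^bsub>V\<^esub> \<one>\<^bsub>V\<^esub>"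


section \<open>Braided systems of vector spaces\<close>

text \<open>
  The members of a rank \<open>t\<close> system are numbered \<open>0, \<dots>, t - 1\<close>; the values \<open>\<sigma> i j\<close> for \<open>i > j\<close>
  are irrelevant.  Both sides of the colored Yang-Baxter equation are maps
  \<open>(V\<^sub>i \<otimes> V\<^sub>j) \<otimes> V\<^sub>k \<rightarrow> (V\<^sub>k \<otimes> V\<^sub>j) \<otimes> V\<^sub>i\<close>, with the associativity isomorphisms written out.
\<close>

definition braided_system ::
    "('k, 'c) ring_scheme \<Rightarrow> nat \<Rightarrow> (nat \<Rightarrow> ('k, 'v, 'x) module_scheme)
      \<Rightarrow> (nat \<Rightarrow> nat \<Rightarrow> ('k, 'v, 'v) tensor \<Rightarrow> ('k, 'v, 'v) tensor) \<Rightarrow> bool"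
  where "braided_system K t V \<sigma> \<longleftrightarrow>
    (\<forall>i<t. module K (V i)) \<and>
    (\<forall>i j. i \<le> j \<and> j < t \<longrightarrow> \<sigma> i j \<in> lin_maps K (tensor K (V i) (V j)) (tensor K (V j) (V i))) \<and>
    (\<forall>i j k. i \<le> j \<and> j \<le> k \<and> k < t \<longrightarrow>
      (\<forall>x \<in> carrier (tensor K (tensor K (V i) (V j)) (V k)).
        (tensor_map K (tensor K (V k) (V j)) (V i) (\<sigma> j k) (\<lambda>y. y) \<circ>
         tensor_assoc_inv K (V j) (V k) (V i) \<circ>
         tensor_map K (V j) (tensor K (V k) (V i)) (\<lambda>y. y) (\<sigma> i k) \<circ>
         tensor_assoc K (V j) (V i) (V k) \<circ>
         tensor_map K (tensor K (V j) (V i)) (V k) (\<sigma> i j) (\<lambda>y. y)) x =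
        (tensor_assoc_inv K (V k) (V j) (V i) \<circ>
         tensor_map K (V k) (tensor K (V j) (V i)) (\<lambda>y. y) (\<sigma> i j) \<circ>
         tensor_assoc K (V k) (V i) (V j) \<circ>
         tensor_map K (tensor K (V k) (V i)) (V j) (\<sigma> i k) (\<lambda>y. y) \<circ>
         tensor_assoc_inv K (V i) (V k) (V j) \<circ>
         tensor_map K (V i) (tensor K (V k) (V j)) (\<lambda>y. y) (\<sigma> j k) \<circ>
         tensor_assoc K (V i) (V j) (V k)) x))"

text \<open>
  The system \<open>(H, M\<^sub>1, \<dots>, M\<^sub>r, H\<^sup>*)\<close>: its members are given isomorphic copies inside one common
  type, so that they form a family indexed by \<^typ>\<open>nat\<close>, with \<open>H\<close> in position \<open>0\<close>, \<open>M\<^sub>i\<close> in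
  position \<open>i\<close> and \<open>H\<^sup>*\<close> in position \<open>r + 1\<close>.
\<close>

datatype ('k, 'h, 'm) member = InH 'h | InM 'm | InDual "'h \<Rightarrow> 'k"

definition yd_system ::
    "('k, 'c) ring_scheme \<Rightarrow> ('k, 'h, 'x) bialgebra_scheme \<Rightarrow> nat
      \<Rightarrow> (nat \<Rightarrow> ('k, 'h, 'm, 'y) yd_module_algebra_scheme) \<Rightarrow> nat \<Rightarrow> ('k, ('k, 'h, 'm) member) module"
  where "yd_system K H r M i =
    (if i = 0 then image_module InH H
     else if i \<le> r then image_module InM (M i)
     else image_module InDual (dual_algebra K H))"

end

theory Submission
  imports Defs
begin

text \<open>
  All braidings between two different members of the system come from one construction.  If \<open>X\<close> carries a
  coaction \<open>a \<mapsto> a\<^sub>0 \<otimes> a\<^sub>1 \<in> X \<otimes> H\<close> and \<open>Y\<close> an action of \<open>H\<close>, there is the crossing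
  \<open>a \<otimes> b \<mapsto> a\<^sub>1b \<otimes> a\<^sub>0\<close> from \<open>X \<otimes> Y\<close> to \<open>Y \<otimes> X\<close> (\<open>cross_braid\<close>).  The bialgebra \<open>H\<close> coacts on
  itself by its comultiplication, and it acts on \<open>H\<^sup>*\<close> by \<open>(h l)(x) = l(xh)\<close>; the formula that determines
  the comultiplication of \<open>H\<^sup>*\<close> says that \<open>h l = l\<^sub>1(h) l\<^sub>2\<close>, so the braidings that involve \<open>H\<close> or
  \<open>H\<^sup>*\<close> are crossings as well.  Every member but the last one coacts, every member but the first one is
  acted on, and all of them are algebras compatible with these structures.

  For \<open>i \<le> j \<le> k\<close> the Yang-Baxter equation depends only on which of the indices coincide.
  For \<open>i = j = k\<close> it is associativity (\<open>ybe_unit_mult\<close>, \<open>ybe_mult_unit\<close>).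
  For \<open>i = j < k\<close> it says that the coaction of the first member is multiplicative (\<open>ybe_cross_left\<close>).
  For \<open>i < j = k\<close> it says, up to coassociativity, that \<open>h(bc) = (h\<^sub>2b)(h\<^sub>1c)\<close> (\<open>ybe_cross_right\<close>).
  For \<open>i < j < k\<close> the two sides agree up to coassociativity and the Yetter-Drinfel'd condition of the
  middle member (\<open>ybe_cross_cross\<close>).

  These computations are the usual ones in Sweedler notation, written as nested applications of
  \<^const>\<open>tensor_lift\<close>; \<open>ybeI\<close> brings the Yang-Baxter equation, associators included, into this form.
  The finite dimension of \<open>H\<close> is used through a dual basis, which makes the comultiplication of \<open>H\<^sup>*\<close>
  well defined (\<open>dual_comult_ex1\<close>).
\<close>

section \<open>Linear maps, quotients and free modules\<close>

lemma lin_mapsI: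
  assumes "\<And>x. x \<in> carrier V \<Longrightarrow> f x \<in> carrier W"
    and "\<And>x y. x \<in> carrier V \<Longrightarrow> y \<in> carrier V \<Longrightarrow> f (x \<oplus>\<^bsub>V\<^esub> y) = f x \<oplus>\<^bsub>W\<^esub> f y"
    and "\<And>c x. c \<in> carrier K \<Longrightarrow> x \<in> carrier V \<Longrightarrow> f (c \<odot>\<^bsub>V\<^esub> x) = c \<odot>\<^bsub>W\<^esub> f x"
  shows "f \<in> lin_maps K V W"
  using assms by (auto simp: lin_maps_def)

lemma lin_maps_closed: "f \<in> lin_maps K V W \<Longrightarrow> x \<in> carrier V \<Longrightarrow> f x \<in> carrier W"
  by (auto simp: lin_maps_def)

lemma lin_maps_add:
  "f \<in> lin_maps K V W \<Longrightarrow> x \<in> carrier V \<Longrightarrow> y \<in> carrier V \<Longrightarrow> f (x \<oplus>\<^bsub>V\<^esub> y) = f x \<oplus>\<^bsub>W\<^esub> f y"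
  by (auto simp: lin_maps_def)

lemma lin_maps_smult:
  "f \<in> lin_maps K V W \<Longrightarrow> c \<in> carrier K \<Longrightarrow> x \<in> carrier V \<Longrightarrow> f (c \<odot>\<^bsub>V\<^esub> x) = c \<odot>\<^bsub>W\<^esub> f x"
  by (auto simp: lin_maps_def)

lemma lin_maps_zero:
  assumes "module K V" "module K W" "f \<in> lin_maps K V W"
  shows "f \<zero>\<^bsub>V\<^esub> = \<zero>\<^bsub>W\<^esub>"
proof -
  interpret V: module K V by fact
  interpret W: module K W by fact
  have "f \<zero>\<^bsub>V\<^esub> = f (\<zero>\<^bsub>K\<^esub> \<odot>\<^bsub>V\<^esub> \<zero>\<^bsub>V\<^esub>)" by simp
  also have "\<dots> = \<zero>\<^bsub>K\<^esub> \<odot>\<^bsub>W\<^esub> f \<zero>\<^bsub>V\<^esub>"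
    using assms(3) by (intro lin_maps_smult) auto
  also have "\<dots> = \<zero>\<^bsub>W\<^esub>" using lin_maps_closed[OF assms(3)] by simp
  finally show ?thesis .
qed

lemma lin_maps_neg:
  assumes "module K V" "module K W" "f \<in> lin_maps K V W" "x \<in> carrier V"
  shows "f (\<ominus>\<^bsub>V\<^esub> x) = \<ominus>\<^bsub>W\<^esub> f x"
proof -
  interpret V: module K V by fact
  interpret W: module K W by fact
  have "f (\<ominus>\<^bsub>V\<^esub> x) \<oplus>\<^bsub>W\<^esub> f x = f (\<ominus>\<^bsub>V\<^esub> x \<oplus>\<^bsub>V\<^esub> x)"
    using assms(4) by (simp add: lin_maps_add[OF assms(3)])
  also have "\<dots> = \<zero>\<^bsub>W\<^esub>" using assms by (simp add: V.M.l_neg lin_maps_zero)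
  finally show ?thesis
    using lin_maps_closed[OF assms(3)] assms(4) by (metis V.M.a_inv_closed W.M.minus_equality)
qed

lemma lin_kernel_submodule:
  assumes "module K V" "module K W" "f \<in> lin_maps K V W"
  shows "submodule {x \<in> carrier V. f x = \<zero>\<^bsub>W\<^esub>} K V"
proof -
  interpret V: module K V by fact
  interpret W: module K W by fact
  show ?thesis
    by (rule V.submoduleI)
      (auto simp: lin_maps_zero[OF assms] lin_maps_neg[OF assms] lin_maps_add[OF assms(3)]
        lin_maps_smult[OF assms(3)])
qed

lemma lin_span_submodule:
  assumes "module K V" "S \<subseteq> carrier V"
  shows "submodule (lin_span K V S) K V"
proof -
  interpret V: module K V by fact
  show ?thesis
  proof (rule V.submoduleI)
    show "lin_span K V S \<subseteq> carrier V"
      using V.carrier_is_submodule assms(2) by (auto simp: lin_span_def)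
  qed (auto simp: lin_span_def V.submoduleE subgroup.one_closed[OF submodule.axioms(1), simplified]
      submodule.smult_closed)
qed

lemma lin_span_least: "submodule N K V \<Longrightarrow> S \<subseteq> N \<Longrightarrow> lin_span K V S \<subseteq> N"
  by (auto simp: lin_span_def)

lemma lin_span_superset: "S \<subseteq> lin_span K V S"
  by (auto simp: lin_span_def)

lemma quotient_module_carrier: "carrier (quotient_module K V N) = (\<lambda>v. N +>\<^bsub>V\<^esub> v) ` carrier V"
  by (auto simp: quotient_module_def A_RCOSETS_def')

lemma submodule_abelian_subgroup:
  assumes "module K V" "submodule N K V"
  shows "abelian_subgroup N V"
proof -
  interpret V: module K V by fact
  show ?thesis
    by (rule abelian_subgroupI3[OF additive_subgroupI])
      (use assms submodule.axioms V.abelian_group_axioms in auto)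
qed

lemma quotient_proj_add:
  assumes "module K V" "submodule N K V" "x \<in> carrier V" "y \<in> carrier V"
  shows "(N +>\<^bsub>V\<^esub> x) \<oplus>\<^bsub>quotient_module K V N\<^esub> (N +>\<^bsub>V\<^esub> y) = N +>\<^bsub>V\<^esub> (x \<oplus>\<^bsub>V\<^esub> y)"
  using abelian_subgroup.a_rcos_sum[OF submodule_abelian_subgroup[OF assms(1,2)] assms(3,4)]
  by (simp add: quotient_module_def)

lemma quotient_proj_smult:
  assumes "module K V" "submodule N K V" "c \<in> carrier K" "x \<in> carrier V"
  shows "c \<odot>\<^bsub>quotient_module K V N\<^esub> (N +>\<^bsub>V\<^esub> x) = N +>\<^bsub>V\<^esub> (c \<odot>\<^bsub>V\<^esub> x)"
proof -
  interpret V: module K V by fact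
  interpret N: abelian_subgroup N V by (rule submodule_abelian_subgroup[OF assms(1,2)])
  have "N +>\<^bsub>V\<^esub> (c \<odot>\<^bsub>V\<^esub> y) = N +>\<^bsub>V\<^esub> (c \<odot>\<^bsub>V\<^esub> x)" if y: "y \<in> N +>\<^bsub>V\<^esub> x" for y
  proof -
    obtain n where n: "n \<in> N" "y = n \<oplus>\<^bsub>V\<^esub> x" using y by (auto simp: a_r_coset_def')
    have "n \<in> carrier V" using n N.a_subset by blast
    then have "c \<odot>\<^bsub>V\<^esub> y = c \<odot>\<^bsub>V\<^esub> n \<oplus>\<^bsub>V\<^esub> c \<odot>\<^bsub>V\<^esub> x"
      using n assms V.smult_r_distr by simp
    moreover have "c \<odot>\<^bsub>V\<^esub> n \<in> N" using submodule.smult_closed[OF assms(2,3)] n by blast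
    ultimately have "c \<odot>\<^bsub>V\<^esub> y \<in> N +>\<^bsub>V\<^esub> (c \<odot>\<^bsub>V\<^esub> x)" by (auto simp: a_r_coset_def')
    then show ?thesis
      using V.a_repr_independence[OF _ _ N.a_subgroup] assms by simp
  qed
  moreover have "N +>\<^bsub>V\<^esub> x \<noteq> {}" using N.a_rcos_self[OF assms(4)] by blast
  ultimately show ?thesis by (simp add: quotient_module_def)
qed

lemma quotient_proj_eq:
  assumes "module K V" "submodule N K V" "x \<in> carrier V" "y \<in> carrier V" "x \<ominus>\<^bsub>V\<^esub> y \<in> N"
  shows "N +>\<^bsub>V\<^esub> x = N +>\<^bsub>V\<^esub> y"
proof -
  interpret V: module K V by fact
  interpret N: abelian_subgroup N V by (rule submodule_abelian_subgroup[OF assms(1,2)])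
  have "x = (x \<ominus>\<^bsub>V\<^esub> y) \<oplus>\<^bsub>V\<^esub> y"
    using assms by (simp add: a_minus_def V.M.a_assoc V.M.l_neg)
  then have "x \<in> N +>\<^bsub>V\<^esub> y" using assms(5) by (auto simp: a_r_coset_def')
  then show ?thesis
    using V.a_repr_independence[OF _ _ N.a_subgroup] assms by simp
qed

lemma quotient_module_module:
  assumes "module K V" "submodule N K V"
  shows "module K (quotient_module K V N)"
proof -
  let ?Q = "quotient_module K V N"
  interpret V: module K V by fact
  interpret N: abelian_subgroup N V by (rule submodule_abelian_subgroup[OF assms(1,2)])
  note [simp] = quotient_proj_add[OF assms] quotient_proj_smult[OF assms]
  have z: "\<zero>\<^bsub>?Q\<^esub> = N +>\<^bsub>V\<^esub> \<zero>\<^bsub>V\<^esub>"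
    using N.a_subset by (simp add: quotient_module_def)
  show ?thesis
  proof (rule moduleI)
    show "cring K" by (rule V.R.is_cring)
    show "abelian_group (?Q)"
    proof (rule abelian_groupI)
      fix X assume "X \<in> carrier (?Q)"
      then obtain x where x: "x \<in> carrier V" "X = N +>\<^bsub>V\<^esub> x" by (auto simp: quotient_module_carrier)
      have "(N +>\<^bsub>V\<^esub> (\<ominus>\<^bsub>V\<^esub> x)) \<oplus>\<^bsub>?Q\<^esub> X = \<zero>\<^bsub>?Q\<^esub>"
        using x by (simp add: z V.M.l_neg)
      then show "\<exists>Y\<in>carrier (?Q). Y \<oplus>\<^bsub>?Q\<^esub> X = \<zero>\<^bsub>?Q\<^esub>"
        using x by (auto simp: quotient_module_carrier intro!: bexI)
    qed (auto simp: quotient_module_carrier z V.M.a_ac intro!: imageI)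
  qed (auto simp: quotient_module_carrier V.smult_l_distr V.smult_r_distr V.smult_assoc1 intro!: imageI)
qed

lemma quotient_proj_lin:
  assumes "module K V" "submodule N K V"
  shows "(\<lambda>x. N +>\<^bsub>V\<^esub> x) \<in> lin_maps K V (quotient_module K V N)"
  by (rule lin_mapsI)
    (auto simp: quotient_module_carrier quotient_proj_add[OF assms] quotient_proj_smult[OF assms])

lemma free_module_module:
  fixes K :: "('k, 'c) ring_scheme" and I :: "'i set"
  assumes "cring K" shows "module K (free_module K I)"
proof -
  let ?F = "free_module K I"
  interpret cring K by fact
  note [simp] = free_module_def
  have sm: "finite {i. c \<otimes>\<^bsub>K\<^esub> \<psi> i \<noteq> \<zero>\<^bsub>K\<^esub>}" if "finite {i. \<psi> i \<noteq> \<zero>\<^bsub>K\<^esub>}" "c \<in> carrier K"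
    for c and \<psi> :: "'i \<Rightarrow> 'k"
    by (rule finite_subset[of _ "{i. \<psi> i \<noteq> \<zero>\<^bsub>K\<^esub>}"]) (use that in auto)
  show ?thesis
  proof (rule moduleI)
    show "abelian_group (?F)"
    proof (rule abelian_groupI)
      fix x assume x: "x \<in> carrier (?F)"
      show "\<exists>y\<in>carrier (?F). y \<oplus>\<^bsub>?F\<^esub> x = \<zero>\<^bsub>?F\<^esub>"
      proof (rule bexI)
        show "(\<lambda>i. \<ominus>\<^bsub>K\<^esub> x i) \<oplus>\<^bsub>?F\<^esub> x = \<zero>\<^bsub>?F\<^esub>"
          using x by (auto simp: l_neg)
        have "{i. \<ominus>\<^bsub>K\<^esub> x i \<noteq> \<zero>\<^bsub>K\<^esub>} \<subseteq> {i. x i \<noteq> \<zero>\<^bsub>K\<^esub>}" by auto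
        then show "(\<lambda>i. \<ominus>\<^bsub>K\<^esub> x i) \<in> carrier (?F)"
          using x by (auto intro: finite_subset)
      qed
    next
      fix x y assume xy: "x \<in> carrier (?F)" "y \<in> carrier (?F)"
      let ?S = "{i. x i \<noteq> \<zero>\<^bsub>K\<^esub>} \<union> {i. y i \<noteq> \<zero>\<^bsub>K\<^esub>}"
      have sub: "{i. x i \<oplus>\<^bsub>K\<^esub> y i \<noteq> \<zero>\<^bsub>K\<^esub>} \<subseteq> ?S" by auto
      have S: "finite ?S" "?S \<subseteq> I" "\<And>i. x i \<oplus>\<^bsub>K\<^esub> y i \<in> carrier K" using xy by auto
      show "x \<oplus>\<^bsub>?F\<^esub> y \<in> carrier (?F)"
        using finite_subset[OF sub S(1)] subset_trans[OF sub S(2)] S(3) by simp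
    qed (auto simp: a_ac fun_eq_iff)
  next
    fix c x assume "c \<in> carrier K" "x \<in> carrier (?F)"
    then show "c \<odot>\<^bsub>?F\<^esub> x \<in> carrier (?F)"
      using sm[of x c] by fastforce
  qed (auto simp: is_cring l_distr r_distr m_assoc fun_eq_iff)
qed

lemma free_gen_closed: "cring K \<Longrightarrow> i \<in> I \<Longrightarrow> free_gen K i \<in> carrier (free_module K I)"
proof -
  assume "cring K" and i: "i \<in> I"
  interpret cring K by fact
  have "{j. free_gen K i j \<noteq> \<zero>\<^bsub>K\<^esub>} \<subseteq> {i}" by (auto simp: free_gen_def)
  then show ?thesis using i by (auto simp: free_module_def free_gen_def intro: finite_subset)
qed

text \<open>
  An element of a free module is built from \<open>0\<close> by adding one multiple of a generator at a time, since its
  support is finite.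
\<close>

lemma free_module_induct [consumes 2, case_names zero step]:
  assumes "cring K" and "\<phi> \<in> carrier (free_module K I)"
    and z: "P \<zero>\<^bsub>free_module K I\<^esub>"
    and s: "\<And>c i \<psi>. c \<in> carrier K \<Longrightarrow> i \<in> I \<Longrightarrow> \<psi> \<in> carrier (free_module K I) \<Longrightarrow> P \<psi> \<Longrightarrow>
      P (c \<odot>\<^bsub>free_module K I\<^esub> free_gen K i \<oplus>\<^bsub>free_module K I\<^esub> \<psi>)"
  shows "P \<phi>"
proof -
  let ?F = "free_module K I"
  interpret cring K by fact
  have "\<forall>\<phi> \<in> carrier (?F). {i. \<phi> i \<noteq> \<zero>\<^bsub>K\<^esub>} \<subseteq> A \<longrightarrow> P \<phi>" if "finite A" for A
    using that
  proof (induction A)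
    case empty
    have "\<phi> = \<zero>\<^bsub>?F\<^esub>" if "\<phi> \<in> carrier (?F)" "{i. \<phi> i \<noteq> \<zero>\<^bsub>K\<^esub>} \<subseteq> {}" for \<phi>
      using that by (auto simp: free_module_def)
    then show ?case using z by blast
  next
    case (insert a A)
    show ?case
    proof (intro ballI impI)
      fix \<phi> assume p: "\<phi> \<in> carrier (?F)" "{i. \<phi> i \<noteq> \<zero>\<^bsub>K\<^esub>} \<subseteq> insert a A"
      show "P \<phi>"
      proof (cases "\<phi> a = \<zero>\<^bsub>K\<^esub>")
        case True
        then show ?thesis using p insert by blast
      next
        case False
        let ?\<psi> = "\<phi>(a := \<zero>\<^bsub>K\<^esub>)"
        have a: "a \<in> I" using p False by (auto simp: free_module_def)
        have sub: "{i. ?\<psi> i \<noteq> \<zero>\<^bsub>K\<^esub>} \<subseteq> {i. \<phi> i \<noteq> \<zero>\<^bsub>K\<^esub>}" by auto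
        have psi: "?\<psi> \<in> carrier (?F)"
          using p finite_subset[OF sub] by (auto simp: free_module_def)
        have "{i. ?\<psi> i \<noteq> \<zero>\<^bsub>K\<^esub>} \<subseteq> A" using p by auto
        then have "P ?\<psi>" using insert.IH psi by blast
        moreover have "\<phi> = \<phi> a \<odot>\<^bsub>?F\<^esub> free_gen K a \<oplus>\<^bsub>?F\<^esub> ?\<psi>"
          using p by (auto simp: free_module_def free_gen_def fun_eq_iff)
        moreover have "\<phi> a \<in> carrier K" using p by (auto simp: free_module_def)
        ultimately show ?thesis using s[OF _ a psi] by metis
      qed
    qed
  qed
  then show ?thesis using assms(2) by (auto simp: free_module_def)
qed

text \<open>
  The linear extension to the free module of a function \<open>f\<close> on its generators.  The sum is taken over the support
  exactly as in \<^const>\<open>tensor_lift\<close>.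
\<close>

definition free_eval where
  "free_eval K U f \<phi> = (\<Oplus>\<^bsub>U\<^esub>p\<in>{p. \<phi> p \<noteq> \<zero>\<^bsub>K\<^esub>}. \<phi> p \<odot>\<^bsub>U\<^esub> f p)"

lemma free_eval_superset:
  assumes "module K U" "\<phi> \<in> carrier (free_module K I)" "f \<in> I \<rightarrow> carrier U"
    "finite A" "{p. \<phi> p \<noteq> \<zero>\<^bsub>K\<^esub>} \<subseteq> A" "A \<subseteq> I"
  shows "free_eval K U f \<phi> = (\<Oplus>\<^bsub>U\<^esub>p\<in>A. \<phi> p \<odot>\<^bsub>U\<^esub> f p)"
proof -
  interpret U: module K U by fact
  have c: "\<And>p. \<phi> p \<in> carrier K" using assms(2) by (auto simp: free_module_def)
  have m: "\<phi> p \<odot>\<^bsub>U\<^esub> f p \<in> carrier U" if "p \<in> A" for p using assms(3,6) c that by auto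
  have m': "\<phi> p \<odot>\<^bsub>U\<^esub> f p \<in> carrier U" if "\<phi> p \<noteq> \<zero>\<^bsub>K\<^esub>" for p using assms(5) m that by auto
  have d: "A = {p. \<phi> p \<noteq> \<zero>\<^bsub>K\<^esub>} \<union> (A - {p. \<phi> p \<noteq> \<zero>\<^bsub>K\<^esub>})" using assms by auto
  have "(\<Oplus>\<^bsub>U\<^esub>p\<in>A. \<phi> p \<odot>\<^bsub>U\<^esub> f p) =
    free_eval K U f \<phi> \<oplus>\<^bsub>U\<^esub> (\<Oplus>\<^bsub>U\<^esub>p\<in>A - {p. \<phi> p \<noteq> \<zero>\<^bsub>K\<^esub>}. \<phi> p \<odot>\<^bsub>U\<^esub> f p)"
    unfolding free_eval_def
    by (subst d, rule U.finsum_Un_disjoint) (use assms m m' in \<open>auto intro: finite_subset\<close>)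
  also have "(\<Oplus>\<^bsub>U\<^esub>p\<in>A - {p. \<phi> p \<noteq> \<zero>\<^bsub>K\<^esub>}. \<phi> p \<odot>\<^bsub>U\<^esub> f p) = \<zero>\<^bsub>U\<^esub>"
    by (rule U.M.add.finprod_one_eqI) (use assms in \<open>auto simp: Pi_iff subset_iff\<close>)
  moreover have "free_eval K U f \<phi> \<in> carrier U"
    unfolding free_eval_def by (rule U.finsum_closed) (use m' in auto)
  ultimately show ?thesis by simp
qed

lemma free_eval_lin:
  assumes "module K U" "f \<in> I \<rightarrow> carrier U"
  shows "free_eval K U f \<in> lin_maps K (free_module K I) U"
proof -
  let ?F = "free_module K I"
  interpret U: module K U by fact
  interpret F: module K ?F by (rule free_module_module) (rule U.R.is_cring)
  let ?S = "\<lambda>\<phi>. {p. \<phi> p \<noteq> \<zero>\<^bsub>K\<^esub>}"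
  have S: "finite (?S \<phi>)" "?S \<phi> \<subseteq> I" "\<And>p. \<phi> p \<in> carrier K" if "\<phi> \<in> carrier (?F)" for \<phi>
    using that by (auto simp: free_module_def)
  show ?thesis
  proof (rule lin_mapsI)
    fix x assume x: "x \<in> carrier (?F)"
    show "free_eval K U f x \<in> carrier U"
      unfolding free_eval_def by (rule U.finsum_closed) (use assms S[OF x] in auto)
    fix c assume c: "c \<in> carrier K"
    have cx: "c \<odot>\<^bsub>?F\<^esub> x \<in> carrier (?F)" using x c by simp
    have "free_eval K U f (c \<odot>\<^bsub>?F\<^esub> x) =
      (\<Oplus>\<^bsub>U\<^esub>p\<in>?S x. (c \<odot>\<^bsub>?F\<^esub> x) p \<odot>\<^bsub>U\<^esub> f p)"
      by (rule free_eval_superset[OF assms(1) cx assms(2)])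
        (use S[OF x] c in \<open>auto simp: free_module_def\<close>)
    also have "\<dots> = (\<Oplus>\<^bsub>U\<^esub>p\<in>?S x. c \<odot>\<^bsub>U\<^esub> (x p \<odot>\<^bsub>U\<^esub> f p))"
      by (rule U.finsum_cong') (use S[OF x] c assms(2) in \<open>auto simp: free_module_def U.smult_assoc1 Pi_iff subset_iff\<close>)
    also have "\<dots> = c \<odot>\<^bsub>U\<^esub> free_eval K U f x"
      unfolding free_eval_def
      by (rule U.finsum_smult_ldistr[symmetric]) (use S[OF x] c assms(2) in auto)
    finally show "free_eval K U f (c \<odot>\<^bsub>?F\<^esub> x) = c \<odot>\<^bsub>U\<^esub> free_eval K U f x" .
  next
    fix x y assume x: "x \<in> carrier (?F)" and y: "y \<in> carrier (?F)"
    then have xy: "x \<oplus>\<^bsub>?F\<^esub> y \<in> carrier (?F)" by simp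
    let ?A = "?S x \<union> ?S y"
    have A: "finite ?A" "?A \<subseteq> I" using S[OF x] S[OF y] by auto
    have "free_eval K U f (x \<oplus>\<^bsub>?F\<^esub> y) =
      (\<Oplus>\<^bsub>U\<^esub>p\<in>?A. (x \<oplus>\<^bsub>?F\<^esub> y) p \<odot>\<^bsub>U\<^esub> f p)"
      by (rule free_eval_superset[OF assms(1) xy assms(2)]) (use A in \<open>auto simp: free_module_def\<close>)
    also have "\<dots> = (\<Oplus>\<^bsub>U\<^esub>p\<in>?A. x p \<odot>\<^bsub>U\<^esub> f p \<oplus>\<^bsub>U\<^esub> y p \<odot>\<^bsub>U\<^esub> f p)"
      by (rule U.finsum_cong') (use S[OF x] S[OF y] assms(2) in \<open>auto simp: free_module_def U.smult_l_distr Pi_iff subset_iff\<close>)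
    also have "\<dots> = (\<Oplus>\<^bsub>U\<^esub>p\<in>?A. x p \<odot>\<^bsub>U\<^esub> f p) \<oplus>\<^bsub>U\<^esub> (\<Oplus>\<^bsub>U\<^esub>p\<in>?A. y p \<odot>\<^bsub>U\<^esub> f p)"
      by (rule U.finsum_addf) (use A S[OF x] S[OF y] assms(2) in \<open>auto simp: Pi_iff subset_iff\<close>)
    also have "(\<Oplus>\<^bsub>U\<^esub>p\<in>?A. x p \<odot>\<^bsub>U\<^esub> f p) = free_eval K U f x"
      by (rule free_eval_superset[symmetric]) (use A assms x in auto)
    also have "(\<Oplus>\<^bsub>U\<^esub>p\<in>?A. y p \<odot>\<^bsub>U\<^esub> f p) = free_eval K U f y"
      by (rule free_eval_superset[symmetric]) (use A assms y in auto)
    finally show "free_eval K U f (x \<oplus>\<^bsub>?F\<^esub> y) = free_eval K U f x \<oplus>\<^bsub>U\<^esub> free_eval K U f y" .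
  qed
qed

lemma free_eval_gen:
  assumes "module K U" "f \<in> I \<rightarrow> carrier U" "i \<in> I"
  shows "free_eval K U f (free_gen K i) = f i"
proof -
  interpret U: module K U by fact
  have fi: "f i \<in> carrier U" using assms by auto
  have "free_eval K U f (free_gen K i) = (\<Oplus>\<^bsub>U\<^esub>p\<in>{i}. free_gen K i p \<odot>\<^bsub>U\<^esub> f p)"
    by (rule free_eval_superset[OF assms(1) free_gen_closed assms(2)])
      (use assms U.R.is_cring in \<open>auto simp: free_gen_def\<close>)
  also have "\<dots> = f i" using fi by (simp add: free_gen_def)
  finally show ?thesis .
qed

section \<open>The universal property of the tensor product\<close>

definition bilin where
  "bilin K V W U f \<longleftrightarrow>
    (\<forall>w\<in>carrier W. (\<lambda>v. f v w) \<in> lin_maps K V U) \<and> (\<forall>v\<in>carrier V. (\<lambda>w. f v w) \<in> lin_maps K W U)"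

lemma bilinI:
  "(\<And>w. w \<in> carrier W \<Longrightarrow> (\<lambda>v. f v w) \<in> lin_maps K V U) \<Longrightarrow>
   (\<And>v. v \<in> carrier V \<Longrightarrow> (\<lambda>w. f v w) \<in> lin_maps K W U) \<Longrightarrow> bilin K V W U f"
  by (auto simp: bilin_def)

lemma bilin_closed: "bilin K V W U f \<Longrightarrow> v \<in> carrier V \<Longrightarrow> w \<in> carrier W \<Longrightarrow> f v w \<in> carrier U"
  by (auto simp: bilin_def lin_maps_def)

lemma bilin_left: "bilin K V W U f \<Longrightarrow> w \<in> carrier W \<Longrightarrow> (\<lambda>v. f v w) \<in> lin_maps K V U"
  and bilin_right: "bilin K V W U f \<Longrightarrow> v \<in> carrier V \<Longrightarrow> f v \<in> lin_maps K W U"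
  by (auto simp: bilin_def)

lemma tensor_relators_carrier:
  assumes "module K V" "module K W"
  shows "tensor_relators K V W \<subseteq> carrier (free_module K (carrier V \<times> carrier W))"
proof -
  interpret V: module K V by fact
  interpret W: module K W by fact
  interpret F: module K "free_module K (carrier V \<times> carrier W)" by (rule free_module_module) (rule V.R.is_cring)
  note g = free_gen_closed[OF V.R.is_cring, where I = "carrier V \<times> carrier W"]
  show ?thesis
    by (auto simp: tensor_relators_def Let_def intro!: F.M.minus_closed g)
qed

lemma tensor_null_submodule:
  assumes "module K V" "module K W"
  shows "submodule (tensor_null K V W) K (free_module K (carrier V \<times> carrier W))"
  unfolding tensor_null_def
  by (rule lin_span_submodule[OF free_module_module tensor_relators_carrier[OF assms]])
    (use assms in \<open>simp add: module_def\<close>)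

lemma tensor_module [simp, intro]:
  assumes "module K V" "module K W"
  shows "module K (tensor K V W)"
  unfolding tensor_def
  by (rule quotient_module_module[OF free_module_module tensor_null_submodule[OF assms]])
    (use assms in \<open>simp add: module_def\<close>)

lemma pure_tensor_bilin:
  assumes "module K V" "module K W"
  shows "bilin K V W (tensor K V W) (pure_tensor K V W)"
proof -
  interpret V: module K V by fact
  interpret W: module K W by fact
  let ?F = "free_module K (carrier V \<times> carrier W)" and ?N = "tensor_null K V W"
  interpret F: module K ?F by (rule free_module_module) (rule V.R.is_cring)
  note g [simp] = free_gen_closed[OF V.R.is_cring, where I = "carrier V \<times> carrier W"]
  note N = F.module_axioms tensor_null_submodule[OF assms]
  note p [simp] = quotient_proj_add[OF N] quotient_proj_smult[OF N]
  have R: "\<And>x. x \<in> tensor_relators K V W \<Longrightarrow> x \<in> ?N"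
    using lin_span_superset[of "tensor_relators K V W" K ?F] by (auto simp: tensor_null_def)
  note pure = pure_tensor_def tensor_def
  have 1: "pure_tensor K V W (v \<oplus>\<^bsub>V\<^esub> v') w =
      pure_tensor K V W v w \<oplus>\<^bsub>tensor K V W\<^esub> pure_tensor K V W v' w"
    if "v \<in> carrier V" "v' \<in> carrier V" "w \<in> carrier W" for v v' w
  proof -
    have "pure_tensor K V W (v \<oplus>\<^bsub>V\<^esub> v') w =
        ?N +>\<^bsub>?F\<^esub> (free_gen K (v, w) \<oplus>\<^bsub>?F\<^esub> free_gen K (v', w))"
      unfolding pure using that
      by (intro quotient_proj_eq[OF N] R) (simp, simp, unfold tensor_relators_def Let_def, blast)
    then show ?thesis using that by (simp add: pure)
  qed
  have 2: "pure_tensor K V W v (w \<oplus>\<^bsub>W\<^esub> w') =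
      pure_tensor K V W v w \<oplus>\<^bsub>tensor K V W\<^esub> pure_tensor K V W v w'"
    if "v \<in> carrier V" "w \<in> carrier W" "w' \<in> carrier W" for v w w'
  proof -
    have "pure_tensor K V W v (w \<oplus>\<^bsub>W\<^esub> w') =
        ?N +>\<^bsub>?F\<^esub> (free_gen K (v, w) \<oplus>\<^bsub>?F\<^esub> free_gen K (v, w'))"
      unfolding pure using that
      by (intro quotient_proj_eq[OF N] R) (simp, simp, unfold tensor_relators_def Let_def, blast)
    then show ?thesis using that by (simp add: pure)
  qed
  have 3: "pure_tensor K V W (c \<odot>\<^bsub>V\<^esub> v) w = c \<odot>\<^bsub>tensor K V W\<^esub> pure_tensor K V W v w"
    if "c \<in> carrier K" "v \<in> carrier V" "w \<in> carrier W" for c v w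
  proof -
    have "pure_tensor K V W (c \<odot>\<^bsub>V\<^esub> v) w = ?N +>\<^bsub>?F\<^esub> (c \<odot>\<^bsub>?F\<^esub> free_gen K (v, w))"
      unfolding pure using that
      by (intro quotient_proj_eq[OF N] R) (simp, simp, unfold tensor_relators_def Let_def, blast)
    then show ?thesis using that by (simp add: pure)
  qed
  have 4: "pure_tensor K V W v (c \<odot>\<^bsub>W\<^esub> w) = c \<odot>\<^bsub>tensor K V W\<^esub> pure_tensor K V W v w"
    if "c \<in> carrier K" "v \<in> carrier V" "w \<in> carrier W" for c v w
  proof -
    have "pure_tensor K V W v (c \<odot>\<^bsub>W\<^esub> w) = ?N +>\<^bsub>?F\<^esub> (c \<odot>\<^bsub>?F\<^esub> free_gen K (v, w))"
      unfolding pure using that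
      by (intro quotient_proj_eq[OF N] R) (simp, simp, unfold tensor_relators_def Let_def, blast)
    then show ?thesis using that by (simp add: pure)
  qed
  have 5: "pure_tensor K V W v w \<in> carrier (tensor K V W)" if "v \<in> carrier V" "w \<in> carrier W" for v w
    using that by (auto simp: pure quotient_module_carrier)
  show ?thesis by (intro bilinI lin_mapsI 1 2 3 4 5)
qed

lemma pure_closed [simp, intro]:
  "module K V \<Longrightarrow> module K W \<Longrightarrow> v \<in> carrier V \<Longrightarrow> w \<in> carrier W \<Longrightarrow>
    pure_tensor K V W v w \<in> carrier (tensor K V W)"
  by (rule bilin_closed[OF pure_tensor_bilin])

text \<open>
  Scalars can be absorbed into the first factor of a pure tensor, so every tensor is a sum of pure tensors, and
  \<open>0\<close> is itself pure.
\<close>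

lemma tensor_induct [consumes 3, case_names pure add]:
  assumes "module K V" "module K W" "x \<in> carrier (tensor K V W)"
    and pure: "\<And>v w. v \<in> carrier V \<Longrightarrow> w \<in> carrier W \<Longrightarrow> P (pure_tensor K V W v w)"
    and add: "\<And>x y. x \<in> carrier (tensor K V W) \<Longrightarrow> y \<in> carrier (tensor K V W) \<Longrightarrow> P x \<Longrightarrow> P y \<Longrightarrow>
      P (x \<oplus>\<^bsub>tensor K V W\<^esub> y)"
  shows "P x"
proof -
  interpret V: module K V by fact
  interpret W: module K W by fact
  let ?F = "free_module K (carrier V \<times> carrier W)" and ?N = "tensor_null K V W"
  interpret F: module K ?F by (rule free_module_module) (rule V.R.is_cring)
  interpret T: module K "tensor K V W" using assms by simp
  note g [simp] = free_gen_closed[OF V.R.is_cring, where I = "carrier V \<times> carrier W"]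
  note N = F.module_axioms tensor_null_submodule[OF assms(1,2)]
  note b = pure_tensor_bilin[OF assms(1,2)]
  note pl = quotient_proj_lin[OF N]
  obtain \<phi> where p: "\<phi> \<in> carrier ?F" "x = ?N +>\<^bsub>?F\<^esub> \<phi>"
    using assms(3) by (auto simp: tensor_def quotient_module_carrier)
  have "P (?N +>\<^bsub>?F\<^esub> \<phi>)" using V.R.is_cring p(1)
  proof (induction \<phi> rule: free_module_induct)
    case zero
    have "pure_tensor K V W \<zero>\<^bsub>V\<^esub> \<zero>\<^bsub>W\<^esub> = \<zero>\<^bsub>tensor K V W\<^esub>"
      using lin_maps_zero[OF assms(1) T.module_axioms bilin_left[OF b, of "\<zero>\<^bsub>W\<^esub>"]] by simp
    also have "\<dots> = ?N +>\<^bsub>?F\<^esub> \<zero>\<^bsub>?F\<^esub>"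
      using lin_maps_zero[OF F.module_axioms _ pl] assms by (simp add: tensor_def[symmetric])
    finally show ?case using pure[of "\<zero>\<^bsub>V\<^esub>" "\<zero>\<^bsub>W\<^esub>"] by simp
  next
    case (step c i \<psi>)
    obtain v w where i: "i = (v, w)" "v \<in> carrier V" "w \<in> carrier W" using step by auto
    have "?N +>\<^bsub>?F\<^esub> (c \<odot>\<^bsub>?F\<^esub> free_gen K i \<oplus>\<^bsub>?F\<^esub> \<psi>) =
        c \<odot>\<^bsub>tensor K V W\<^esub> pure_tensor K V W v w \<oplus>\<^bsub>tensor K V W\<^esub> (?N +>\<^bsub>?F\<^esub> \<psi>)"
      using step i by (simp add: lin_maps_add[OF pl] lin_maps_smult[OF pl] tensor_def pure_tensor_def)
    also have "c \<odot>\<^bsub>tensor K V W\<^esub> pure_tensor K V W v w = pure_tensor K V W (c \<odot>\<^bsub>V\<^esub> v) w"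
      using lin_maps_smult[OF bilin_left[OF b, of w]] step i by simp
    finally have e: "?N +>\<^bsub>?F\<^esub> (c \<odot>\<^bsub>?F\<^esub> free_gen K i \<oplus>\<^bsub>?F\<^esub> \<psi>) =
      pure_tensor K V W (c \<odot>\<^bsub>V\<^esub> v) w \<oplus>\<^bsub>tensor K V W\<^esub> (?N +>\<^bsub>?F\<^esub> \<psi>)" .
    have "?N +>\<^bsub>?F\<^esub> \<psi> \<in> carrier (tensor K V W)"
      using lin_maps_closed[OF pl] step by (simp add: tensor_def)
    then show ?case unfolding e
      using step i bilin_closed[OF b] by (intro add pure) auto
  qed
  then show ?thesis using p by simp
qed

text \<open>
  The linear extension of a bilinear \<open>f\<close> kills the relators, hence the subspace that they span, and is therefore
  constant on cosets.  The value does not depend on the representative that \<^const>\<open>tensor_lift\<close> picks.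
\<close>

lemma tensor_lift_class:
  assumes "module K V" "module K W" "module K U" "bilin K V W U f"
    "\<phi> \<in> carrier (free_module K (carrier V \<times> carrier W))"
  shows "tensor_lift K U f (tensor_null K V W +>\<^bsub>free_module K (carrier V \<times> carrier W)\<^esub> \<phi>) =
    free_eval K U (\<lambda>p. f (fst p) (snd p)) \<phi>"
proof -
  interpret V: module K V by fact
  interpret W: module K W by fact
  interpret U: module K U by fact
  let ?F = "free_module K (carrier V \<times> carrier W)" and ?N = "tensor_null K V W"
  interpret F: module K ?F by (rule free_module_module) (rule V.R.is_cring)
  note N = F.module_axioms tensor_null_submodule[OF assms(1,2)]
  interpret N: abelian_subgroup ?N ?F by (rule submodule_abelian_subgroup[OF N])
  let ?f = "\<lambda>p. f (fst p) (snd p)"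
  let ?e = "free_eval K U ?f"
  have f: "?f \<in> carrier V \<times> carrier W \<rightarrow> carrier U"
    using bilin_closed[OF assms(4)] by auto
  note l = free_eval_lin[OF assms(3) f]
  note g [simp] = free_gen_closed[OF V.R.is_cring, where I = "carrier V \<times> carrier W"]
  have ef: "?e (free_gen K (v, w)) = f v w" if "v \<in> carrier V" "w \<in> carrier W" for v w
    using free_eval_gen[OF assms(3) f, of "(v, w)"] that by simp
  note bc [simp] = bilin_closed[OF assms(4)]
  have mi: "?e (x \<ominus>\<^bsub>?F\<^esub> y) = \<zero>\<^bsub>U\<^esub>" if "x \<in> carrier ?F" "y \<in> carrier ?F" "?e x = ?e y" for x y
    using that lin_maps_add[OF l] lin_maps_neg[OF F.module_axioms assms(3) l] lin_maps_closed[OF l]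
    by (simp add: a_minus_def U.M.r_neg)
  have "tensor_relators K V W \<subseteq> {x \<in> carrier ?F. ?e x = \<zero>\<^bsub>U\<^esub>}"
    unfolding tensor_relators_def Let_def
    by (auto intro!: mi F.M.minus_closed
      simp: lin_maps_add[OF l] lin_maps_smult[OF l] ef
        lin_maps_add[OF bilin_left[OF assms(4)]] lin_maps_add[OF bilin_right[OF assms(4)]]
        lin_maps_smult[OF bilin_left[OF assms(4)]] lin_maps_smult[OF bilin_right[OF assms(4)]])
  then have k: "?N \<subseteq> {x \<in> carrier ?F. ?e x = \<zero>\<^bsub>U\<^esub>}"
    unfolding tensor_null_def
    by (rule lin_span_least[OF lin_kernel_submodule[OF F.module_axioms assms(3) l]])
  let ?X = "?N +>\<^bsub>?F\<^esub> \<phi>"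
  have e: "?e \<psi> = ?e \<phi>" if psi: "\<psi> \<in> ?X" for \<psi>
  proof -
    obtain n where n: "n \<in> ?N" "\<psi> = n \<oplus>\<^bsub>?F\<^esub> \<phi>" using psi by (auto simp: a_r_coset_def')
    then show ?thesis using k lin_maps_add[OF l] assms(5) lin_maps_closed[OF l] by auto
  qed
  have "(SOME \<psi>. \<psi> \<in> ?X) \<in> ?X" using N.a_rcos_self[OF assms(5)] by (auto simp: some_in_eq)
  then have "?e (SOME \<psi>. \<psi> \<in> ?X) = ?e \<phi>" by (rule e)
  then show ?thesis by (simp add: tensor_lift_def Let_def free_eval_def)
qed

lemma tensor_lift_pure:
  assumes "module K V" "module K W" "module K U" "bilin K V W U f" "v \<in> carrier V" "w \<in> carrier W"
  shows "tensor_lift K U f (pure_tensor K V W v w) = f v w"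
proof -
  have c: "cring K" using assms by (simp add: module_def)
  have "tensor_lift K U f (pure_tensor K V W v w) =
    free_eval K U (\<lambda>p. f (fst p) (snd p)) (free_gen K (v, w))"
    unfolding pure_tensor_def
    by (rule tensor_lift_class) (use assms c in \<open>auto intro!: free_gen_closed\<close>)
  also have "\<dots> = f v w"
    using free_eval_gen[OF assms(3), of "\<lambda>p. f (fst p) (snd p)" "carrier V \<times> carrier W" "(v, w)"]
      bilin_closed[OF assms(4)] assms(5,6) by fastforce
  finally show ?thesis .
qed

lemma tensor_lift_lin:
  assumes "module K V" "module K W" "module K U" "bilin K V W U f"
  shows "tensor_lift K U f \<in> lin_maps K (tensor K V W) U"
proof -
  interpret V: module K V by fact
  let ?F = "free_module K (carrier V \<times> carrier W)" and ?N = "tensor_null K V W"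
  interpret F: module K ?F by (rule free_module_module) (rule V.R.is_cring)
  note N = F.module_axioms tensor_null_submodule[OF assms(1,2)]
  have f: "(\<lambda>p. f (fst p) (snd p)) \<in> carrier V \<times> carrier W \<rightarrow> carrier U"
    using bilin_closed[OF assms(4)] by auto
  note l = free_eval_lin[OF assms(3) f]
  show ?thesis
    by (rule lin_mapsI)
      (auto simp: tensor_def quotient_module_carrier quotient_proj_add[OF N] quotient_proj_smult[OF N]
        tensor_lift_class[OF assms] lin_maps_add[OF l] lin_maps_smult[OF l] lin_maps_closed[OF l])
qed

section \<open>Computing with Sweedler sums\<close>

text \<open>
  The inductive relations behind the two folds coincide, since the function is only applied to elements of the set.
\<close>

lemma foldD_cong:
  fixes f g :: "'i \<Rightarrow> 'd \<Rightarrow> 'd"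
  assumes "\<And>x y. x \<in> A \<Longrightarrow> f x y = g x y"
  shows "foldD D f e A = foldD D g e A"
proof -
  have "(B, y) \<in> foldSetD D g e" if "(B, y) \<in> foldSetD D f e" "B \<subseteq> A" "\<And>x y. x \<in> A \<Longrightarrow> f x y = g x y"
    for B y and f g :: "'i \<Rightarrow> 'd \<Rightarrow> 'd"
    using that(1,2)
  proof induction
    case (emptyI)
    then show ?case by (simp add: foldSetD.emptyI)
  next
    case (insertI x B y)
    then show ?case using foldSetD.insertI[of x B g y D e] that(3)[of x y] by auto
  qed
  from this[of A _ f g] this[of A _ g f] have "(A, y) \<in> foldSetD D f e \<longleftrightarrow> (A, y) \<in> foldSetD D g e" for y
    using assms by auto
  then show ?thesis by (simp add: foldD_def)
qed

text \<open>
  The representative that is summed over has its support in \<open>carrier V \<times> carrier W\<close>, so the body of a Sweedler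
  sum may be rewritten under the assumption that its arguments lie in the carriers.
\<close>

lemma tensor_lift_cong:
  assumes "module K V" "module K W" "x \<in> carrier (tensor K V W)"
    and eq: "\<And>v w. v \<in> carrier V \<Longrightarrow> w \<in> carrier W \<Longrightarrow> f v w = g v w"
  shows "tensor_lift K U f x = tensor_lift K U g x"
proof -
  interpret V: module K V by fact
  let ?F = "free_module K (carrier V \<times> carrier W)" and ?N = "tensor_null K V W"
  interpret F: module K ?F by (rule free_module_module) (rule V.R.is_cring)
  interpret N: abelian_subgroup ?N ?F
    by (rule submodule_abelian_subgroup[OF F.module_axioms tensor_null_submodule[OF assms(1,2)]])
  obtain \<phi> where "\<phi> \<in> carrier ?F" "x = ?N +>\<^bsub>?F\<^esub> \<phi>"
    using assms(3) by (auto simp: tensor_def quotient_module_carrier)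
  then have "x \<noteq> {}" "x \<subseteq> carrier ?F"
    using N.a_rcos_self F.a_r_coset_subset_G[OF N.a_subset] by auto
  then have "(SOME \<psi>. \<psi> \<in> x) \<in> carrier ?F" by (auto simp: some_in_eq subset_iff)
  then have "{p. (SOME \<psi>. \<psi> \<in> x) p \<noteq> \<zero>\<^bsub>K\<^esub>} \<subseteq> carrier V \<times> carrier W"
    by (auto simp: free_module_def)
  then show ?thesis
    unfolding tensor_lift_def Let_def finsum_def finprod_def
    by (auto intro!: foldD_cong simp: eq subset_iff)
qed

lemma lin_id: "(\<lambda>x. x) \<in> lin_maps K V V"
  by (auto simp: lin_maps_def)

lemma lin_comp: "f \<in> lin_maps K W U \<Longrightarrow> g \<in> lin_maps K V W \<Longrightarrow> (\<lambda>x. f (g x)) \<in> lin_maps K V U"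
  by (auto simp: lin_maps_def Pi_iff)

lemma lin_cong:
  assumes "f \<in> lin_maps K V U" "module K V" "\<And>x. x \<in> carrier V \<Longrightarrow> f x = g x"
  shows "g \<in> lin_maps K V U"
proof -
  interpret V: module K V by fact
  show ?thesis using assms(1) assms(3)[symmetric] unfolding lin_maps_def by auto
qed

lemma lin_finsum_param:
  assumes "module K U" and V: "module K V" and "\<And>a. a \<in> A \<Longrightarrow> (\<lambda>t. f t a) \<in> lin_maps K V U"
  shows "(\<lambda>t. finsum U (f t) A) \<in> lin_maps K V U"
proof -
  interpret U: module K U by fact
  have z: "(\<lambda>_. \<zero>\<^bsub>U\<^esub>) \<in> lin_maps K V U" by (rule lin_mapsI) auto
  show ?thesis using assms(3)
  proof (induction A rule: infinite_finite_induct)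
    case (insert a A)
    have l: "(\<lambda>t. f t a) \<in> lin_maps K V U" "(\<lambda>t. finsum U (f t) A) \<in> lin_maps K V U" using insert by auto
    have cl: "f t a \<in> carrier U" "f t \<in> A \<rightarrow> carrier U" if "t \<in> carrier V" for t
      using lin_maps_closed[OF insert.prems] that by auto
    have eq: "finsum U (f t) (insert a A) = f t a \<oplus>\<^bsub>U\<^esub> finsum U (f t) A" if "t \<in> carrier V" for t
      using insert.hyps cl[OF that] by simp
    have l': "(\<lambda>t. f t a \<oplus>\<^bsub>U\<^esub> finsum U (f t) A) \<in> lin_maps K V U"
      using l unfolding lin_maps_def by (auto simp: U.M.a_ac U.smult_r_distr Pi_iff)
    show ?case by (rule lin_cong[OF l' V]) (rule eq[symmetric])
  qed (simp_all add: U.M.finsum_infinite z)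
qed

lemma lin_finsum:
  assumes "module K V" "module K W" "f \<in> lin_maps K V W" "g \<in> A \<rightarrow> carrier V"
  shows "f (finsum V g A) = finsum W (\<lambda>a. f (g a)) A"
proof -
  interpret V: module K V by fact
  interpret W: module K W by fact
  show ?thesis using assms(4)
  proof (induction A rule: infinite_finite_induct)
    case (insert a A)
    then have g: "g a \<in> carrier V" "g \<in> A \<rightarrow> carrier V" by auto
    moreover have "(\<lambda>a. f (g a)) \<in> A \<rightarrow> carrier W" using g lin_maps_closed[OF assms(3)] by auto
    ultimately show ?case using insert by (simp add: lin_maps_add[OF assms(3)] lin_maps_closed[OF assms(3)])
  qed (simp_all add: lin_maps_zero[OF assms(1,2,3)] V.M.finsum_infinite W.M.finsum_infinite)
qed

lemma lin_left: "bilin K A B U F \<Longrightarrow> f \<in> lin_maps K V A \<Longrightarrow> b \<in> carrier B \<Longrightarrow> (\<lambda>x. F (f x) b) \<in> lin_maps K V U"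
  by (rule lin_comp[OF bilin_left])

lemma lin_right: "bilin K A B U F \<Longrightarrow> f \<in> lin_maps K V B \<Longrightarrow> a \<in> carrier A \<Longrightarrow> (\<lambda>x. F a (f x)) \<in> lin_maps K V U"
  by (rule lin_comp[OF bilin_right])

lemma lin_lift_comp:
  "g \<in> lin_maps K X (tensor K V W) \<Longrightarrow> module K V \<Longrightarrow> module K W \<Longrightarrow> module K U \<Longrightarrow> bilin K V W U f \<Longrightarrow>
    (\<lambda>x. tensor_lift K U f (g x)) \<in> lin_maps K X U"
  by (rule lin_comp[OF tensor_lift_lin])

lemma tensor_lift_closed:
  "t \<in> carrier (tensor K V W) \<Longrightarrow> module K V \<Longrightarrow> module K W \<Longrightarrow> module K U \<Longrightarrow> bilin K V W U f \<Longrightarrow>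
    tensor_lift K U f t \<in> carrier U"
  by (rule lin_maps_closed[OF tensor_lift_lin])

lemma tensor_lin_eq:
  assumes "module K V" "module K W" "module K U"
    "f \<in> lin_maps K (tensor K V W) U" "g \<in> lin_maps K (tensor K V W) U"
    "\<And>v w. v \<in> carrier V \<Longrightarrow> w \<in> carrier W \<Longrightarrow> f (pure_tensor K V W v w) = g (pure_tensor K V W v w)"
    "x \<in> carrier (tensor K V W)"
  shows "f x = g x"
  using assms(1,2,7)
  by (induction x rule: tensor_induct)
    (simp_all add: assms lin_maps_add[OF assms(4)] lin_maps_add[OF assms(5)])

lemma lin_tensor_lift:
  assumes "module K V" "module K W" "module K U" "module K U'"
    "h \<in> lin_maps K U U'" "bilin K V W U f" "t \<in> carrier (tensor K V W)"
  shows "h (tensor_lift K U f t) = tensor_lift K U' (\<lambda>v w. h (f v w)) t"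
proof -
  have b: "bilin K V W U' (\<lambda>v w. h (f v w))"
    by (intro bilinI lin_comp[OF assms(5)]) (use assms(6) in \<open>auto simp: bilin_def\<close>)
  show ?thesis
    by (rule tensor_lin_eq[OF assms(1,2,4) _ _ _ assms(7)])
      (use assms b in \<open>auto simp: tensor_lift_pure intro!: lin_comp[OF assms(5)] tensor_lift_lin\<close>)
qed

text \<open>
  A Sweedler sum depends linearly on any parameter on which its body depends linearly.  Together with
  \<open>lin_lift_comp\<close>, where the variable sits in the tensor instead of the body, it settles the linearity of nested sums.
\<close>

lemma lin_lift_param:
  assumes t: "t \<in> carrier (tensor K V W)" and m: "module K V" "module K W" "module K U"
    and f: "\<And>x. x \<in> carrier X \<Longrightarrow> bilin K V W U (f x)"
    and l: "\<And>v w. v \<in> carrier V \<Longrightarrow> w \<in> carrier W \<Longrightarrow> (\<lambda>x. f x v w) \<in> lin_maps K X U"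
    and X: "module K X"
  shows "(\<lambda>x. tensor_lift K U (f x) t) \<in> lin_maps K X U"
  using m(1,2) t
proof (induction t rule: tensor_induct)
  case (pure v w)
  show ?case
    by (rule lin_cong[OF l[OF pure] X]) (use pure m f in \<open>simp add: tensor_lift_pure\<close>)
next
  case (add s t)
  interpret U: module K U by fact
  interpret X: module K X by fact
  have "(\<lambda>x. tensor_lift K U (f x) s \<oplus>\<^bsub>U\<^esub> tensor_lift K U (f x) t) \<in> lin_maps K X U"
    using add.IH unfolding lin_maps_def
    by (auto simp: U.M.a_ac U.smult_r_distr Pi_iff)
  then show ?case
    by (rule lin_cong[OF _ X]) (use add m f in \<open>simp add: lin_maps_add[OF tensor_lift_lin]\<close>)
qed

text \<open>
  Two independent Sweedler sums can be exchanged: both sides are linear in \<open>s\<close> and agree when \<open>s\<close> is pure.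
\<close>

lemma tensor_lift_swap:
  assumes m: "module K V" "module K W" "module K V'" "module K W'" "module K U"
    and s: "s \<in> carrier (tensor K V W)" and t: "t \<in> carrier (tensor K V' W')"
    and f1: "\<And>a b. a \<in> carrier V \<Longrightarrow> b \<in> carrier W \<Longrightarrow> bilin K V' W' U (f a b)"
    and f2: "\<And>a b. a \<in> carrier V' \<Longrightarrow> b \<in> carrier W' \<Longrightarrow> bilin K V W U (\<lambda>x y. f x y a b)"
  shows "tensor_lift K U (\<lambda>a b. tensor_lift K U (f a b) t) s =
    tensor_lift K U (\<lambda>c d. tensor_lift K U (\<lambda>a b. f a b c d) s) t"
proof (rule tensor_lin_eq[OF m(1,2,5) _ _ _ s])
  have l1: "(\<lambda>x. f x b c d) \<in> lin_maps K V U" if "b \<in> carrier W" "c \<in> carrier V'" "d \<in> carrier W'" for b c d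
    using bilin_left[OF f2] that by blast
  have l2: "(\<lambda>y. f a y c d) \<in> lin_maps K W U" if "a \<in> carrier V" "c \<in> carrier V'" "d \<in> carrier W'" for a c d
    using bilin_right[OF f2] that by blast
  have l3: "(\<lambda>x. f a b x d) \<in> lin_maps K V' U" if "a \<in> carrier V" "b \<in> carrier W" "d \<in> carrier W'" for a b d
    using bilin_left[OF f1] that by blast
  have l4: "(\<lambda>y. f a b c y) \<in> lin_maps K W' U" if "a \<in> carrier V" "b \<in> carrier W" "c \<in> carrier V'" for a b c
    using bilin_right[OF f1] that by blast
  have b1: "bilin K V W U (\<lambda>a b. tensor_lift K U (f a b) t)"
    by (intro bilinI lin_lift_param[OF t m(3,4,5)] f1 l1 l2 m) auto
  have b2: "bilin K V' W' U (\<lambda>c d. tensor_lift K U (\<lambda>a b. f a b c d) x)"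
    if "x \<in> carrier (tensor K V W)" for x
    by (intro bilinI lin_lift_param[OF that m(1,2,5)] f2 l3 l4 m) auto
  show "(\<lambda>s. tensor_lift K U (\<lambda>a b. tensor_lift K U (f a b) t) s) \<in> lin_maps K (tensor K V W) U"
    by (intro tensor_lift_lin m b1)
  show "(\<lambda>s. tensor_lift K U (\<lambda>c d. tensor_lift K U (\<lambda>a b. f a b c d) s) t) \<in> lin_maps K (tensor K V W) U"
    by (intro lin_lift_param[OF t m(3,4,5)] b2 tensor_lift_lin m f2 tensor_module)
  show "tensor_lift K U (\<lambda>a b. tensor_lift K U (f a b) t) (pure_tensor K V W v w) =
    tensor_lift K U (\<lambda>c d. tensor_lift K U (\<lambda>a b. f a b c d) (pure_tensor K V W v w)) t"
    if "v \<in> carrier V" "w \<in> carrier W" for v w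
    unfolding tensor_lift_pure[OF m(1,2,5) b1 that]
    by (rule tensor_lift_cong[OF m(3,4) t]) (simp add: tensor_lift_pure[OF m(1,2,5) f2 that])
qed

lemma tensor_lift_lift:
  assumes "module K A" "module K B" "module K V" "module K W" "module K U"
    "bilin K A B U F" "t \<in> carrier (tensor K V W)"
    "bilin K V W (tensor K A B) (\<lambda>v w. pure_tensor K A B (p v w) (q v w))"
    "\<And>v w. v \<in> carrier V \<Longrightarrow> w \<in> carrier W \<Longrightarrow> p v w \<in> carrier A"
    "\<And>v w. v \<in> carrier V \<Longrightarrow> w \<in> carrier W \<Longrightarrow> q v w \<in> carrier B"
  shows "tensor_lift K U F (tensor_lift K (tensor K A B) (\<lambda>v w. pure_tensor K A B (p v w) (q v w)) t) =
    tensor_lift K U (\<lambda>v w. F (p v w) (q v w)) t"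
proof -
  note m = assms(1-5)
  have "tensor_lift K U F (tensor_lift K (tensor K A B) (\<lambda>v w. pure_tensor K A B (p v w) (q v w)) t) =
    tensor_lift K U (\<lambda>v w. tensor_lift K U F (pure_tensor K A B (p v w) (q v w))) t"
    by (rule lin_tensor_lift[OF m(3,4) tensor_module m(5) tensor_lift_lin]) (use assms in auto)
  also have "\<dots> = tensor_lift K U (\<lambda>v w. F (p v w) (q v w)) t"
    by (rule tensor_lift_cong[OF m(3,4)]) (use assms in \<open>auto simp: tensor_lift_pure\<close>)
  finally show ?thesis .
qed

text \<open>
  Multilinearity of a concrete expression follows from its syntax: each variable occurs once, and the rules
  peel off the operation at the head until that variable is reached.  Lemmas below extend this list by the
  operations of the algebra at hand and use it as an exhaustive rule set.
\<close>

lemmas lin_rules = bilinI lin_id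
  lin_left[OF pure_tensor_bilin] lin_right[OF pure_tensor_bilin]
  lin_lift_comp lin_lift_param tensor_lift_closed pure_closed tensor_module

section \<open>Associators and the Yang-Baxter equation\<close>

lemma tensor_map_bilin:
  assumes "module K V'" "module K W'" "f \<in> lin_maps K V V'" "g \<in> lin_maps K W W'"
  shows "bilin K V W (tensor K V' W') (\<lambda>v w. pure_tensor K V' W' (f v) (g w))"
  by (assumption | rule assms lin_rules lin_maps_closed[OF assms(3)] lin_maps_closed[OF assms(4)])+

lemma tensor_map_lin:
  assumes "module K V" "module K W" "module K V'" "module K W'" "f \<in> lin_maps K V V'" "g \<in> lin_maps K W W'"
  shows "tensor_map K V' W' f g \<in> lin_maps K (tensor K V W) (tensor K V' W')"
  unfolding tensor_map_def
  by (intro tensor_lift_lin tensor_map_bilin tensor_module assms)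

lemma tensor_map_pure:
  assumes "module K V" "module K W" "module K V'" "module K W'" "f \<in> lin_maps K V V'" "g \<in> lin_maps K W W'"
    "v \<in> carrier V" "w \<in> carrier W"
  shows "tensor_map K V' W' f g (pure_tensor K V W v w) = pure_tensor K V' W' (f v) (g w)"
  unfolding tensor_map_def
  by (intro tensor_lift_pure tensor_map_bilin tensor_module assms)

lemma tensor_assoc_bilin:
  assumes "module K U" "module K V" "module K W"
  shows "bilin K (tensor K U V) W (tensor K U (tensor K V W)) (\<lambda>t w. tensor_lift K (tensor K U (tensor K V W))
    (\<lambda>u v. pure_tensor K U (tensor K V W) u (pure_tensor K V W v w)) t)"
  by (assumption | rule assms lin_rules)+

lemma tensor_assoc_lin:
  assumes "module K U" "module K V" "module K W"
  shows "tensor_assoc K U V W \<in> lin_maps K (tensor K (tensor K U V) W) (tensor K U (tensor K V W))"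
  unfolding tensor_assoc_def Let_def
  by (intro tensor_lift_lin tensor_assoc_bilin tensor_module assms)

lemma tensor_assoc_pure:
  assumes "module K U" "module K V" "module K W" "u \<in> carrier U" "v \<in> carrier V" "w \<in> carrier W"
  shows "tensor_assoc K U V W (pure_tensor K (tensor K U V) W (pure_tensor K U V u v) w) =
    pure_tensor K U (tensor K V W) u (pure_tensor K V W v w)"
proof -
  have b: "bilin K U V (tensor K U (tensor K V W))
    (\<lambda>u v. pure_tensor K U (tensor K V W) u (pure_tensor K V W v w))"
    by (assumption | rule assms lin_rules)+
  show ?thesis
    unfolding tensor_assoc_def Let_def
    using assms by (simp add: tensor_lift_pure[OF _ _ _ tensor_assoc_bilin] tensor_lift_pure[OF _ _ _ b])
qed

lemma tensor_assoc_inv_bilin: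
  assumes "module K U" "module K V" "module K W"
  shows "bilin K U (tensor K V W) (tensor K (tensor K U V) W) (\<lambda>u t. tensor_lift K (tensor K (tensor K U V) W)
    (\<lambda>v w. pure_tensor K (tensor K U V) W (pure_tensor K U V u v) w) t)"
  by (assumption | rule assms lin_rules)+

lemma tensor_assoc_inv_lin:
  assumes "module K U" "module K V" "module K W"
  shows "tensor_assoc_inv K U V W \<in> lin_maps K (tensor K U (tensor K V W)) (tensor K (tensor K U V) W)"
  unfolding tensor_assoc_inv_def Let_def
  by (intro tensor_lift_lin tensor_assoc_inv_bilin tensor_module assms)

lemma tensor_assoc_inv_pure:
  assumes "module K U" "module K V" "module K W" "u \<in> carrier U" "v \<in> carrier V" "w \<in> carrier W"
  shows "tensor_assoc_inv K U V W (pure_tensor K U (tensor K V W) u (pure_tensor K V W v w)) =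
    pure_tensor K (tensor K U V) W (pure_tensor K U V u v) w"
proof -
  have b: "bilin K V W (tensor K (tensor K U V) W)
    (\<lambda>v w. pure_tensor K (tensor K U V) W (pure_tensor K U V u v) w)"
    by (assumption | rule assms lin_rules)+
  show ?thesis
    unfolding tensor_assoc_inv_def Let_def
    using assms by (simp add: tensor_lift_pure[OF _ _ _ tensor_assoc_inv_bilin] tensor_lift_pure[OF _ _ _ b])
qed

lemma tensor_lin_eq3:
  assumes "module K U" "module K V" "module K W" "module K R"
    "f \<in> lin_maps K (tensor K (tensor K U V) W) R" "g \<in> lin_maps K (tensor K (tensor K U V) W) R"
    "\<And>u v w. u \<in> carrier U \<Longrightarrow> v \<in> carrier V \<Longrightarrow> w \<in> carrier W \<Longrightarrow>
      f (pure_tensor K (tensor K U V) W (pure_tensor K U V u v) w) =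
      g (pure_tensor K (tensor K U V) W (pure_tensor K U V u v) w)"
    "x \<in> carrier (tensor K (tensor K U V) W)"
  shows "f x = g x"
proof (rule tensor_lin_eq[OF _ assms(3,4,5,6) _ assms(8)])
  show m: "module K (tensor K U V)" using assms by simp
  fix t w assume t: "t \<in> carrier (tensor K U V)" and w: "w \<in> carrier W"
  show "f (pure_tensor K (tensor K U V) W t w) = g (pure_tensor K (tensor K U V) W t w)"
    by (rule tensor_lin_eq[OF assms(1,2,4) _ _ _ t,
          where f = "\<lambda>t. f (pure_tensor K (tensor K U V) W t w)" and g = "\<lambda>t. g (pure_tensor K (tensor K U V) W t w)"])
      (use assms w m in \<open>auto intro!: lin_comp[OF assms(5)] lin_comp[OF assms(6)] bilin_left[OF pure_tensor_bilin]\<close>)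
qed

text \<open>
  The Yang-Baxter equation on \<open>(U \<otimes> V) \<otimes> W\<close> for three members taken out of a system; \<^const>\<open>braided_system\<close>
  demands it for all triples.
\<close>

definition ybe where
  "ybe K U V W s12 s13 s23 \<longleftrightarrow> (\<forall>x \<in> carrier (tensor K (tensor K U V) W).
        (tensor_map K (tensor K W V) U s23 (\<lambda>y. y) \<circ>
         tensor_assoc_inv K V W U \<circ>
         tensor_map K V (tensor K W U) (\<lambda>y. y) s13 \<circ>
         tensor_assoc K V U W \<circ>
         tensor_map K (tensor K V U) W s12 (\<lambda>y. y)) x =
        (tensor_assoc_inv K W V U \<circ>
         tensor_map K W (tensor K V U) (\<lambda>y. y) s12 \<circ>
         tensor_assoc K W U V \<circ>
         tensor_map K (tensor K W U) V s13 (\<lambda>y. y) \<circ>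
         tensor_assoc_inv K U W V \<circ>
         tensor_map K U (tensor K W V) (\<lambda>y. y) s23 \<circ>
         tensor_assoc K U V W) x)"

text \<open>
  The bodies of the sums in \<open>ybeI\<close> below are bilinear.  This is what permits evaluating the braiding to which each of
  these sums is applied.
\<close>

lemma ybe_bilin:
  fixes K U V W
  defines "R \<equiv> tensor K (tensor K W V) U"
  assumes m: "module K U" "module K V" "module K W"
    and s12: "s12 \<in> lin_maps K (tensor K U V) (tensor K V U)"
    and s13: "s13 \<in> lin_maps K (tensor K U W) (tensor K W U)"
    and s23: "s23 \<in> lin_maps K (tensor K V W) (tensor K W V)"
  shows "w \<in> carrier W \<Longrightarrow> bilin K V U R (\<lambda>v' u'. tensor_lift K R (\<lambda>w' u''. tensor_lift K R (\<lambda>w'' v''.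
        pure_tensor K (tensor K W V) U (pure_tensor K W V w'' v'') u'')
          (s23 (pure_tensor K V W v' w'))) (s13 (pure_tensor K U W u' w)))"
    and "v \<in> carrier V \<Longrightarrow> bilin K W U R (\<lambda>w' u''. tensor_lift K R (\<lambda>w'' v''.
        pure_tensor K (tensor K W V) U (pure_tensor K W V w'' v'') u'')
          (s23 (pure_tensor K V W v w')))"
    and "u \<in> carrier U \<Longrightarrow> bilin K W V R (\<lambda>w v. pure_tensor K (tensor K W V) U (pure_tensor K W V w v) u)"
    and "w \<in> carrier W \<Longrightarrow> bilin K V U R (\<lambda>v u. pure_tensor K (tensor K W V) U (pure_tensor K W V w v) u)"
    and "v \<in> carrier V \<Longrightarrow> bilin K W U R (\<lambda>w'' u'. tensor_lift K R (\<lambda>v'' u''.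
        pure_tensor K (tensor K W V) U (pure_tensor K W V w'' v'') u'') (s12 (pure_tensor K U V u' v)))"
    and "u \<in> carrier U \<Longrightarrow> bilin K W V R (\<lambda>w' v'. tensor_lift K R (\<lambda>w'' u'. tensor_lift K R (\<lambda>v'' u''.
        pure_tensor K (tensor K W V) U (pure_tensor K W V w'' v'') u'')
          (s12 (pure_tensor K U V u' v'))) (s13 (pure_tensor K U W u w')))"
  unfolding R_def
  by (assumption | rule lin_rules m lin_comp[OF s12] lin_comp[OF s13] lin_comp[OF s23]
      lin_maps_closed[OF s12] lin_maps_closed[OF s13] lin_maps_closed[OF s23])+

text \<open>
  Both sides are linear, so it suffices to compare them on \<open>(u \<otimes> v) \<otimes> w\<close>.  There each braiding is applied to a
  pure tensor and its result is fed into the next one by a Sweedler sum; the associators only rearrange brackets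
  and disappear.
\<close>

lemma ybeI:
  fixes K U V W
  defines "R \<equiv> tensor K (tensor K W V) U"
  assumes m: "module K U" "module K V" "module K W"
    and s12: "s12 \<in> lin_maps K (tensor K U V) (tensor K V U)"
    and s13: "s13 \<in> lin_maps K (tensor K U W) (tensor K W U)"
    and s23: "s23 \<in> lin_maps K (tensor K V W) (tensor K W V)"
    and eq: "\<And>u v w. u \<in> carrier U \<Longrightarrow> v \<in> carrier V \<Longrightarrow> w \<in> carrier W \<Longrightarrow>
      tensor_lift K R (\<lambda>v' u'. tensor_lift K R (\<lambda>w' u''. tensor_lift K R (\<lambda>w'' v''.
        pure_tensor K (tensor K W V) U (pure_tensor K W V w'' v'') u'')
          (s23 (pure_tensor K V W v' w'))) (s13 (pure_tensor K U W u' w))) (s12 (pure_tensor K U V u v)) =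
      tensor_lift K R (\<lambda>w' v'. tensor_lift K R (\<lambda>w'' u'. tensor_lift K R (\<lambda>v'' u''.
        pure_tensor K (tensor K W V) U (pure_tensor K W V w'' v'') u'')
          (s12 (pure_tensor K U V u' v'))) (s13 (pure_tensor K U W u w'))) (s23 (pure_tensor K V W v w))"
  shows "ybe K U V W s12 s13 s23"
proof -
  let ?P = "\<lambda>w v u. pure_tensor K (tensor K W V) U (pure_tensor K W V w v) u"
  note bb = ybe_bilin[OF m s12 s13 s23, folded R_def]
  let ?A1 = "tensor_map K (tensor K W V) U s23 (\<lambda>y. y)" and ?A2 = "tensor_assoc_inv K V W U"
    and ?A3 = "tensor_map K V (tensor K W U) (\<lambda>y. y) s13" and ?A4 = "tensor_assoc K V U W"
    and ?A5 = "tensor_map K (tensor K V U) W s12 (\<lambda>y. y)"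
  let ?B1 = "tensor_assoc_inv K W V U" and ?B2 = "tensor_map K W (tensor K V U) (\<lambda>y. y) s12"
    and ?B3 = "tensor_assoc K W U V" and ?B4 = "tensor_map K (tensor K W U) V s13 (\<lambda>y. y)"
    and ?B5 = "tensor_assoc_inv K U W V" and ?B6 = "tensor_map K U (tensor K W V) (\<lambda>y. y) s23"
    and ?B7 = "tensor_assoc K U V W"
  note ml = tensor_map_lin[OF _ _ _ _ _ lin_id] tensor_map_lin[OF _ _ _ _ lin_id]
  have A: "?A1 \<in> lin_maps K (tensor K (tensor K V W) U) R"
    "?A2 \<in> lin_maps K (tensor K V (tensor K W U)) (tensor K (tensor K V W) U)"
    "?A3 \<in> lin_maps K (tensor K V (tensor K U W)) (tensor K V (tensor K W U))"
    "?A4 \<in> lin_maps K (tensor K (tensor K V U) W) (tensor K V (tensor K U W))"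
    "?A5 \<in> lin_maps K (tensor K (tensor K U V) W) (tensor K (tensor K V U) W)"
    unfolding R_def
    by (intro ml tensor_assoc_inv_lin tensor_assoc_lin m tensor_module s12 s13 s23)+
  have B: "?B1 \<in> lin_maps K (tensor K W (tensor K V U)) R"
    "?B2 \<in> lin_maps K (tensor K W (tensor K U V)) (tensor K W (tensor K V U))"
    "?B3 \<in> lin_maps K (tensor K (tensor K W U) V) (tensor K W (tensor K U V))"
    "?B4 \<in> lin_maps K (tensor K (tensor K U W) V) (tensor K (tensor K W U) V)"
    "?B5 \<in> lin_maps K (tensor K U (tensor K W V)) (tensor K (tensor K U W) V)"
    "?B6 \<in> lin_maps K (tensor K U (tensor K V W)) (tensor K U (tensor K W V))"
    "?B7 \<in> lin_maps K (tensor K (tensor K U V) W) (tensor K U (tensor K V W))"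
    unfolding R_def
    by (intro ml tensor_assoc_inv_lin tensor_assoc_lin m tensor_module s12 s13 s23)+
  have mR: "module K R" unfolding R_def by (intro m tensor_module)
  note push = lin_comp[OF A(1)] lin_comp[OF A(2)] lin_comp[OF A(3)] lin_comp[OF A(4)]
    lin_comp[OF B(1)] lin_comp[OF B(2)] lin_comp[OF B(3)] lin_comp[OF B(4)] lin_comp[OF B(5)]
  note pure = tensor_assoc_pure tensor_assoc_inv_pure tensor_map_pure[OF _ _ _ _ lin_id] tensor_map_pure[OF _ _ _ _ _ lin_id]
  note [simp] = m mR s12 s13 s23 lin_maps_closed[OF s12] lin_maps_closed[OF s13] lin_maps_closed[OF s23]
  (* a1 and a2 evaluate the left-hand side and b1 to b3 the right-hand side, starting from the braiding applied last *)
  have a0: "pure_tensor K (tensor K W V) U t u =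
      tensor_lift K R (\<lambda>w v. ?P w v u) t"
    if "t \<in> carrier (tensor K W V)" "u \<in> carrier U" for t u
    by (rule tensor_lin_eq[OF m(3,2) mR _ tensor_lift_lin[OF m(3,2) mR bb(3)[OF that(2)]] _ that(1)])
      (use that in \<open>auto simp: tensor_lift_pure[OF m(3,2) mR bb(3)[OF that(2)]],
        auto simp: R_def intro!: bilin_left[OF pure_tensor_bilin]\<close>)
  have a1: "?A1 (?A2 (pure_tensor K V (tensor K W U) v s)) =
      tensor_lift K R (\<lambda>w' u''. tensor_lift K R
        (\<lambda>w'' v''. ?P w'' v'' u'') (s23 (pure_tensor K V W v w'))) s"
    if "v \<in> carrier V" "s \<in> carrier (tensor K W U)" for v s
    by (rule tensor_lin_eq[OF m(3,1) mR _ tensor_lift_lin[OF m(3,1) mR bb(2)[OF that(1)]] _ that(2)])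
      (use that in \<open>auto simp: pure a0[symmetric] tensor_lift_pure[OF m(3,1) mR bb(2)[OF that(1)]] intro!: lin_comp[OF A(1)] lin_comp[OF A(2)]
        bilin_right[OF pure_tensor_bilin]\<close>)
  have a2: "?A1 (?A2 (?A3 (?A4 (pure_tensor K (tensor K V U) W t w)))) =
      tensor_lift K R (\<lambda>v' u'. tensor_lift K R (\<lambda>w' u''.
        tensor_lift K R (\<lambda>w'' v''. ?P w'' v'' u'')
          (s23 (pure_tensor K V W v' w'))) (s13 (pure_tensor K U W u' w))) t"
    if "t \<in> carrier (tensor K V U)" "w \<in> carrier W" for t w
    by (rule tensor_lin_eq[OF m(2,1) mR _ tensor_lift_lin[OF m(2,1) mR bb(1)[OF that(2)]] _ that(1)])
      (use that in \<open>auto simp: pure a1 tensor_lift_pure[OF m(2,1) mR bb(1)[OF that(2)]]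
        intro!: push bilin_left[OF pure_tensor_bilin]\<close>)
  have b1: "?B1 (pure_tensor K W (tensor K V U) w x) =
      tensor_lift K R (\<lambda>v u. ?P w v u) x"
    if "w \<in> carrier W" "x \<in> carrier (tensor K V U)" for w x
    by (rule tensor_lin_eq[OF m(2,1) mR _ tensor_lift_lin[OF m(2,1) mR bb(4)[OF that(1)]] _ that(2)])
      (use that in \<open>auto simp: pure tensor_lift_pure[OF m(2,1) mR bb(4)[OF that(1)]]
        intro!: push bilin_right[OF pure_tensor_bilin]\<close>)
  have b2: "?B1 (?B2 (?B3 (pure_tensor K (tensor K W U) V t v))) =
      tensor_lift K R (\<lambda>w'' u'. tensor_lift K R (\<lambda>v'' u''.
        ?P w'' v'' u'') (s12 (pure_tensor K U V u' v))) t"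
    if "t \<in> carrier (tensor K W U)" "v \<in> carrier V" for t v
    by (rule tensor_lin_eq[OF m(3,1) mR _ tensor_lift_lin[OF m(3,1) mR bb(5)[OF that(2)]] _ that(1)])
      (use that in \<open>auto simp: pure b1 tensor_lift_pure[OF m(3,1) mR bb(5)[OF that(2)]]
        intro!: push bilin_left[OF pure_tensor_bilin]\<close>)
  have b3: "?B1 (?B2 (?B3 (?B4 (?B5 (pure_tensor K U (tensor K W V) u y))))) =
      tensor_lift K R (\<lambda>w' v'. tensor_lift K R (\<lambda>w'' u'. tensor_lift K R (\<lambda>v'' u''.
        ?P w'' v'' u'')
          (s12 (pure_tensor K U V u' v'))) (s13 (pure_tensor K U W u w'))) y"
    if "u \<in> carrier U" "y \<in> carrier (tensor K W V)" for u y
    by (rule tensor_lin_eq[OF m(3,2) mR _ tensor_lift_lin[OF m(3,2) mR bb(6)[OF that(1)]] _ that(2)])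
      (use that in \<open>auto simp: pure b2 tensor_lift_pure[OF m(3,2) mR bb(6)[OF that(1)]]
        intro!: push bilin_right[OF pure_tensor_bilin]\<close>)
  have L: "(\<lambda>x. ?A1 (?A2 (?A3 (?A4 (?A5 x))))) \<in> lin_maps K (tensor K (tensor K U V) W) R"
    by (intro push A(5))
  have M: "(\<lambda>x. ?B1 (?B2 (?B3 (?B4 (?B5 (?B6 (?B7 x))))))) \<in> lin_maps K (tensor K (tensor K U V) W) R"
    by (intro push lin_comp[OF B(6)] B(7))
  show ?thesis
    unfolding ybe_def comp_apply
    by (rule ballI, rule tensor_lin_eq3[OF m mR L M]) (simp_all add: pure a2 b3 eq)
qed

section \<open>Algebras with a coaction or an action\<close>

text \<open>
  An equation in \<open>A \<otimes> (B \<otimes> C)\<close>, such as coassociativity, may be applied under any trilinear function, because that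
  function factors through the triple tensor product.
\<close>

lemma trilinear_factor:
  assumes m: "module K A" "module K B" "module K C" "module K U"
    and f1: "\<And>b c. b \<in> carrier B \<Longrightarrow> c \<in> carrier C \<Longrightarrow> (\<lambda>a. f a b c) \<in> lin_maps K A U"
    and f2: "\<And>a c. a \<in> carrier A \<Longrightarrow> c \<in> carrier C \<Longrightarrow> (\<lambda>b. f a b c) \<in> lin_maps K B U"
    and f3: "\<And>a b. a \<in> carrier A \<Longrightarrow> b \<in> carrier B \<Longrightarrow> (\<lambda>c. f a b c) \<in> lin_maps K C U"
  obtains F where "F \<in> lin_maps K (tensor K A (tensor K B C)) U"
    "\<And>a b c. a \<in> carrier A \<Longrightarrow> b \<in> carrier B \<Longrightarrow> c \<in> carrier C \<Longrightarrow>
      F (pure_tensor K A (tensor K B C) a (pure_tensor K B C b c)) = f a b c"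
proof
  have b: "bilin K B C U (f a)" if "a \<in> carrier A" for a
    by (intro bilinI f2 f3 that)
  have bl: "bilin K A (tensor K B C) U (\<lambda>a. tensor_lift K U (f a))"
    by (intro bilinI lin_lift_param[OF _ m(2,3,4) b f1 m(1)] tensor_lift_lin[OF m(2,3,4) b])
  show "tensor_lift K U (\<lambda>a. tensor_lift K U (f a)) \<in> lin_maps K (tensor K A (tensor K B C)) U"
    by (intro tensor_lift_lin bl m tensor_module)
  show "tensor_lift K U (\<lambda>a. tensor_lift K U (f a)) (pure_tensor K A (tensor K B C) a (pure_tensor K B C b c)) = f a b c"
    if "a \<in> carrier A" "b \<in> carrier B" "c \<in> carrier C" for a b c
    using that m by (simp add: tensor_lift_pure[OF _ _ _ bl] tensor_lift_pure[OF m(2,3,4) b])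
qed

lemma unital_algebra_module: "unital_algebra K A \<Longrightarrow> module K A"
  by (simp add: unital_algebra_def)

lemma unital_algebra_ring: "unital_algebra K A \<Longrightarrow> ring A"
  by (simp add: unital_algebra_def)

lemma unital_algebra_one_closed: "unital_algebra K A \<Longrightarrow> \<one>\<^bsub>A\<^esub> \<in> carrier A"
  by (simp add: unital_algebra_def ring_def monoid.one_closed)

lemma unital_algebra_mult_bilin:
  assumes "unital_algebra K A" shows "bilin K A A A (monoid.mult A)"
proof -
  interpret R: ring A by (rule unital_algebra_ring) fact
  interpret A: unital_algebra K A by fact
  show ?thesis
    by (intro bilinI lin_mapsI) (auto simp: R.l_distr R.r_distr A.smult_mult_left A.smult_mult_right)
qed

text \<open>
  The structure that a member needs in order to stand on the left of a crossing.  The coaction is an explicit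
  function, so that \<open>H\<close> with its comultiplication, a Yetter-Drinfel'd module algebra and a copy of either of them
  inside another type are all instances.  Coassociativity is stated in Sweedler form, with values in the universal
  target \<open>X \<otimes> (H \<otimes> H)\<close>.
\<close>

locale coacting_algebra = H: bialgebra K H + X: unital_algebra K X
  for K :: "('k, 'c) ring_scheme" and H :: "('k, 'h, 'a) bialgebra_scheme" and X :: "('k, 'v, 'b) module_scheme" +
  fixes \<delta> :: "'v \<Rightarrow> ('k, 'v, 'h) tensor"
  assumes coact_lin: "\<delta> \<in> lin_maps K X (tensor K X H)"
    and coact_coassoc: "x \<in> carrier X \<Longrightarrow>
      tensor_lift K (tensor K X (tensor K H H)) (\<lambda>x0 x1. tensor_lift K (tensor K X (tensor K H H)) (\<lambda>x00 x01.
        pure_tensor K X (tensor K H H) x00 (pure_tensor K H H x01 x1)) (\<delta> x0)) (\<delta> x) =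
      tensor_lift K (tensor K X (tensor K H H)) (\<lambda>x0 x1. tensor_lift K (tensor K X (tensor K H H)) (\<lambda>h1 h2.
        pure_tensor K X (tensor K H H) x0 (pure_tensor K H H h1 h2)) (comult H x1)) (\<delta> x)"
    and coact_mult: "\<lbrakk>x \<in> carrier X; y \<in> carrier X\<rbrakk> \<Longrightarrow>
      \<delta> (x \<otimes>\<^bsub>X\<^esub> y) =
      tensor_lift K (tensor K X H) (\<lambda>x0 x1. tensor_lift K (tensor K X H) (\<lambda>y0 y1.
        pure_tensor K X H (x0 \<otimes>\<^bsub>X\<^esub> y0) (x1 \<otimes>\<^bsub>H\<^esub> y1)) (\<delta> y)) (\<delta> x)"
    and coact_one: "\<delta> \<one>\<^bsub>X\<^esub> = pure_tensor K X H \<one>\<^bsub>X\<^esub> \<one>\<^bsub>H\<^esub>"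

text \<open>
  The structure that a member needs in order to stand on the right of a crossing.  The order in which \<open>h\<^sub>1\<close> and
  \<open>h\<^sub>2\<close> act on a product is reversed, as in a Yetter-Drinfel'd module algebra.
\<close>

locale acted_algebra = H: bialgebra K H + Y: unital_algebra K Y
  for K :: "('k, 'c) ring_scheme" and H :: "('k, 'h, 'a) bialgebra_scheme" and Y :: "('k, 'v, 'b) module_scheme" +
  fixes \<alpha> :: "'h \<Rightarrow> 'v \<Rightarrow> 'v"
  assumes act_bilin: "bilin K H Y Y \<alpha>"
    and act_mult: "\<lbrakk>h \<in> carrier H; g \<in> carrier H; y \<in> carrier Y\<rbrakk> \<Longrightarrow> \<alpha> (h \<otimes>\<^bsub>H\<^esub> g) y = \<alpha> h (\<alpha> g y)"
    and act_one: "y \<in> carrier Y \<Longrightarrow> \<alpha> \<one>\<^bsub>H\<^esub> y = y"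
    and act_alg_mult: "\<lbrakk>h \<in> carrier H; y \<in> carrier Y; z \<in> carrier Y\<rbrakk> \<Longrightarrow>
      \<alpha> h (y \<otimes>\<^bsub>Y\<^esub> z) = tensor_lift K Y (\<lambda>h1 h2. \<alpha> h2 y \<otimes>\<^bsub>Y\<^esub> \<alpha> h1 z) (comult H h)"
    and act_alg_one: "h \<in> carrier H \<Longrightarrow> \<alpha> h \<one>\<^bsub>Y\<^esub> = counit H h \<odot>\<^bsub>Y\<^esub> \<one>\<^bsub>Y\<^esub>"

locale yd_algebra = coacting_algebra K H Y \<delta> + acted_algebra K H Y \<alpha> for K H Y \<delta> \<alpha> +
  assumes yd: "\<lbrakk>h \<in> carrier H; y \<in> carrier Y\<rbrakk> \<Longrightarrow>
      tensor_lift K (tensor K Y H) (\<lambda>h1 h2. tensor_lift K (tensor K Y H) (\<lambda>y0 y1.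
        pure_tensor K Y H y0 (y1 \<otimes>\<^bsub>H\<^esub> h1)) (\<delta> (\<alpha> h2 y))) (comult H h) =
      tensor_lift K (tensor K Y H) (\<lambda>h1 h2. tensor_lift K (tensor K Y H) (\<lambda>y0 y1.
        pure_tensor K Y H (\<alpha> h1 y0) (h2 \<otimes>\<^bsub>H\<^esub> y1)) (\<delta> y)) (comult H h)"

context bialgebra begin

lemma module_H: "module K H" ..

lemmas H_mult_bilin = unital_algebra_mult_bilin[OF unital_algebra_axioms]

lemmas H_rules = module_H lin_comp[OF comult_linear] lin_maps_closed[OF comult_linear]
  lin_left[OF H_mult_bilin] lin_right[OF H_mult_bilin] bilin_closed[OF H_mult_bilin]

end

context coacting_algebra begin

lemma module_X: "module K X" ..

lemmas X_mult_bilin = unital_algebra_mult_bilin[OF X.unital_algebra_axioms]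

lemmas X_rules = module_X lin_comp[OF coact_lin] lin_maps_closed[OF coact_lin]
  lin_left[OF X_mult_bilin] lin_right[OF X_mult_bilin] bilin_closed[OF X_mult_bilin]

text \<open>
  Both sides are images of the two sides of \<open>coact_coassoc\<close> under the linear map induced by \<open>f\<close>.
\<close>

lemma coassoc_sweedler:
  assumes U: "module K U"
    and f1: "\<And>b c. b \<in> carrier H \<Longrightarrow> c \<in> carrier H \<Longrightarrow> (\<lambda>a. f a b c) \<in> lin_maps K X U"
    and f2: "\<And>a c. a \<in> carrier X \<Longrightarrow> c \<in> carrier H \<Longrightarrow> (\<lambda>b. f a b c) \<in> lin_maps K H U"
    and f3: "\<And>a b. a \<in> carrier X \<Longrightarrow> b \<in> carrier H \<Longrightarrow> (\<lambda>c. f a b c) \<in> lin_maps K H U"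
    and x: "x \<in> carrier X"
  shows "tensor_lift K U (\<lambda>x0 x1. tensor_lift K U (\<lambda>x00 x01. f x00 x01 x1) (\<delta> x0)) (\<delta> x) =
    tensor_lift K U (\<lambda>x0 x1. tensor_lift K U (\<lambda>h1 h2. f x0 h1 h2) (comult H x1)) (\<delta> x)"
proof -
  let ?T = "tensor K X (tensor K H H)"
  obtain F where F: "F \<in> lin_maps K ?T U"
    and Fp: "\<And>a b c. a \<in> carrier X \<Longrightarrow> b \<in> carrier H \<Longrightarrow> c \<in> carrier H \<Longrightarrow>
      F (pure_tensor K X (tensor K H H) a (pure_tensor K H H b c)) = f a b c"
    using trilinear_factor[OF module_X H.module_H H.module_H U f1 f2 f3] by blast
  have mT: "module K ?T" by (intro tensor_module module_X H.module_H)
  note rl = lin_rules H.H_rules X_rules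
  note dx = lin_maps_closed[OF coact_lin]
  have 1: "F (tensor_lift K ?T (\<lambda>x0 x1. tensor_lift K ?T (\<lambda>x00 x01.
        pure_tensor K X (tensor K H H) x00 (pure_tensor K H H x01 x1)) (\<delta> x0)) (\<delta> x)) =
      tensor_lift K U (\<lambda>x0 x1. F (tensor_lift K ?T (\<lambda>x00 x01.
        pure_tensor K X (tensor K H H) x00 (pure_tensor K H H x01 x1)) (\<delta> x0))) (\<delta> x)"
    by (rule lin_tensor_lift[OF module_X H.module_H mT U F _ dx[OF x]]) (assumption | rule rl)+
  have 2: "F (tensor_lift K ?T (\<lambda>x00 x01.
        pure_tensor K X (tensor K H H) x00 (pure_tensor K H H x01 x1)) (\<delta> x0)) =
      tensor_lift K U (\<lambda>x00 x01. f x00 x01 x1) (\<delta> x0)" if "x0 \<in> carrier X" "x1 \<in> carrier H" for x0 x1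
  proof -
    have "F (tensor_lift K ?T (\<lambda>x00 x01.
        pure_tensor K X (tensor K H H) x00 (pure_tensor K H H x01 x1)) (\<delta> x0)) =
      tensor_lift K U (\<lambda>x00 x01. F (pure_tensor K X (tensor K H H) x00 (pure_tensor K H H x01 x1))) (\<delta> x0)"
      by (rule lin_tensor_lift[OF module_X H.module_H mT U F _ dx[OF that(1)]]) (assumption | rule that rl)+
    also have "\<dots> = tensor_lift K U (\<lambda>x00 x01. f x00 x01 x1) (\<delta> x0)"
      by (rule tensor_lift_cong[OF module_X H.module_H dx[OF that(1)]]) (intro Fp that)
    finally show ?thesis .
  qed
  have 3: "F (tensor_lift K ?T (\<lambda>x0 x1. tensor_lift K ?T (\<lambda>h1 h2.
        pure_tensor K X (tensor K H H) x0 (pure_tensor K H H h1 h2)) (comult H x1)) (\<delta> x)) =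
      tensor_lift K U (\<lambda>x0 x1. F (tensor_lift K ?T (\<lambda>h1 h2.
        pure_tensor K X (tensor K H H) x0 (pure_tensor K H H h1 h2)) (comult H x1))) (\<delta> x)"
    by (rule lin_tensor_lift[OF module_X H.module_H mT U F _ dx[OF x]]) (assumption | rule rl)+
  have 4: "F (tensor_lift K ?T (\<lambda>h1 h2.
        pure_tensor K X (tensor K H H) x0 (pure_tensor K H H h1 h2)) (comult H x1)) =
      tensor_lift K U (\<lambda>h1 h2. f x0 h1 h2) (comult H x1)" if "x0 \<in> carrier X" "x1 \<in> carrier H" for x0 x1
  proof -
    note dh = lin_maps_closed[OF H.comult_linear that(2)]
    have "F (tensor_lift K ?T (\<lambda>h1 h2.
        pure_tensor K X (tensor K H H) x0 (pure_tensor K H H h1 h2)) (comult H x1)) =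
      tensor_lift K U (\<lambda>h1 h2. F (pure_tensor K X (tensor K H H) x0 (pure_tensor K H H h1 h2))) (comult H x1)"
      by (rule lin_tensor_lift[OF H.module_H H.module_H mT U F _ dh]) (assumption | rule that rl)+
    also have "\<dots> = tensor_lift K U (\<lambda>h1 h2. f x0 h1 h2) (comult H x1)"
      by (rule tensor_lift_cong[OF H.module_H H.module_H dh]) (intro Fp that)
    finally show ?thesis .
  qed
  show ?thesis
    using arg_cong[OF coact_coassoc[OF x], of F]
    unfolding 1 3 by (simp only: tensor_lift_cong[OF module_X H.module_H dx[OF x] 2]
      tensor_lift_cong[OF module_X H.module_H dx[OF x] 4])
qed

lemma coact_mult_sweedler:
  assumes U: "module K U" and F: "bilin K X H U F" and x: "x \<in> carrier X" and y: "y \<in> carrier X"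
  shows "tensor_lift K U F (\<delta> (x \<otimes>\<^bsub>X\<^esub> y)) =
    tensor_lift K U (\<lambda>x0 x1. tensor_lift K U (\<lambda>y0 y1. F (x0 \<otimes>\<^bsub>X\<^esub> y0) (x1 \<otimes>\<^bsub>H\<^esub> y1)) (\<delta> y)) (\<delta> x)"
proof -
  note rl = lin_rules H.H_rules X_rules x y
  note dx = lin_maps_closed[OF coact_lin]
  have "tensor_lift K U F (\<delta> (x \<otimes>\<^bsub>X\<^esub> y)) = tensor_lift K U (\<lambda>x0 x1. tensor_lift K U F
     (tensor_lift K (tensor K X H) (\<lambda>y0 y1. pure_tensor K X H (x0 \<otimes>\<^bsub>X\<^esub> y0) (x1 \<otimes>\<^bsub>H\<^esub> y1)) (\<delta> y))) (\<delta> x)"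
    unfolding coact_mult[OF x y]
    by (rule lin_tensor_lift[OF module_X H.module_H _ U tensor_lift_lin[OF module_X H.module_H U F] _ dx[OF x]])
      (assumption | rule rl)+
  also have "\<dots> = tensor_lift K U (\<lambda>x0 x1. tensor_lift K U (\<lambda>y0 y1. F (x0 \<otimes>\<^bsub>X\<^esub> y0) (x1 \<otimes>\<^bsub>H\<^esub> y1)) (\<delta> y)) (\<delta> x)"
    by (rule tensor_lift_cong[OF module_X H.module_H dx[OF x]],
        rule tensor_lift_lift[OF module_X H.module_H module_X H.module_H U F dx[OF y]])
      (assumption | rule rl)+
  finally show ?thesis .
qed

end

context acted_algebra begin

lemma module_Y: "module K Y" ..

lemmas Y_mult_bilin = unital_algebra_mult_bilin[OF Y.unital_algebra_axioms]

lemmas Y_rules = module_Y lin_left[OF act_bilin] lin_right[OF act_bilin] bilin_closed[OF act_bilin]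
  lin_left[OF Y_mult_bilin] lin_right[OF Y_mult_bilin] bilin_closed[OF Y_mult_bilin]

end

lemma (in yd_algebra) yd_sweedler:
  assumes U: "module K U" and F: "bilin K Y H U F" and h: "h \<in> carrier H" and y: "y \<in> carrier Y"
  shows "tensor_lift K U (\<lambda>h1 h2. tensor_lift K U (\<lambda>y0 y1. F y0 (y1 \<otimes>\<^bsub>H\<^esub> h1)) (\<delta> (\<alpha> h2 y))) (comult H h) =
    tensor_lift K U (\<lambda>h1 h2. tensor_lift K U (\<lambda>y0 y1. F (\<alpha> h1 y0) (h2 \<otimes>\<^bsub>H\<^esub> y1)) (\<delta> y)) (comult H h)"
proof -
  note rl = lin_rules H.H_rules X_rules Y_rules h y
  let ?T = "tensor K Y H"
  note dx = lin_maps_closed[OF coact_lin]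
  note dh = lin_maps_closed[OF H.comult_linear]
  note Fl = tensor_lift_lin[OF module_Y H.module_H U F]
  have mT: "module K ?T" by (intro tensor_module module_Y H.module_H)
  have 1: "tensor_lift K U F (tensor_lift K ?T (\<lambda>h1 h2. tensor_lift K ?T (\<lambda>y0 y1.
        pure_tensor K Y H y0 (y1 \<otimes>\<^bsub>H\<^esub> h1)) (\<delta> (\<alpha> h2 y))) (comult H h)) =
     tensor_lift K U (\<lambda>h1 h2. tensor_lift K U F (tensor_lift K ?T (\<lambda>y0 y1.
        pure_tensor K Y H y0 (y1 \<otimes>\<^bsub>H\<^esub> h1)) (\<delta> (\<alpha> h2 y)))) (comult H h)"
    by (rule lin_tensor_lift[OF H.module_H H.module_H mT U Fl _ dh[OF h]]) (assumption | rule rl)+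
  have 2: "\<dots> = tensor_lift K U (\<lambda>h1 h2. tensor_lift K U (\<lambda>y0 y1. F y0 (y1 \<otimes>\<^bsub>H\<^esub> h1)) (\<delta> (\<alpha> h2 y))) (comult H h)"
    by (rule tensor_lift_cong[OF H.module_H H.module_H dh[OF h]],
        rule tensor_lift_lift[OF module_Y H.module_H module_Y H.module_H U F])
      (assumption | rule rl)+
  have 3: "tensor_lift K U F (tensor_lift K ?T (\<lambda>h1 h2. tensor_lift K ?T (\<lambda>y0 y1.
        pure_tensor K Y H (\<alpha> h1 y0) (h2 \<otimes>\<^bsub>H\<^esub> y1)) (\<delta> y)) (comult H h)) =
     tensor_lift K U (\<lambda>h1 h2. tensor_lift K U F (tensor_lift K ?T (\<lambda>y0 y1.
        pure_tensor K Y H (\<alpha> h1 y0) (h2 \<otimes>\<^bsub>H\<^esub> y1)) (\<delta> y))) (comult H h)"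
    by (rule lin_tensor_lift[OF H.module_H H.module_H mT U Fl _ dh[OF h]]) (assumption | rule rl)+
  have 4: "\<dots> = tensor_lift K U (\<lambda>h1 h2. tensor_lift K U (\<lambda>y0 y1. F (\<alpha> h1 y0) (h2 \<otimes>\<^bsub>H\<^esub> y1)) (\<delta> y)) (comult H h)"
    by (rule tensor_lift_cong[OF H.module_H H.module_H dh[OF h]],
        rule tensor_lift_lift[OF module_Y H.module_H module_Y H.module_H U F])
      (assumption | rule rl)+
  show ?thesis using yd[OF h y] 1 2 3 4 by simp
qed

section \<open>The Yang-Baxter equation for crossings and multiplications\<close>

definition cross_braid where
  "cross_braid K X \<delta> Y \<alpha> = tensor_lift K (tensor K Y X)
    (\<lambda>a b. tensor_lift K (tensor K Y X) (\<lambda>a0 a1. pure_tensor K Y X (\<alpha> a1 b) a0) (\<delta> a))"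

definition unit_mult_braid where
  "unit_mult_braid K A = tensor_lift K (tensor K A A) (\<lambda>a b. pure_tensor K A A \<one>\<^bsub>A\<^esub> (a \<otimes>\<^bsub>A\<^esub> b))"

definition mult_unit_braid where
  "mult_unit_braid K A = tensor_lift K (tensor K A A) (\<lambda>a b. pure_tensor K A A (a \<otimes>\<^bsub>A\<^esub> b) \<one>\<^bsub>A\<^esub>)"

lemma unit_mult_bilin:
  assumes "unital_algebra K A"
  shows "bilin K A A (tensor K A A) (\<lambda>a b. pure_tensor K A A \<one>\<^bsub>A\<^esub> (a \<otimes>\<^bsub>A\<^esub> b))"
    and "bilin K A A (tensor K A A) (\<lambda>a b. pure_tensor K A A (a \<otimes>\<^bsub>A\<^esub> b) \<one>\<^bsub>A\<^esub>)"
proof -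
  interpret R: ring A by (rule unital_algebra_ring) fact
  interpret A: unital_algebra K A by fact
  note bl = unital_algebra_mult_bilin[OF assms]
  show "bilin K A A (tensor K A A) (\<lambda>a b. pure_tensor K A A \<one>\<^bsub>A\<^esub> (a \<otimes>\<^bsub>A\<^esub> b))"
    "bilin K A A (tensor K A A) (\<lambda>a b. pure_tensor K A A (a \<otimes>\<^bsub>A\<^esub> b) \<one>\<^bsub>A\<^esub>)"
    by (assumption | rule lin_rules R.one_closed A.module_axioms lin_left[OF bl] lin_right[OF bl] bilin_closed[OF bl])+
qed

lemma unit_mult_braid_lin:
  "unital_algebra K A \<Longrightarrow> unit_mult_braid K A \<in> lin_maps K (tensor K A A) (tensor K A A)"
  unfolding unit_mult_braid_def
  by (intro tensor_lift_lin unit_mult_bilin unital_algebra_module tensor_module)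

lemma mult_unit_braid_lin:
  "unital_algebra K A \<Longrightarrow> mult_unit_braid K A \<in> lin_maps K (tensor K A A) (tensor K A A)"
  unfolding mult_unit_braid_def
  by (intro tensor_lift_lin unit_mult_bilin unital_algebra_module tensor_module)

lemma unit_mult_braid_pure:
  "unital_algebra K A \<Longrightarrow> a \<in> carrier A \<Longrightarrow> b \<in> carrier A \<Longrightarrow>
    unit_mult_braid K A (pure_tensor K A A a b) = pure_tensor K A A \<one>\<^bsub>A\<^esub> (a \<otimes>\<^bsub>A\<^esub> b)"
  unfolding unit_mult_braid_def
  by (intro tensor_lift_pure unit_mult_bilin unital_algebra_module tensor_module)

lemma mult_unit_braid_pure:
  "unital_algebra K A \<Longrightarrow> a \<in> carrier A \<Longrightarrow> b \<in> carrier A \<Longrightarrow>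
    mult_unit_braid K A (pure_tensor K A A a b) = pure_tensor K A A (a \<otimes>\<^bsub>A\<^esub> b) \<one>\<^bsub>A\<^esub>"
  unfolding mult_unit_braid_def
  by (intro tensor_lift_pure unit_mult_bilin unital_algebra_module tensor_module)

lemma cross_bilin:
  assumes "module K X" "module K H" "module K Y" "\<delta> \<in> lin_maps K X (tensor K X H)" "bilin K H Y Y \<alpha>"
  shows "b \<in> carrier Y \<Longrightarrow> bilin K X H (tensor K Y X) (\<lambda>a0 a1. pure_tensor K Y X (\<alpha> a1 b) a0)"
    and "bilin K X Y (tensor K Y X)
      (\<lambda>a b. tensor_lift K (tensor K Y X) (\<lambda>a0 a1. pure_tensor K Y X (\<alpha> a1 b) a0) (\<delta> a))"
proof -
  note rl = lin_rules assms(1-3) lin_left[OF assms(5)] lin_right[OF assms(5)] bilin_closed[OF assms(5)]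
    lin_comp[OF assms(4)] lin_maps_closed[OF assms(4)]
  show "b \<in> carrier Y \<Longrightarrow> bilin K X H (tensor K Y X) (\<lambda>a0 a1. pure_tensor K Y X (\<alpha> a1 b) a0)"
    by (assumption | rule rl)+
  show "bilin K X Y (tensor K Y X)
      (\<lambda>a b. tensor_lift K (tensor K Y X) (\<lambda>a0 a1. pure_tensor K Y X (\<alpha> a1 b) a0) (\<delta> a))"
    by (assumption | rule rl)+
qed

lemma cross_braid_lin:
  assumes "module K X" "module K H" "module K Y" "\<delta> \<in> lin_maps K X (tensor K X H)" "bilin K H Y Y \<alpha>"
  shows "cross_braid K X \<delta> Y \<alpha> \<in> lin_maps K (tensor K X Y) (tensor K Y X)"
  unfolding cross_braid_def
  by (intro tensor_lift_lin cross_bilin(2)[OF assms(1-5)] assms tensor_module)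

lemma cross_braid_pure:
  assumes "module K X" "module K H" "module K Y" "\<delta> \<in> lin_maps K X (tensor K X H)" "bilin K H Y Y \<alpha>"
    "a \<in> carrier X" "b \<in> carrier Y"
  shows "cross_braid K X \<delta> Y \<alpha> (pure_tensor K X Y a b) =
    tensor_lift K (tensor K Y X) (\<lambda>a0 a1. pure_tensor K Y X (\<alpha> a1 b) a0) (\<delta> a)"
  unfolding cross_braid_def
  by (intro tensor_lift_pure cross_bilin(2)[OF assms(1-5)] assms tensor_module)

lemma lift_cross_braid:
  assumes "module K X" "module K H" "module K Y" "\<delta> \<in> lin_maps K X (tensor K X H)" "bilin K H Y Y \<alpha>"
    "module K R" "bilin K Y X R F" "a \<in> carrier X" "b \<in> carrier Y"
  shows "tensor_lift K R F (cross_braid K X \<delta> Y \<alpha> (pure_tensor K X Y a b)) =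
    tensor_lift K R (\<lambda>a0 a1. F (\<alpha> a1 b) a0) (\<delta> a)"
  unfolding cross_braid_pure[OF assms(1-5,8,9)]
  by (rule tensor_lift_lift[OF assms(3,1,1,2,6,7)])
    (use assms in \<open>auto intro!: cross_bilin(1)[OF assms(1-5)] lin_maps_closed[OF assms(4)] bilin_closed[OF assms(5)]\<close>)

lemma lift_unit_mult_braid:
  assumes "unital_algebra K A" "module K R" "bilin K A A R F" "a \<in> carrier A" "b \<in> carrier A"
  shows "tensor_lift K R F (unit_mult_braid K A (pure_tensor K A A a b)) = F \<one>\<^bsub>A\<^esub> (a \<otimes>\<^bsub>A\<^esub> b)"
proof -
  interpret R: ring A by (rule unital_algebra_ring) fact
  interpret A: unital_algebra K A by fact
  show ?thesis using assms
    by (simp add: unit_mult_braid_pure tensor_lift_pure[OF A.module_axioms A.module_axioms])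
qed

lemma lift_mult_unit_braid:
  assumes "unital_algebra K A" "module K R" "bilin K A A R F" "a \<in> carrier A" "b \<in> carrier A"
  shows "tensor_lift K R F (mult_unit_braid K A (pure_tensor K A A a b)) = F (a \<otimes>\<^bsub>A\<^esub> b) \<one>\<^bsub>A\<^esub>"
proof -
  interpret R: ring A by (rule unital_algebra_ring) fact
  interpret A: unital_algebra K A by fact
  show ?thesis using assms
    by (simp add: mult_unit_braid_pure tensor_lift_pure[OF A.module_axioms A.module_axioms])
qed

lemma ybe_unit_mult:
  assumes A: "unital_algebra K A"
  defines "s \<equiv> unit_mult_braid K A"
  shows "ybe K A A A s s s"
proof -
  interpret R: ring A by (rule unital_algebra_ring) fact
  interpret A: unital_algebra K A by fact
  note m = A.module_axioms
  have s: "s \<in> lin_maps K (tensor K A A) (tensor K A A)" unfolding s_def by (rule unit_mult_braid_lin[OF A])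
  note bb = ybe_bilin[OF m m m s s s]
  show ?thesis
    by (rule ybeI[OF m m m s s s]) (simp add: s_def lift_unit_mult_braid[OF A] bb[unfolded s_def] m R.m_assoc)
qed

lemma ybe_mult_unit:
  assumes A: "unital_algebra K A"
  defines "s \<equiv> mult_unit_braid K A"
  shows "ybe K A A A s s s"
proof -
  interpret R: ring A by (rule unital_algebra_ring) fact
  interpret A: unital_algebra K A by fact
  note m = A.module_axioms
  have s: "s \<in> lin_maps K (tensor K A A) (tensor K A A)" unfolding s_def by (rule mult_unit_braid_lin[OF A])
  note bb = ybe_bilin[OF m m m s s s]
  show ?thesis
    by (rule ybeI[OF m m m s s s]) (simp add: s_def lift_mult_unit_braid[OF A] bb[unfolded s_def] m R.m_assoc)
qed

context bialgebra begin

lemma counit_closed: "h \<in> carrier H \<Longrightarrow> counit H h \<in> carrier K"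
  using lin_maps_closed[OF counit_linear] by (simp add: self_module_def)

lemma counit_smult_bilin: "bilin K H H H (\<lambda>h1 h2. counit H h2 \<odot>\<^bsub>H\<^esub> h1)"
proof -
  have "module K H" ..
  then interpret m: module K H .
  have "counit H (x \<oplus>\<^bsub>H\<^esub> y) = counit H x \<oplus>\<^bsub>K\<^esub> counit H y" if "x \<in> carrier H" "y \<in> carrier H" for x y
    using lin_maps_add[OF counit_linear that] by (simp add: self_module_def)
  moreover have "counit H (c \<odot>\<^bsub>H\<^esub> y) = c \<otimes>\<^bsub>K\<^esub> counit H y" if "c \<in> carrier K" "y \<in> carrier H" for c y
    using lin_maps_smult[OF counit_linear that] by (simp add: self_module_def)
  ultimately show ?thesis
    by (intro bilinI lin_mapsI)
      (auto simp: counit_closed smult_l_distr smult_r_distr smult_assoc1[symmetric] m_comm)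
qed

end

context coacting_algebra begin

text \<open>
  The coaction is multiplicative and \<open>(gh)w = g(hw)\<close>, so crossing \<open>w\<close> with \<open>uv\<close> at once, or first with
  \<open>v\<close> and then with \<open>u\<close>, gives the same result.
\<close>

lemma cross_mult:
  assumes Y: "acted_algebra K H Y \<alpha>" and U: "module K U" and Q: "bilin K Y X U Q"
    and u: "u \<in> carrier X" and v: "v \<in> carrier X" and w: "w \<in> carrier Y"
  shows "tensor_lift K U (\<lambda>x0 x1. Q (\<alpha> x1 w) x0) (\<delta> (u \<otimes>\<^bsub>X\<^esub> v)) =
    tensor_lift K U (\<lambda>v0 v1. tensor_lift K U (\<lambda>u0 u1. Q (\<alpha> u1 (\<alpha> v1 w)) (u0 \<otimes>\<^bsub>X\<^esub> v0)) (\<delta> u)) (\<delta> v)"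
proof -
  interpret Y: acted_algebra K H Y \<alpha> by (rule Y)
  note rl = lin_rules H.H_rules X_rules Y.Y_rules u v w U lin_left[OF Q] lin_right[OF Q]
  note dx = lin_maps_closed[OF coact_lin]
  have "tensor_lift K U (\<lambda>x0 x1. Q (\<alpha> x1 w) x0) (\<delta> (u \<otimes>\<^bsub>X\<^esub> v)) =
    tensor_lift K U (\<lambda>u0 u1. tensor_lift K U (\<lambda>v0 v1. Q (\<alpha> (u1 \<otimes>\<^bsub>H\<^esub> v1) w) (u0 \<otimes>\<^bsub>X\<^esub> v0)) (\<delta> v)) (\<delta> u)"
    by (rule coact_mult_sweedler[OF U _ u v]) (assumption | rule rl)+
  also have "\<dots> = tensor_lift K U (\<lambda>u0 u1. tensor_lift K U (\<lambda>v0 v1. Q (\<alpha> u1 (\<alpha> v1 w)) (u0 \<otimes>\<^bsub>X\<^esub> v0)) (\<delta> v)) (\<delta> u)"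
    by (intro tensor_lift_cong[OF module_X H.module_H dx] u v) (simp add: Y.act_mult w)
  also have "\<dots> = tensor_lift K U (\<lambda>v0 v1. tensor_lift K U (\<lambda>u0 u1. Q (\<alpha> u1 (\<alpha> v1 w)) (u0 \<otimes>\<^bsub>X\<^esub> v0)) (\<delta> u)) (\<delta> v)"
    by (rule tensor_lift_swap[OF module_X H.module_H module_X H.module_H U dx[OF u] dx[OF v]])
      (assumption | rule rl)+
  finally show ?thesis .
qed

text \<open>
  Pulling \<open>w\<close> through \<open>u \<otimes> v\<close> and multiplying afterwards is compared with multiplying first; this is
  \<open>cross_mult\<close>.  The unit that the multiplication leaves behind, on either side, passes \<open>w\<close> unchanged because it
  coacts trivially.  Which side the unit is on makes no difference, so the lemma serves both \<open>H\<close> and the other members.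
\<close>

lemma ybe_cross_left:
  assumes Y: "acted_algebra K H Y \<alpha>"
    and s: "s \<in> {unit_mult_braid K X, mult_unit_braid K X}"
  defines "c \<equiv> cross_braid K X \<delta> Y \<alpha>"
  shows "ybe K X X Y s c c"
proof -
  interpret Y: acted_algebra K H Y \<alpha> by (rule Y)
  note A = X.unital_algebra_axioms
  note [simp] = module_X Y.module_Y H.module_H
  note cl = cross_braid_lin[OF module_X H.module_H Y.module_Y coact_lin Y.act_bilin, folded c_def]
  have sl: "s \<in> lin_maps K (tensor K X X) (tensor K X X)"
    using s unit_mult_braid_lin[OF A] mult_unit_braid_lin[OF A] by blast
  note bb = ybe_bilin[OF module_X module_X Y.module_Y sl cl cl]
  let ?R = "tensor K (tensor K Y X) X"
  have R: "module K ?R" by simp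
  note cr = lift_cross_braid[OF module_X H.module_H Y.module_Y coact_lin Y.act_bilin R, folded c_def]
  note dx = lin_maps_closed[OF coact_lin]
  note cong = tensor_lift_cong[OF module_X H.module_H dx]
  note yc = bilin_closed[OF Y.act_bilin]
  let ?P = "\<lambda>y a b. pure_tensor K (tensor K Y X) X (pure_tensor K Y X y a) b"
  have bP: "bilin K Y X ?R (\<lambda>y a. ?P y \<one>\<^bsub>X\<^esub> a)" "bilin K Y X ?R (\<lambda>y a. ?P y a \<one>\<^bsub>X\<^esub>)"
    by (assumption | rule lin_rules module_X Y.module_Y unital_algebra_one_closed[OF A])+
  have one: "tensor_lift K ?R F (c (pure_tensor K X Y \<one>\<^bsub>X\<^esub> w)) = F w \<one>\<^bsub>X\<^esub>"
    if F: "bilin K Y X ?R F" and w: "w \<in> carrier Y" for F w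
  proof -
    have b: "bilin K X H ?R (\<lambda>a0 a1. F (\<alpha> a1 w) a0)"
      by (assumption | rule lin_rules X_rules H.H_rules Y.Y_rules w R lin_left[OF F] lin_right[OF F])+
    have "tensor_lift K ?R F (c (pure_tensor K X Y \<one>\<^bsub>X\<^esub> w)) = F (\<alpha> \<one>\<^bsub>H\<^esub> w) \<one>\<^bsub>X\<^esub>"
      using w by (simp add: cr[OF F] coact_one tensor_lift_pure[OF module_X H.module_H R b])
    then show ?thesis using w by (simp add: Y.act_one)
  qed
  have one': "tensor_lift K ?R (\<lambda>a0 a1. ?P (\<alpha> a1 w) a0 x) (\<delta> \<one>\<^bsub>X\<^esub>) = ?P w \<one>\<^bsub>X\<^esub> x"
    if x: "x \<in> carrier X" and w: "w \<in> carrier Y" for x w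
  proof -
    have b: "bilin K Y X ?R (\<lambda>y a. ?P y a x)"
      by (assumption | rule lin_rules module_X Y.module_Y x)+
    show ?thesis using one[OF b w] cr[OF b unital_algebra_one_closed[OF A] w] by simp
  qed
  show ?thesis
  proof (rule ybeI[OF module_X module_X Y.module_Y sl cl cl])
    fix u v w assume u: "u \<in> carrier X" and v: "v \<in> carrier X" and w: "w \<in> carrier Y"
    have uv: "u \<otimes>\<^bsub>X\<^esub> v \<in> carrier X" using u v by simp
    from s consider "s = unit_mult_braid K X" | "s = mult_unit_braid K X" by blast
    then show "tensor_lift K ?R (\<lambda>v' u'. tensor_lift K ?R (\<lambda>w' u''. tensor_lift K ?R (\<lambda>w'' v''. ?P w'' v'' u'')
          (c (pure_tensor K X Y v' w'))) (c (pure_tensor K X Y u' w))) (s (pure_tensor K X X u v)) =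
      tensor_lift K ?R (\<lambda>w' v'. tensor_lift K ?R (\<lambda>w'' u'. tensor_lift K ?R (\<lambda>v'' u''. ?P w'' v'' u'')
          (s (pure_tensor K X X u' v'))) (c (pure_tensor K X Y u w'))) (c (pure_tensor K X Y v w))"
      (is "?lhs = ?rhs")
    proof cases
      case 1
      note bb = bb[unfolded 1]
      have "?lhs = tensor_lift K ?R (\<lambda>x0 x1. ?P (\<alpha> x1 w) \<one>\<^bsub>X\<^esub> x0) (\<delta> (u \<otimes>\<^bsub>X\<^esub> v))"
        unfolding 1 using u v w by (simp add: lift_unit_mult_braid[OF A R] bb cr one' yc uv cong: cong)
      also have "\<dots> = tensor_lift K ?R (\<lambda>v0 v1. tensor_lift K ?R
          (\<lambda>u0 u1. ?P (\<alpha> u1 (\<alpha> v1 w)) \<one>\<^bsub>X\<^esub> (u0 \<otimes>\<^bsub>X\<^esub> v0)) (\<delta> u)) (\<delta> v)"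
        by (rule cross_mult[OF Y R bP(1) u v w])
      also have "\<dots> = ?rhs"
        unfolding 1 using u v w by (simp add: lift_unit_mult_braid[OF A R] bb cr yc cong: cong)
      finally show ?thesis .
    next
      case 2
      note bb = bb[unfolded 2]
      have "?lhs = tensor_lift K ?R (\<lambda>w' u''. tensor_lift K ?R (\<lambda>w'' v''. ?P w'' v'' u'')
          (c (pure_tensor K X Y (u \<otimes>\<^bsub>X\<^esub> v) w'))) (c (pure_tensor K X Y \<one>\<^bsub>X\<^esub> w))"
        unfolding 2 using u v w by (simp add: lift_mult_unit_braid[OF A R] bb)
      also have "\<dots> = tensor_lift K ?R (\<lambda>w'' v''. ?P w'' v'' \<one>\<^bsub>X\<^esub>) (c (pure_tensor K X Y (u \<otimes>\<^bsub>X\<^esub> v) w))"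
        by (rule one[OF bb(2)[OF uv] w])
      also have "\<dots> = tensor_lift K ?R (\<lambda>x0 x1. ?P (\<alpha> x1 w) x0 \<one>\<^bsub>X\<^esub>) (\<delta> (u \<otimes>\<^bsub>X\<^esub> v))"
        using uv w unital_algebra_one_closed[OF A] by (simp add: cr bb)
      also have "\<dots> = tensor_lift K ?R (\<lambda>v0 v1. tensor_lift K ?R
          (\<lambda>u0 u1. ?P (\<alpha> u1 (\<alpha> v1 w)) (u0 \<otimes>\<^bsub>X\<^esub> v0) \<one>\<^bsub>X\<^esub>) (\<delta> u)) (\<delta> v)"
        by (rule cross_mult[OF Y R bP(2) u v w])
      also have "\<dots> = ?rhs"
        unfolding 2 using u v w by (simp add: lift_mult_unit_braid[OF A R] bb cr yc cong: cong)
      finally show ?thesis .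
    qed
  qed
qed

text \<open>
  By coassociativity the left-hand side becomes \<open>1 \<otimes> (u\<^sub>1\<^sub>2v)(u\<^sub>1\<^sub>1w) \<otimes> u\<^sub>0\<close> and the right-hand side
  \<open>u\<^sub>1\<^sub>2 1 \<otimes> u\<^sub>1\<^sub>1(vw) \<otimes> u\<^sub>0\<close>.  Both equal \<open>1 \<otimes> u\<^sub>1(vw) \<otimes> u\<^sub>0\<close>: the first since the action
  distributes over products, the second since \<open>h 1 = \<epsilon>(h) 1\<close> and by the counit law of \<open>H\<close>.
\<close>

lemma ybe_cross_right:
  assumes Y: "acted_algebra K H Y \<alpha>"
  defines "c \<equiv> cross_braid K X \<delta> Y \<alpha>" and "s \<equiv> unit_mult_braid K Y"
  shows "ybe K X Y Y c c s"
proof -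
  interpret Y: acted_algebra K H Y \<alpha> by (rule Y)
  note A = Y.Y.unital_algebra_axioms
  note [simp] = module_X Y.module_Y H.module_H
  note cl = cross_braid_lin[OF module_X H.module_H Y.module_Y coact_lin Y.act_bilin, folded c_def]
  note sl = unit_mult_braid_lin[OF A, folded s_def]
  note bb = ybe_bilin[OF module_X Y.module_Y Y.module_Y cl cl sl]
  let ?R = "tensor K (tensor K Y Y) X"
  have R: "module K ?R" by simp
  note cr = lift_cross_braid[OF module_X H.module_H Y.module_Y coact_lin Y.act_bilin R, folded c_def]
  note sr = lift_unit_mult_braid[OF A R, folded s_def]
  note dx = lin_maps_closed[OF coact_lin]
  note dh = lin_maps_closed[OF H.comult_linear]
  note cong = tensor_lift_cong[OF module_X H.module_H dx]
  note yc = bilin_closed[OF Y.act_bilin]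
  let ?P = "\<lambda>y a b. pure_tensor K (tensor K Y Y) X (pure_tensor K Y Y y a) b"
  note one = unital_algebra_one_closed[OF A]
  note rl = lin_rules H.H_rules X_rules Y.Y_rules
  show ?thesis
  proof (rule ybeI[OF module_X Y.module_Y Y.module_Y cl cl sl])
    fix u v w assume u: "u \<in> carrier X" and v: "v \<in> carrier Y" and w: "w \<in> carrier Y"
    have vw: "v \<otimes>\<^bsub>Y\<^esub> w \<in> carrier Y" using v w by simp
    have *: "tensor_lift K ?R (\<lambda>h1 h2. ?P \<one>\<^bsub>Y\<^esub> (\<alpha> h2 v \<otimes>\<^bsub>Y\<^esub> \<alpha> h1 w) x0) (comult H x1) =
        ?P \<one>\<^bsub>Y\<^esub> (\<alpha> x1 (v \<otimes>\<^bsub>Y\<^esub> w)) x0" if "x0 \<in> carrier X" "x1 \<in> carrier H" for x0 x1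
      unfolding Y.act_alg_mult[OF that(2) v w]
      by (rule lin_tensor_lift[symmetric, OF H.module_H H.module_H Y.module_Y R _ _ dh[OF that(2)],
            where h = "\<lambda>y. ?P \<one>\<^bsub>Y\<^esub> y x0"]) (assumption | rule that one v w rl)+
    have **: "tensor_lift K ?R (\<lambda>h1 h2. ?P (\<alpha> h2 \<one>\<^bsub>Y\<^esub>) (\<alpha> h1 (v \<otimes>\<^bsub>Y\<^esub> w)) x0) (comult H x1) =
        ?P \<one>\<^bsub>Y\<^esub> (\<alpha> x1 (v \<otimes>\<^bsub>Y\<^esub> w)) x0" if "x0 \<in> carrier X" "x1 \<in> carrier H" for x0 x1
    proof -
      let ?z = "v \<otimes>\<^bsub>Y\<^esub> w"
      have l1: "(\<lambda>y. ?P y a x0) \<in> lin_maps K Y ?R" if "a \<in> carrier Y" for a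
        by (assumption | rule that \<open>x0 \<in> carrier X\<close> rl)+
      have l2: "(\<lambda>h. ?P \<one>\<^bsub>Y\<^esub> (\<alpha> h ?z) x0) \<in> lin_maps K H ?R"
        by (assumption | rule that one vw rl)+
      have "?P (\<alpha> h2 \<one>\<^bsub>Y\<^esub>) (\<alpha> h1 ?z) x0 = ?P \<one>\<^bsub>Y\<^esub> (\<alpha> (counit H h2 \<odot>\<^bsub>H\<^esub> h1) ?z) x0"
        if "h1 \<in> carrier H" "h2 \<in> carrier H" for h1 h2
        using that H.counit_closed[OF that(2)] vw
        by (simp add: Y.act_alg_one one yc lin_maps_smult[OF l1] lin_maps_smult[OF l2])
      then have "tensor_lift K ?R (\<lambda>h1 h2. ?P (\<alpha> h2 \<one>\<^bsub>Y\<^esub>) (\<alpha> h1 ?z) x0) (comult H x1) =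
          tensor_lift K ?R (\<lambda>h1 h2. ?P \<one>\<^bsub>Y\<^esub> (\<alpha> (counit H h2 \<odot>\<^bsub>H\<^esub> h1) ?z) x0) (comult H x1)"
        by (rule tensor_lift_cong[OF H.module_H H.module_H dh[OF that(2)]])
      also have "\<dots> = ?P \<one>\<^bsub>Y\<^esub> (\<alpha> (tensor_lift K H (\<lambda>h1 h2. counit H h2 \<odot>\<^bsub>H\<^esub> h1) (comult H x1)) ?z) x0"
        by (rule lin_tensor_lift[symmetric, OF H.module_H H.module_H H.module_H R l2 H.counit_smult_bilin dh[OF that(2)]])
      finally show ?thesis by (simp add: H.counit_right[OF that(2)])
    qed
    show "tensor_lift K ?R (\<lambda>v' u'. tensor_lift K ?R (\<lambda>w' u''. tensor_lift K ?R (\<lambda>w'' v''. ?P w'' v'' u'')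
          (s (pure_tensor K Y Y v' w'))) (c (pure_tensor K X Y u' w))) (c (pure_tensor K X Y u v)) =
      tensor_lift K ?R (\<lambda>w' v'. tensor_lift K ?R (\<lambda>w'' u'. tensor_lift K ?R (\<lambda>v'' u''. ?P w'' v'' u'')
          (c (pure_tensor K X Y u' v'))) (c (pure_tensor K X Y u w'))) (s (pure_tensor K Y Y v w))"
      (is "?lhs = ?rhs")
    proof -
      have "?lhs = tensor_lift K ?R (\<lambda>x0 x1. tensor_lift K ?R (\<lambda>x00 x01.
          ?P \<one>\<^bsub>Y\<^esub> (\<alpha> x1 v \<otimes>\<^bsub>Y\<^esub> \<alpha> x01 w) x00) (\<delta> x0)) (\<delta> u)"
        using u v w by (simp add: sr bb cr yc one cong: cong)
      also have "\<dots> = tensor_lift K ?R (\<lambda>x0 x1. tensor_lift K ?R (\<lambda>h1 h2.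
          ?P \<one>\<^bsub>Y\<^esub> (\<alpha> h2 v \<otimes>\<^bsub>Y\<^esub> \<alpha> h1 w) x0) (comult H x1)) (\<delta> u)"
        by (rule coassoc_sweedler[OF R _ _ _ u]) (assumption | rule one v w rl)+
      also have "\<dots> = tensor_lift K ?R (\<lambda>x0 x1. ?P \<one>\<^bsub>Y\<^esub> (\<alpha> x1 (v \<otimes>\<^bsub>Y\<^esub> w)) x0) (\<delta> u)"
        by (rule cong[OF u *])
      also have "\<dots> = tensor_lift K ?R (\<lambda>x0 x1. tensor_lift K ?R (\<lambda>h1 h2.
          ?P (\<alpha> h2 \<one>\<^bsub>Y\<^esub>) (\<alpha> h1 (v \<otimes>\<^bsub>Y\<^esub> w)) x0) (comult H x1)) (\<delta> u)"
        by (rule cong[OF u **[symmetric]])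
      also have "\<dots> = tensor_lift K ?R (\<lambda>x0 x1. tensor_lift K ?R (\<lambda>x00 x01.
          ?P (\<alpha> x1 \<one>\<^bsub>Y\<^esub>) (\<alpha> x01 (v \<otimes>\<^bsub>Y\<^esub> w)) x00) (\<delta> x0)) (\<delta> u)"
        by (rule coassoc_sweedler[OF R _ _ _ u, symmetric]) (assumption | rule one v w rl)+
      also have "\<dots> = ?rhs"
        using u v w vw by (simp add: sr bb cr yc one cong: cong)
      finally show ?thesis .
    qed
  qed
qed

text \<open>
  By coassociativity of the coaction on \<open>u\<close>, and with \<open>h = u\<^sub>1\<close>, the two sides are
  \<open>(h\<^sub>2v)\<^sub>1h\<^sub>1w \<otimes> (h\<^sub>2v)\<^sub>0 \<otimes> u\<^sub>0\<close> and \<open>h\<^sub>2v\<^sub>1w \<otimes> h\<^sub>1v\<^sub>0 \<otimes> u\<^sub>0\<close>: the two sides of the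
  Yetter-Drinfel'd condition for \<open>h\<close> and \<open>v\<close>.
\<close>

lemma ybe_cross_cross:
  assumes Y: "yd_algebra K H Y \<epsilon> \<beta>" and Z: "acted_algebra K H Z \<gamma>"
  defines "c \<equiv> cross_braid K X \<delta> Y \<beta>" and "d \<equiv> cross_braid K X \<delta> Z \<gamma>" and "e \<equiv> cross_braid K Y \<epsilon> Z \<gamma>"
  shows "ybe K X Y Z c d e"
proof -
  interpret Y: yd_algebra K H Y \<epsilon> \<beta> by (rule Y)
  interpret Z: acted_algebra K H Z \<gamma> by (rule Z)
  note [simp] = module_X Y.module_Y H.module_H Z.module_Y
  note cl = cross_braid_lin[OF module_X H.module_H Y.module_Y coact_lin Y.act_bilin, folded c_def]
  note dl = cross_braid_lin[OF module_X H.module_H Z.module_Y coact_lin Z.act_bilin, folded d_def]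
  note el = cross_braid_lin[OF Y.module_X H.module_H Z.module_Y Y.coact_lin Z.act_bilin, folded e_def]
  note bb = ybe_bilin[OF module_X Y.module_Y Z.module_Y cl dl el]
  let ?R = "tensor K (tensor K Z Y) X"
  have R: "module K ?R" by simp
  note cr = lift_cross_braid[OF module_X H.module_H Y.module_Y coact_lin Y.act_bilin R, folded c_def]
  note dr = lift_cross_braid[OF module_X H.module_H Z.module_Y coact_lin Z.act_bilin R, folded d_def]
  note er = lift_cross_braid[OF Y.module_X H.module_H Z.module_Y Y.coact_lin Z.act_bilin R, folded e_def]
  note dx = lin_maps_closed[OF coact_lin]
  note dy = lin_maps_closed[OF Y.coact_lin]
  note dh = lin_maps_closed[OF H.comult_linear]
  note congx = tensor_lift_cong[OF module_X H.module_H dx]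
  note congy = tensor_lift_cong[OF Y.module_X H.module_H dy]
  note congh = tensor_lift_cong[OF H.module_H H.module_H dh]
  note yc = bilin_closed[OF Y.act_bilin] bilin_closed[OF Z.act_bilin]
  let ?P = "\<lambda>z y x. pure_tensor K (tensor K Z Y) X (pure_tensor K Z Y z y) x"
  note rl = lin_rules H.H_rules X_rules Y.X_rules Y.Y_rules Z.Y_rules
  show ?thesis
  proof (rule ybeI[OF module_X Y.module_Y Z.module_Y cl dl el])
    fix u v w assume u: "u \<in> carrier X" and v: "v \<in> carrier Y" and w: "w \<in> carrier Z"
    note rl = R u v w rl
    show "tensor_lift K ?R (\<lambda>v' u'. tensor_lift K ?R (\<lambda>w' u''. tensor_lift K ?R (\<lambda>w'' v''. ?P w'' v'' u'')
          (e (pure_tensor K Y Z v' w'))) (d (pure_tensor K X Z u' w))) (c (pure_tensor K X Y u v)) =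
      tensor_lift K ?R (\<lambda>w' v'. tensor_lift K ?R (\<lambda>w'' u'. tensor_lift K ?R (\<lambda>v'' u''. ?P w'' v'' u'')
          (c (pure_tensor K X Y u' v'))) (d (pure_tensor K X Z u w'))) (e (pure_tensor K Y Z v w))"
      (is "?lhs = ?rhs")
    proof -
      have yd: "tensor_lift K ?R (\<lambda>h1 h2. tensor_lift K ?R (\<lambda>y0 y1. ?P (\<gamma> y1 (\<gamma> h1 w)) y0 x0) (\<epsilon> (\<beta> h2 v))) (comult H x1) =
        tensor_lift K ?R (\<lambda>h1 h2. tensor_lift K ?R (\<lambda>y0 y1. ?P (\<gamma> h2 (\<gamma> y1 w)) (\<beta> h1 y0) x0) (\<epsilon> v)) (comult H x1)"
        (is "?l = ?r") if x: "x0 \<in> carrier X" "x1 \<in> carrier H" for x0 x1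
      proof -
        have "?l = tensor_lift K ?R (\<lambda>h1 h2. tensor_lift K ?R (\<lambda>y0 y1. ?P (\<gamma> (y1 \<otimes>\<^bsub>H\<^esub> h1) w) y0 x0) (\<epsilon> (\<beta> h2 v))) (comult H x1)"
          by (intro congh congy x yc v) (simp_all add: Z.act_mult w)
        also have "\<dots> = tensor_lift K ?R (\<lambda>h1 h2. tensor_lift K ?R (\<lambda>y0 y1. ?P (\<gamma> (h2 \<otimes>\<^bsub>H\<^esub> y1) w) (\<beta> h1 y0) x0) (\<epsilon> v)) (comult H x1)"
          by (rule Y.yd_sweedler[OF R _ x(2) v]) (assumption | rule rl x)+
        also have "\<dots> = ?r"
          by (intro congh congy x yc v) (simp_all add: Z.act_mult w)
        finally show ?thesis .
      qed
      have "?lhs = tensor_lift K ?R (\<lambda>x0 x1. tensor_lift K ?R (\<lambda>w' u''. tensor_lift K ?R (\<lambda>w'' v''. ?P w'' v'' u'')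
          (e (pure_tensor K Y Z (\<beta> x1 v) w'))) (d (pure_tensor K X Z x0 w))) (\<delta> u)"
        by (rule cr[OF bb(1)[OF w] u v])
      also have "\<dots> = tensor_lift K ?R (\<lambda>x0 x1. tensor_lift K ?R (\<lambda>x00 x01. tensor_lift K ?R (\<lambda>y0 y1.
          ?P (\<gamma> y1 (\<gamma> x01 w)) y0 x00) (\<epsilon> (\<beta> x1 v))) (\<delta> x0)) (\<delta> u)"
        using u v w by (simp add: bb dr er yc cong: congx)
      also have "\<dots> = tensor_lift K ?R (\<lambda>x0 x1. tensor_lift K ?R (\<lambda>h1 h2. tensor_lift K ?R (\<lambda>y0 y1.
          ?P (\<gamma> y1 (\<gamma> h1 w)) y0 x0) (\<epsilon> (\<beta> h2 v))) (comult H x1)) (\<delta> u)"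
        by (rule coassoc_sweedler[OF R _ _ _ u]) (assumption | rule rl)+
      also have "\<dots> = tensor_lift K ?R (\<lambda>x0 x1. tensor_lift K ?R (\<lambda>h1 h2. tensor_lift K ?R (\<lambda>y0 y1.
          ?P (\<gamma> h2 (\<gamma> y1 w)) (\<beta> h1 y0) x0) (\<epsilon> v)) (comult H x1)) (\<delta> u)"
        by (rule congx[OF u yd])
      also have "\<dots> = tensor_lift K ?R (\<lambda>x0 x1. tensor_lift K ?R (\<lambda>y0 y1. tensor_lift K ?R (\<lambda>h1 h2.
          ?P (\<gamma> h2 (\<gamma> y1 w)) (\<beta> h1 y0) x0) (comult H x1)) (\<epsilon> v)) (\<delta> u)"
        by (rule congx[OF u], rule tensor_lift_swap[OF H.module_H H.module_H Y.module_X H.module_H R dh dy[OF v]])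
          (assumption | rule rl)+
      also have "\<dots> = tensor_lift K ?R (\<lambda>y0 y1. tensor_lift K ?R (\<lambda>x0 x1. tensor_lift K ?R (\<lambda>h1 h2.
          ?P (\<gamma> h2 (\<gamma> y1 w)) (\<beta> h1 y0) x0) (comult H x1)) (\<delta> u)) (\<epsilon> v)"
        by (rule tensor_lift_swap[OF module_X H.module_H Y.module_X H.module_H R dx[OF u] dy[OF v]])
          (assumption | rule rl)+
      also have "\<dots> = tensor_lift K ?R (\<lambda>y0 y1. tensor_lift K ?R (\<lambda>x0 x1. tensor_lift K ?R (\<lambda>x00 x01.
          ?P (\<gamma> x1 (\<gamma> y1 w)) (\<beta> x01 y0) x00) (\<delta> x0)) (\<delta> u)) (\<epsilon> v)"
        by (rule congy[OF v], rule coassoc_sweedler[OF R _ _ _ u, symmetric]) (assumption | rule rl)+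
      also have "\<dots> = tensor_lift K ?R (\<lambda>y0 y1. tensor_lift K ?R (\<lambda>w'' u'. tensor_lift K ?R (\<lambda>v'' u''. ?P w'' v'' u'')
          (c (pure_tensor K X Y u' y0))) (d (pure_tensor K X Z u (\<gamma> y1 w)))) (\<epsilon> v)"
        by (rule congy[OF v]) (use u w in \<open>simp add: bb cr dr yc cong: congx\<close>)
      also have "\<dots> = ?rhs"
        by (rule er[OF bb(6)[OF u] v w, symmetric])
      finally show ?thesis .
    qed
  qed
qed

end

section \<open>Copies of an algebra inside another type\<close>

lemma image_module_carrier: "carrier (image_module j X) = j ` carrier X"
  by (simp add: image_module_def ring.defs image_ring_carrier)

context
  fixes j :: "'v \<Rightarrow> 'w" and X :: "('k, 'v, 'b) module_scheme"
  assumes inj: "inj_on j (carrier X)"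
begin

lemma image_module_simps:
  "x \<in> carrier X \<Longrightarrow> y \<in> carrier X \<Longrightarrow> j x \<oplus>\<^bsub>image_module j X\<^esub> j y = j (x \<oplus>\<^bsub>X\<^esub> y)"
  "x \<in> carrier X \<Longrightarrow> y \<in> carrier X \<Longrightarrow> j x \<otimes>\<^bsub>image_module j X\<^esub> j y = j (x \<otimes>\<^bsub>X\<^esub> y)"
  "x \<in> carrier X \<Longrightarrow> c \<odot>\<^bsub>image_module j X\<^esub> j x = j (c \<odot>\<^bsub>X\<^esub> x)"
  "\<one>\<^bsub>image_module j X\<^esub> = j \<one>\<^bsub>X\<^esub>"
  "\<zero>\<^bsub>image_module j X\<^esub> = j \<zero>\<^bsub>X\<^esub>"
  using inj
  by (simp_all add: image_module_def ring.defs image_ring_def image_group_def monoid.defs inv_into_f_f)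

lemma image_module_module:
  assumes "module K X" shows "module K (image_module j X)"
proof -
  interpret X: module K X by fact
  show ?thesis
  proof (rule moduleI)
    show "cring K" by (rule X.R.is_cring)
    show "abelian_group (image_module j X)"
    proof (rule abelian_groupI)
      fix y assume "y \<in> carrier (image_module j X)"
      then obtain x where "x \<in> carrier X" "y = j x" by (auto simp: image_module_carrier)
      then show "\<exists>z\<in>carrier (image_module j X). z \<oplus>\<^bsub>image_module j X\<^esub> y = \<zero>\<^bsub>image_module j X\<^esub>"
        by (intro bexI[of _ "j (\<ominus>\<^bsub>X\<^esub> x)"]) (simp_all add: image_module_carrier image_module_simps X.M.l_neg)
    qed (auto simp: image_module_carrier image_module_simps X.M.a_ac)
  qed (auto simp: image_module_carrier image_module_simps X.smult_l_distr X.smult_r_distr X.smult_assoc1)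
qed

lemma image_module_lin: "j \<in> lin_maps K X (image_module j X)"
  by (rule lin_mapsI) (simp_all add: image_module_carrier image_module_simps)

lemma inv_image_module_lin: 
  assumes "module K X" shows "inv_into (carrier X) j \<in> lin_maps K (image_module j X) X"
proof -
  interpret X: module K X by fact
  show ?thesis
    using inj by (intro lin_mapsI) (auto simp: image_module_carrier image_module_simps)
qed

lemma image_module_unital_algebra:
  assumes "unital_algebra K X" shows "unital_algebra K (image_module j X)"
proof -
  interpret R: ring X by (rule unital_algebra_ring) fact
  interpret X: unital_algebra K X by fact
  interpret M: module K "image_module j X" by (rule image_module_module) (rule X.module_axioms)
  have "ring (image_module j X)"
    by (rule ringI[OF M.M.abelian_group_axioms])
      (auto intro!: monoidI simp: image_module_carrier image_module_simps R.m_assoc R.l_distr R.r_distr)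
  then show ?thesis
    by (intro unital_algebra.intro unital_algebra_axioms.intro X.K.field_axioms M.module_axioms)
      (auto simp: image_module_carrier image_module_simps X.smult_mult_left X.smult_mult_right)
qed

end

text \<open>
  The members of a system are copies of the given algebras inside one common type.  Their structure maps are those of
  the originals, conjugated with the copying function \<open>j\<close>.
\<close>

definition image_coact where
  "image_coact K H j X \<delta> y = tensor_map K (image_module j X) H j (\<lambda>h. h) (\<delta> (inv_into (carrier X) j y))"

definition image_act where
  "image_act j X \<alpha> h y = j (\<alpha> h (inv_into (carrier X) j y))"

lemma image_act_image: "inj_on j (carrier X) \<Longrightarrow> x \<in> carrier X \<Longrightarrow> image_act j X \<alpha> h (j x) = j (\<alpha> h x)"
  by (simp add: image_act_def)

lemma image_act_bilin:
  assumes inj: "inj_on j (carrier X)" and m: "module K X" "module K H" and b: "bilin K H X X \<alpha>"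
  shows "bilin K H (image_module j X) (image_module j X) (image_act j X \<alpha>)"
proof -
  note k = inv_image_module_lin[OF inj m(1)]
  show ?thesis
    unfolding image_act_def
    by (intro bilinI lin_comp[OF image_module_lin[OF inj]] lin_right[OF b k] bilin_left[OF b] lin_maps_closed[OF k])
qed

lemma image_acted_algebra:
  assumes inj: "inj_on j (carrier X)" and "acted_algebra K H X \<alpha>"
  shows "acted_algebra K H (image_module j X) (image_act j X \<alpha>)"
proof -
  interpret X: acted_algebra K H X \<alpha> by fact
  note j = image_module_lin[OF inj, of K]
  note [simp] = image_module_carrier image_module_simps[OF inj] image_act_image[OF inj] bilin_closed[OF X.act_bilin]
  show ?thesis
  proof (intro acted_algebra.intro acted_algebra_axioms.intro X.H.bialgebra_axioms
      image_module_unital_algebra[OF inj X.Y.unital_algebra_axioms]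
      image_act_bilin[OF inj X.module_Y X.H.module_H X.act_bilin])
    fix h y z assume h: "h \<in> carrier H" and "y \<in> carrier (image_module j X)" "z \<in> carrier (image_module j X)"
    then obtain a b where ab: "a \<in> carrier X" "y = j a" "b \<in> carrier X" "z = j b" by auto
    note dh = lin_maps_closed[OF X.H.comult_linear h]
    have "image_act j X \<alpha> h (y \<otimes>\<^bsub>image_module j X\<^esub> z) =
      j (tensor_lift K X (\<lambda>h1 h2. \<alpha> h2 a \<otimes>\<^bsub>X\<^esub> \<alpha> h1 b) (comult H h))"
      using ab h by (simp add: X.act_alg_mult)
    also have "\<dots> = tensor_lift K (image_module j X) (\<lambda>h1 h2. j (\<alpha> h2 a \<otimes>\<^bsub>X\<^esub> \<alpha> h1 b)) (comult H h)"
      by (rule lin_tensor_lift[OF X.H.module_H X.H.module_H X.module_Y image_module_module[OF inj X.module_Y] j _ dh])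
        (assumption | rule ab lin_rules X.Y_rules)+
    also have "\<dots> = tensor_lift K (image_module j X)
        (\<lambda>h1 h2. image_act j X \<alpha> h2 y \<otimes>\<^bsub>image_module j X\<^esub> image_act j X \<alpha> h1 z) (comult H h)"
      by (rule tensor_lift_cong[OF X.H.module_H X.H.module_H dh]) (use ab in simp)
    finally show "image_act j X \<alpha> h (y \<otimes>\<^bsub>image_module j X\<^esub> z) = tensor_lift K (image_module j X)
        (\<lambda>h1 h2. image_act j X \<alpha> h2 y \<otimes>\<^bsub>image_module j X\<^esub> image_act j X \<alpha> h1 z) (comult H h)" .
  qed (auto simp: X.act_mult X.act_one X.act_alg_one)
qed

lemma image_coact_lin:
  assumes inj: "inj_on j (carrier X)" and m: "module K X" "module K H" and d: "\<delta> \<in> lin_maps K X (tensor K X H)"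
  shows "image_coact K H j X \<delta> \<in> lin_maps K (image_module j X) (tensor K (image_module j X) H)"
  unfolding image_coact_def
  by (rule lin_comp[OF tensor_map_lin[OF m(1,2) image_module_module[OF inj m(1)] m(2)
    image_module_lin[OF inj] lin_id] lin_comp[OF d inv_image_module_lin[OF inj m(1)]]])

lemma lift_image_coact:
  assumes inj: "inj_on j (carrier X)" and m: "module K X" "module K H" "module K U"
    and d: "\<delta> \<in> lin_maps K X (tensor K X H)"
    and F: "bilin K (image_module j X) H U F" and x: "x \<in> carrier X"
  shows "tensor_lift K U F (image_coact K H j X \<delta> (j x)) = tensor_lift K U (\<lambda>x0 x1. F (j x0) x1) (\<delta> x)"
proof -
  note j = image_module_lin[OF inj, of K] and m' = image_module_module[OF inj m(1)]
  show ?thesis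
    unfolding image_coact_def tensor_map_def inv_into_f_f[OF inj x]
    by (rule tensor_lift_lift[OF m' m(2,1,2,3) F lin_maps_closed[OF d x] tensor_map_bilin[OF m' m(2) j lin_id] lin_maps_closed[OF j]])
qed

lemma image_coacting_algebra:
  assumes inj: "inj_on j (carrier X)" and "coacting_algebra K H X \<delta>"
  shows "coacting_algebra K H (image_module j X) (image_coact K H j X \<delta>)"
proof -
  interpret X: coacting_algebra K H X \<delta> by fact
  let ?X = "image_module j X" and ?d = "image_coact K H j X \<delta>"
  note j = image_module_lin[OF inj, of K] and m' = image_module_module[OF inj X.module_X]
  note dl = image_coact_lin[OF inj X.module_X X.H.module_H X.coact_lin]
  note dr = lift_image_coact[OF inj X.module_X X.H.module_H _ X.coact_lin]
  note u' = image_module_unital_algebra[OF inj X.X.unital_algebra_axioms]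
  note mb = unital_algebra_mult_bilin[OF u']
  note dx = lin_maps_closed[OF X.coact_lin]
  note cong = tensor_lift_cong[OF X.module_X X.H.module_H dx]
  have jc: "j x \<in> carrier ?X" if "x \<in> carrier X" for x using that by (simp add: image_module_carrier)
  note rl = lin_rules X.X_rules X.H.H_rules m' lin_comp[OF j] jc lin_comp[OF dl] lin_maps_closed[OF dl]
    lin_left[OF mb] lin_right[OF mb] bilin_closed[OF mb]
  show ?thesis
  proof (intro coacting_algebra.intro coacting_algebra_axioms.intro X.H.bialgebra_axioms u' dl)
    fix y assume "y \<in> carrier ?X"
    then obtain x where x: "x \<in> carrier X" "y = j x" by (auto simp: image_module_carrier)
    let ?T = "tensor K ?X (tensor K H H)"
    have T: "module K ?T" by (intro tensor_module m' X.H.module_H)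
    show "tensor_lift K ?T (\<lambda>x0 x1. tensor_lift K ?T (\<lambda>x00 x01.
        pure_tensor K ?X (tensor K H H) x00 (pure_tensor K H H x01 x1)) (?d x0)) (?d y) =
      tensor_lift K ?T (\<lambda>x0 x1. tensor_lift K ?T (\<lambda>h1 h2.
        pure_tensor K ?X (tensor K H H) x0 (pure_tensor K H H h1 h2)) (comult H x1)) (?d y)"
      (is "?lhs = ?rhs")
    proof -
      have "?lhs = tensor_lift K ?T (\<lambda>x0 x1. tensor_lift K ?T (\<lambda>x00 x01.
          pure_tensor K ?X (tensor K H H) x00 (pure_tensor K H H x01 x1)) (?d (j x0))) (\<delta> x)"
        unfolding x(2) by (rule dr[OF T _ x(1)]) (assumption | rule rl)+
      also have "\<dots> = tensor_lift K ?T (\<lambda>x0 x1. tensor_lift K ?T (\<lambda>x00 x01.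
          pure_tensor K ?X (tensor K H H) (j x00) (pure_tensor K H H x01 x1)) (\<delta> x0)) (\<delta> x)"
        by (rule cong[OF x(1)], rule dr[OF T]) (assumption | rule rl)+
      also have "\<dots> = tensor_lift K ?T (\<lambda>x0 x1. tensor_lift K ?T (\<lambda>h1 h2.
          pure_tensor K ?X (tensor K H H) (j x0) (pure_tensor K H H h1 h2)) (comult H x1)) (\<delta> x)"
        by (rule X.coassoc_sweedler[OF T _ _ _ x(1)]) (assumption | rule rl)+
      also have "\<dots> = ?rhs"
        unfolding x(2) by (rule dr[OF T _ x(1), symmetric]) (assumption | rule rl)+
      finally show ?thesis .
    qed
  next
    fix y z assume "y \<in> carrier ?X" "z \<in> carrier ?X"
    then obtain a b where ab: "a \<in> carrier X" "y = j a" "b \<in> carrier X" "z = j b"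
      by (auto simp: image_module_carrier)
    let ?T = "tensor K ?X H"
    have T: "module K ?T" by (intro tensor_module m' X.H.module_H)
    have "?d (y \<otimes>\<^bsub>?X\<^esub> z) = tensor_lift K ?T (\<lambda>x0 x1. pure_tensor K ?X H (j x0) x1) (\<delta> (a \<otimes>\<^bsub>X\<^esub> b))"
      using ab by (simp add: image_module_simps[OF inj] image_coact_def tensor_map_def inj)
    also have "\<dots> = tensor_lift K ?T (\<lambda>x0 x1. tensor_lift K ?T (\<lambda>y0 y1.
        pure_tensor K ?X H (j (x0 \<otimes>\<^bsub>X\<^esub> y0)) (x1 \<otimes>\<^bsub>H\<^esub> y1)) (\<delta> b)) (\<delta> a)"
      by (rule X.coact_mult_sweedler[OF T _ ab(1,3)]) (assumption | rule rl)+
    also have "\<dots> = tensor_lift K ?T (\<lambda>x0 x1. tensor_lift K ?T (\<lambda>y0 y1.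
        pure_tensor K ?X H (j x0 \<otimes>\<^bsub>?X\<^esub> j y0) (x1 \<otimes>\<^bsub>H\<^esub> y1)) (\<delta> b)) (\<delta> a)"
      by (intro cong ab) (simp add: image_module_simps[OF inj])
    also have "\<dots> = tensor_lift K ?T (\<lambda>x0 x1. tensor_lift K ?T (\<lambda>y0 y1.
        pure_tensor K ?X H (j x0 \<otimes>\<^bsub>?X\<^esub> y0) (x1 \<otimes>\<^bsub>H\<^esub> y1)) (?d z)) (\<delta> a)"
      unfolding ab(4) by (rule cong[OF ab(1)], rule dr[OF T _ ab(3), symmetric]) (assumption | rule rl)+
    also have "\<dots> = tensor_lift K ?T (\<lambda>x0 x1. tensor_lift K ?T (\<lambda>y0 y1.
        pure_tensor K ?X H (x0 \<otimes>\<^bsub>?X\<^esub> y0) (x1 \<otimes>\<^bsub>H\<^esub> y1)) (?d z)) (?d y)"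
      unfolding ab(2,4) by (rule dr[OF T _ ab(1), symmetric]) (assumption | rule ab rl)+
    finally show "?d (y \<otimes>\<^bsub>?X\<^esub> z) = tensor_lift K ?T (\<lambda>x0 x1. tensor_lift K ?T (\<lambda>y0 y1.
        pure_tensor K ?X H (x0 \<otimes>\<^bsub>?X\<^esub> y0) (x1 \<otimes>\<^bsub>H\<^esub> y1)) (?d z)) (?d y)" .
  next
    show "?d \<one>\<^bsub>?X\<^esub> = pure_tensor K ?X H \<one>\<^bsub>?X\<^esub> \<one>\<^bsub>H\<^esub>"
      using unital_algebra_one_closed[OF X.X.unital_algebra_axioms] unital_algebra_one_closed[OF X.H.unital_algebra_axioms]
      by (simp add: image_coact_def image_module_simps[OF inj] inj X.coact_one
          tensor_map_pure[OF X.module_X X.H.module_H m' X.H.module_H j lin_id])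
  qed
qed

lemma image_yd_algebra:
  assumes inj: "inj_on j (carrier X)" and "yd_algebra K H X \<delta> \<alpha>"
  shows "yd_algebra K H (image_module j X) (image_coact K H j X \<delta>) (image_act j X \<alpha>)"
proof -
  interpret X: yd_algebra K H X \<delta> \<alpha> by fact
  let ?X = "image_module j X" and ?d = "image_coact K H j X \<delta>" and ?a = "image_act j X \<alpha>"
  note j = image_module_lin[OF inj, of K] and m' = image_module_module[OF inj X.module_X]
  note dr = lift_image_coact[OF inj X.module_X X.H.module_H _ X.coact_lin]
  note ab = image_act_bilin[OF inj X.module_X X.H.module_H X.act_bilin]
  note congh = tensor_lift_cong[OF X.H.module_H X.H.module_H lin_maps_closed[OF X.H.comult_linear]]
  note congx = tensor_lift_cong[OF X.module_X X.H.module_H lin_maps_closed[OF X.coact_lin]]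
  have jc: "j x \<in> carrier ?X" if "x \<in> carrier X" for x using that by (simp add: image_module_carrier)
  note rl = lin_rules X.X_rules X.Y_rules X.H.H_rules m' lin_comp[OF j] jc
    lin_left[OF ab] lin_right[OF ab] bilin_closed[OF ab]
  let ?T = "tensor K ?X H"
  have T: "module K ?T" by (intro tensor_module m' X.H.module_H)
  show ?thesis
  proof (intro yd_algebra.intro yd_algebra_axioms.intro image_coacting_algebra image_acted_algebra inj
      X.coacting_algebra_axioms X.acted_algebra_axioms)
    fix h y assume h: "h \<in> carrier H" and "y \<in> carrier ?X"
    then obtain x where x: "x \<in> carrier X" "y = j x" by (auto simp: image_module_carrier)
    show "tensor_lift K ?T (\<lambda>h1 h2. tensor_lift K ?T (\<lambda>y0 y1.
        pure_tensor K ?X H y0 (y1 \<otimes>\<^bsub>H\<^esub> h1)) (?d (?a h2 y))) (comult H h) =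
      tensor_lift K ?T (\<lambda>h1 h2. tensor_lift K ?T (\<lambda>y0 y1.
        pure_tensor K ?X H (?a h1 y0) (h2 \<otimes>\<^bsub>H\<^esub> y1)) (?d y)) (comult H h)"
      (is "?lhs = ?rhs")
    proof -
      have "?lhs = tensor_lift K ?T (\<lambda>h1 h2. tensor_lift K ?T (\<lambda>y0 y1.
          pure_tensor K ?X H y0 (y1 \<otimes>\<^bsub>H\<^esub> h1)) (?d (j (\<alpha> h2 x)))) (comult H h)"
        by (rule congh[OF h]) (simp add: x image_act_image[OF inj])
      also have "\<dots> = tensor_lift K ?T (\<lambda>h1 h2. tensor_lift K ?T (\<lambda>y0 y1.
          pure_tensor K ?X H (j y0) (y1 \<otimes>\<^bsub>H\<^esub> h1)) (\<delta> (\<alpha> h2 x))) (comult H h)"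
        by (rule congh[OF h], rule dr[OF T]) (assumption | rule x(1) rl)+
      also have "\<dots> = tensor_lift K ?T (\<lambda>h1 h2. tensor_lift K ?T (\<lambda>y0 y1.
          pure_tensor K ?X H (j (\<alpha> h1 y0)) (h2 \<otimes>\<^bsub>H\<^esub> y1)) (\<delta> x)) (comult H h)"
        by (rule X.yd_sweedler[OF T _ h x(1)]) (assumption | rule rl)+
      also have "\<dots> = tensor_lift K ?T (\<lambda>h1 h2. tensor_lift K ?T (\<lambda>y0 y1.
          pure_tensor K ?X H (?a h1 (j y0)) (h2 \<otimes>\<^bsub>H\<^esub> y1)) (\<delta> x)) (comult H h)"
        by (intro congh congx h x(1)) (simp_all add: image_act_image[OF inj])
      also have "\<dots> = ?rhs"
        unfolding x(2) by (rule congh[OF h], rule dr[OF T _ x(1), symmetric]) (assumption | rule rl)+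
      finally show ?thesis .
    qed
  qed
qed

section \<open>Dual bases\<close>

lemma submodule_finsum:
  assumes "module K V" "submodule N K V" "\<And>a. a \<in> A \<Longrightarrow> f a \<in> N"
  shows "finsum V f A \<in> N"
proof -
  interpret V: module K V by fact
  interpret N: abelian_subgroup N V by (rule submodule_abelian_subgroup[OF assms(1,2)])
  show ?thesis using assms(3)
  proof (induction A rule: infinite_finite_induct)
    case (insert a A)
    then have "f a \<in> carrier V" "f \<in> A \<rightarrow> carrier V" using N.a_subset by auto
    then show ?case using insert by simp
  qed (auto simp: V.M.finsum_infinite)
qed

lemma lin_span_finite:
  assumes "module K V" "finite B" "B \<subseteq> carrier V" "v \<in> lin_span K V B"
  obtains c where "c \<in> B \<rightarrow> carrier K" "v = (\<Oplus>\<^bsub>V\<^esub>b\<in>B. c b \<odot>\<^bsub>V\<^esub> b)"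
proof -
  interpret V: module K V by fact
  let ?s = "\<lambda>c. \<Oplus>\<^bsub>V\<^esub>b\<in>B. c b \<odot>\<^bsub>V\<^esub> b"
  let ?S = "{?s c | c. c \<in> B \<rightarrow> carrier K}"
  have B: "b \<in> carrier V" if "b \<in> B" for b using assms(3) that by blast
  have cl: "(\<lambda>b. c b \<odot>\<^bsub>V\<^esub> b) \<in> B \<rightarrow> carrier V" if "c \<in> B \<rightarrow> carrier K" for c
    using that B by auto
  have add: "?s c \<oplus>\<^bsub>V\<^esub> ?s d = ?s (\<lambda>b. c b \<oplus>\<^bsub>K\<^esub> d b)" if "c \<in> B \<rightarrow> carrier K" "d \<in> B \<rightarrow> carrier K" for c d
  proof -
    have "?s (\<lambda>b. c b \<oplus>\<^bsub>K\<^esub> d b) = (\<Oplus>\<^bsub>V\<^esub>b\<in>B. c b \<odot>\<^bsub>V\<^esub> b \<oplus>\<^bsub>V\<^esub> d b \<odot>\<^bsub>V\<^esub> b)"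
      by (rule V.finsum_cong') (use that B V.smult_l_distr in \<open>auto simp: Pi_iff\<close>)
    then show ?thesis using V.finsum_addf[OF cl[OF that(1)] cl[OF that(2)]] by simp
  qed
  have sm: "k \<odot>\<^bsub>V\<^esub> ?s c = ?s (\<lambda>b. k \<otimes>\<^bsub>K\<^esub> c b)" if "k \<in> carrier K" "c \<in> B \<rightarrow> carrier K" for k c
  proof -
    have "?s (\<lambda>b. k \<otimes>\<^bsub>K\<^esub> c b) = (\<Oplus>\<^bsub>V\<^esub>b\<in>B. k \<odot>\<^bsub>V\<^esub> (c b \<odot>\<^bsub>V\<^esub> b))"
      by (rule V.finsum_cong') (use that B V.smult_assoc1 in \<open>auto simp: Pi_iff\<close>)
    then show ?thesis using V.finsum_smult_ldistr[OF assms(2) that(1) cl[OF that(2)]] by simp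
  qed
  have SI: "x \<in> ?S" if "c \<in> B \<rightarrow> carrier K" "x = ?s c" for x c
    using that by blast
  have smS: "k \<odot>\<^bsub>V\<^esub> x \<in> ?S" if k: "k \<in> carrier K" and x: "x \<in> ?S" for k x
  proof -
    obtain c where c: "c \<in> B \<rightarrow> carrier K" "x = ?s c" using x by blast
    then have "k \<odot>\<^bsub>V\<^esub> x = ?s (\<lambda>b. k \<otimes>\<^bsub>K\<^esub> c b)" using sm[OF k c(1)] by simp
    moreover have "(\<lambda>b. k \<otimes>\<^bsub>K\<^esub> c b) \<in> B \<rightarrow> carrier K" using k c by auto
    ultimately show ?thesis by (intro SI)
  qed
  have "submodule ?S K V"
  proof (rule V.submoduleI)
    show sub: "?S \<subseteq> carrier V" using cl by (auto intro!: V.finsum_closed)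
    have "?s (\<lambda>_. \<zero>\<^bsub>K\<^esub>) = \<zero>\<^bsub>V\<^esub>"
      by (rule V.M.add.finprod_one_eqI) (use B in auto)
    moreover have "(\<lambda>_. \<zero>\<^bsub>K\<^esub>) \<in> B \<rightarrow> carrier K" by auto
    ultimately show "\<zero>\<^bsub>V\<^esub> \<in> ?S" by (intro SI[of "\<lambda>_. \<zero>\<^bsub>K\<^esub>"]) simp_all
    show "\<ominus>\<^bsub>V\<^esub> x \<in> ?S" if x: "x \<in> ?S" for x
    proof -
      have "x \<in> carrier V" using sub x by blast
      then have "\<ominus>\<^bsub>V\<^esub> x = (\<ominus>\<^bsub>K\<^esub> \<one>\<^bsub>K\<^esub>) \<odot>\<^bsub>V\<^esub> x" by (simp add: V.smult_l_minus)
      then show ?thesis using smS[OF _ x, of "\<ominus>\<^bsub>K\<^esub> \<one>\<^bsub>K\<^esub>"] by simp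
    qed
    show "x \<oplus>\<^bsub>V\<^esub> y \<in> ?S" if xy: "x \<in> ?S" "y \<in> ?S" for x y
    proof -
      obtain c d where cd: "c \<in> B \<rightarrow> carrier K" "x = ?s c" "d \<in> B \<rightarrow> carrier K" "y = ?s d" using xy by blast
      then have "x \<oplus>\<^bsub>V\<^esub> y = ?s (\<lambda>b. c b \<oplus>\<^bsub>K\<^esub> d b)" using add by simp
      moreover have "(\<lambda>b. c b \<oplus>\<^bsub>K\<^esub> d b) \<in> B \<rightarrow> carrier K" using cd by auto
      ultimately show ?thesis by (intro SI)
    qed
  qed (rule smS)
  moreover have "B \<subseteq> ?S"
  proof
    fix a assume a: "a \<in> B"
    let ?c = "\<lambda>b. if b = a then \<one>\<^bsub>K\<^esub> else \<zero>\<^bsub>K\<^esub>"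
    have "?s ?c = (\<Oplus>\<^bsub>V\<^esub>b\<in>B. if a = b then b else \<zero>\<^bsub>V\<^esub>)"
      by (rule V.finsum_cong') (use B in auto)
    also have "\<dots> = a" by (rule V.finsum_singleton[OF a assms(2)]) (use B in auto)
    finally have "a = ?s ?c" by simp
    moreover have "?c \<in> B \<rightarrow> carrier K" by auto
    ultimately show "a \<in> ?S" by (intro SI)
  qed
  ultimately have "lin_span K V B \<subseteq> ?S" by (rule lin_span_least)
  then show ?thesis using assms(4) that by blast
qed

text \<open>
  A finite spanning set of least cardinality is linearly independent, since otherwise one of its elements would lie
  in the span of the others.  The coefficients in an expansion are then unique, hence linear in the vector.
\<close>

lemma dual_basis_exists:
  assumes "field K" "module K V" "finite_dimensional K V"
  obtains B \<phi> where "finite B" "B \<subseteq> carrier V"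
    "\<And>b. b \<in> B \<Longrightarrow> \<phi> b \<in> lin_maps K V (self_module K)"
    "\<And>v. v \<in> carrier V \<Longrightarrow> v = (\<Oplus>\<^bsub>V\<^esub>b\<in>B. \<phi> b v \<odot>\<^bsub>V\<^esub> b)"
proof -
  interpret K: field K by fact
  interpret V: module K V by fact
  let ?sp = "\<lambda>B. finite B \<and> B \<subseteq> carrier V \<and> lin_span K V B = carrier V"
  obtain B0 where "?sp B0" using assms(3) unfolding finite_dimensional_def by blast
  from ex_has_least_nat[of ?sp, OF this, of card]
  obtain B where B: "?sp B" and min: "\<And>A. ?sp A \<Longrightarrow> card B \<le> card A" by auto
  have Bc: "b \<in> carrier V" if "b \<in> B" for b using B that by blast
  let ?s = "\<lambda>c. \<Oplus>\<^bsub>V\<^esub>b\<in>B. c b \<odot>\<^bsub>V\<^esub> b"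
  have cl: "(\<lambda>b. c b \<odot>\<^bsub>V\<^esub> b) \<in> A \<rightarrow> carrier V" if "c \<in> B \<rightarrow> carrier K" "A \<subseteq> B" for c A
    using that Bc by (auto simp: Pi_iff subset_iff)
  have indep: "c a = \<zero>\<^bsub>K\<^esub>" if c: "c \<in> B \<rightarrow> carrier K" "?s c = \<zero>\<^bsub>V\<^esub>" and a: "a \<in> B" for c a
  proof (rule ccontr)
    assume nz: "c a \<noteq> \<zero>\<^bsub>K\<^esub>"
    let ?A = "B - {a}"
    let ?N = "lin_span K V ?A"
    have ca: "c a \<in> carrier K" using c a by auto
    have N: "submodule ?N K V" using B by (intro lin_span_submodule assms) auto
    interpret N: abelian_subgroup ?N V by (rule submodule_abelian_subgroup[OF assms(2) N])
    have AN: "?A \<subseteq> ?N" by (rule lin_span_superset)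
    have s: "(\<Oplus>\<^bsub>V\<^esub>b\<in>?A. c b \<odot>\<^bsub>V\<^esub> b) \<in> ?N"
      by (rule submodule_finsum[OF assms(2) N])
        (use c AN in \<open>auto intro!: submodule.smult_closed[OF N] simp: Pi_iff subset_iff\<close>)
    have "?s c = c a \<odot>\<^bsub>V\<^esub> a \<oplus>\<^bsub>V\<^esub> (\<Oplus>\<^bsub>V\<^esub>b\<in>?A. c b \<odot>\<^bsub>V\<^esub> b)"
      using V.finsum_insert[of ?A a "\<lambda>b. c b \<odot>\<^bsub>V\<^esub> b"] B a Bc ca cl[OF c(1), of ?A]
      by (simp add: insert_absorb)
    then have "c a \<odot>\<^bsub>V\<^esub> a = \<ominus>\<^bsub>V\<^esub> (\<Oplus>\<^bsub>V\<^esub>b\<in>?A. c b \<odot>\<^bsub>V\<^esub> b)"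
      using c(2) s N.a_subset ca Bc[OF a] by (intro V.M.minus_equality[symmetric]) auto
    then have "c a \<odot>\<^bsub>V\<^esub> a \<in> ?N" using s by simp
    then have "inv\<^bsub>K\<^esub> (c a) \<odot>\<^bsub>V\<^esub> (c a \<odot>\<^bsub>V\<^esub> a) \<in> ?N"
      using ca nz by (intro submodule.smult_closed[OF N, of "inv\<^bsub>K\<^esub> (c a)"]) (auto simp: K.field_Units)
    moreover have "inv\<^bsub>K\<^esub> (c a) \<odot>\<^bsub>V\<^esub> (c a \<odot>\<^bsub>V\<^esub> a) = a"
      using ca nz Bc[OF a] by (subst V.smult_assoc1[symmetric]) (auto simp: K.field_Units)
    ultimately have "a \<in> ?N" by simp
    then have "B \<subseteq> ?N" using AN by blast
    then have "lin_span K V B \<subseteq> ?N" by (rule lin_span_least[OF N])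
    then have "?sp ?A" using B N.a_subset by auto
    then have "card B \<le> card ?A" by (rule min)
    then show False using card_Diff1_less[of B a] B a by simp
  qed
  have uniq: "c a = d a" if c: "c \<in> B \<rightarrow> carrier K" and d: "d \<in> B \<rightarrow> carrier K" and e: "?s c = ?s d" and a: "a \<in> B" for c d a
  proof -
    have "?s (\<lambda>b. c b \<ominus>\<^bsub>K\<^esub> d b) = (\<Oplus>\<^bsub>V\<^esub>b\<in>B. c b \<odot>\<^bsub>V\<^esub> b \<oplus>\<^bsub>V\<^esub> ((\<ominus>\<^bsub>K\<^esub> \<one>\<^bsub>K\<^esub>) \<odot>\<^bsub>V\<^esub> (d b \<odot>\<^bsub>V\<^esub> b)))"
      by (rule V.finsum_cong')
        (use c d Bc in \<open>auto simp: Pi_iff a_minus_def V.smult_l_distr V.smult_assoc1[symmetric] K.l_minus\<close>)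
    also have "\<dots> = ?s c \<oplus>\<^bsub>V\<^esub> (\<Oplus>\<^bsub>V\<^esub>b\<in>B. (\<ominus>\<^bsub>K\<^esub> \<one>\<^bsub>K\<^esub>) \<odot>\<^bsub>V\<^esub> (d b \<odot>\<^bsub>V\<^esub> b))"
      by (rule V.finsum_addf) (use c d Bc in \<open>auto simp: Pi_iff\<close>)
    also have "\<dots> = ?s c \<oplus>\<^bsub>V\<^esub> (\<ominus>\<^bsub>K\<^esub> \<one>\<^bsub>K\<^esub>) \<odot>\<^bsub>V\<^esub> ?s d"
      using B cl[OF d, of B] by (simp add: V.finsum_smult_ldistr)
    also have "\<dots> = \<zero>\<^bsub>V\<^esub>"
    proof -
      have "?s d \<in> carrier V" using cl[OF d, of B] by (intro V.finsum_closed) auto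
      then show ?thesis using e by (simp add: V.smult_l_minus V.M.r_neg)
    qed
    finally have "c a \<ominus>\<^bsub>K\<^esub> d a = \<zero>\<^bsub>K\<^esub>" using c d by (intro indep[OF _ _ a]) auto
    moreover have "c a \<in> carrier K" "d a \<in> carrier K" using c d a by auto
    ultimately show ?thesis
      using K.minus_equality[of "c a" "\<ominus>\<^bsub>K\<^esub> d a"] by (simp add: a_minus_def)
  qed
  define C where "C v = (SOME c. c \<in> B \<rightarrow> carrier K \<and> v = ?s c)" for v
  have C: "C v \<in> B \<rightarrow> carrier K" "v = ?s (C v)" if "v \<in> carrier V" for v
  proof -
    have "\<exists>c. c \<in> B \<rightarrow> carrier K \<and> v = ?s c"
      using lin_span_finite[OF assms(2), of B v] B that by metis
    from someI_ex[OF this] show "C v \<in> B \<rightarrow> carrier K" "v = ?s (C v)" by (auto simp: C_def)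
  qed
  show ?thesis
  proof
    show "finite B" "B \<subseteq> carrier V" using B by auto
    show "v = (\<Oplus>\<^bsub>V\<^esub>b\<in>B. C v b \<odot>\<^bsub>V\<^esub> b)" if "v \<in> carrier V" for v using C(2)[OF that] .
    fix b assume b: "b \<in> B"
    show "(\<lambda>v. C v b) \<in> lin_maps K V (self_module K)"
    proof (rule lin_mapsI; simp add: self_module_def)
      show "C x b \<in> carrier K" if "x \<in> carrier V" for x using C(1)[OF that] b by auto
      fix x assume x: "x \<in> carrier V"
      show "C (x \<oplus>\<^bsub>V\<^esub> y) b = C x b \<oplus>\<^bsub>K\<^esub> C y b" if y: "y \<in> carrier V" for y
      proof (rule uniq[OF _ _ _ b])
        have "?s (\<lambda>b. C x b \<oplus>\<^bsub>K\<^esub> C y b) = (\<Oplus>\<^bsub>V\<^esub>b\<in>B. C x b \<odot>\<^bsub>V\<^esub> b \<oplus>\<^bsub>V\<^esub> C y b \<odot>\<^bsub>V\<^esub> b)"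
          by (rule V.finsum_cong') (use C(1)[OF x] C(1)[OF y] Bc V.smult_l_distr in \<open>auto simp: Pi_iff\<close>)
        also have "\<dots> = ?s (C x) \<oplus>\<^bsub>V\<^esub> ?s (C y)"
          using V.finsum_addf[OF cl[OF C(1)[OF x] subset_refl] cl[OF C(1)[OF y] subset_refl]] by simp
        also have "\<dots> = ?s (C (x \<oplus>\<^bsub>V\<^esub> y))" using C(2)[OF x] C(2)[OF y] C(2)[of "x \<oplus>\<^bsub>V\<^esub> y"] x y by simp
        finally show "?s (C (x \<oplus>\<^bsub>V\<^esub> y)) = ?s (\<lambda>b. C x b \<oplus>\<^bsub>K\<^esub> C y b)" by simp
      qed (use C(1)[OF x] C(1)[OF y] C(1)[of "x \<oplus>\<^bsub>V\<^esub> y"] x y in auto)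
      show "C (k \<odot>\<^bsub>V\<^esub> x) b = k \<otimes>\<^bsub>K\<^esub> C x b" if k: "k \<in> carrier K" for k
      proof (rule uniq[OF _ _ _ b])
        have "?s (\<lambda>b. k \<otimes>\<^bsub>K\<^esub> C x b) = (\<Oplus>\<^bsub>V\<^esub>b\<in>B. k \<odot>\<^bsub>V\<^esub> (C x b \<odot>\<^bsub>V\<^esub> b))"
          by (rule V.finsum_cong') (use C(1)[OF x] k Bc V.smult_assoc1 in \<open>auto simp: Pi_iff\<close>)
        also have "\<dots> = k \<odot>\<^bsub>V\<^esub> ?s (C x)"
          using V.finsum_smult_ldistr[OF _ k cl[OF C(1)[OF x] subset_refl]] B by simp
        also have "\<dots> = ?s (C (k \<odot>\<^bsub>V\<^esub> x))" using C(2)[OF x] C(2)[of "k \<odot>\<^bsub>V\<^esub> x"] x k by simp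
        finally show "?s (C (k \<odot>\<^bsub>V\<^esub> x)) = ?s (\<lambda>b. k \<otimes>\<^bsub>K\<^esub> C x b)" by simp
      qed (use C(1)[OF x] C(1)[of "k \<odot>\<^bsub>V\<^esub> x"] x k in auto)
    qed
  qed
qed

section \<open>The bialgebra and its Yetter-Drinfel'd module algebras\<close>

lemma tensor_assoc_coact:
  assumes m: "module K X" "module K H" and d: "\<delta> \<in> lin_maps K X (tensor K X H)" and x: "x \<in> carrier X"
  shows "tensor_assoc K X H H (tensor_map K (tensor K X H) H \<delta> (\<lambda>x. x) (\<delta> x)) =
    tensor_lift K (tensor K X (tensor K H H)) (\<lambda>x0 x1. tensor_lift K (tensor K X (tensor K H H)) (\<lambda>x00 x01.
        pure_tensor K X (tensor K H H) x00 (pure_tensor K H H x01 x1)) (\<delta> x0)) (\<delta> x)"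
proof -
  let ?T = "tensor K X (tensor K H H)"
  note dx = lin_maps_closed[OF d]
  have mm: "module K (tensor K X H)" "module K (tensor K (tensor K X H) H)" "module K ?T" using m by auto
  have "tensor_assoc K X H H (tensor_map K (tensor K X H) H \<delta> (\<lambda>x. x) (\<delta> x)) =
    tensor_lift K ?T (\<lambda>x0 x1. tensor_assoc K X H H (pure_tensor K (tensor K X H) H (\<delta> x0) x1)) (\<delta> x)"
    unfolding tensor_map_def
    by (rule lin_tensor_lift[OF m mm(2,3) tensor_assoc_lin[OF m m(2)] tensor_map_bilin[OF mm(1) m(2) d lin_id] dx[OF x]])
  also have "\<dots> = tensor_lift K ?T (\<lambda>x0 x1. tensor_lift K ?T (\<lambda>x00 x01.
        pure_tensor K X (tensor K H H) x00 (pure_tensor K H H x01 x1)) (\<delta> x0)) (\<delta> x)"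
    unfolding tensor_assoc_def Let_def
    by (rule tensor_lift_cong[OF m dx[OF x]], rule tensor_lift_pure[OF mm(1) m(2) mm(3) tensor_assoc_bilin[OF m m(2)]])
      (auto intro: dx)
  finally show ?thesis .
qed

lemma tensor_map_comult:
  assumes m: "module K X" "module K H" and d: "t \<in> carrier (tensor K X H)"
    and c: "\<Delta> \<in> lin_maps K H (tensor K H H)"
  shows "tensor_map K X (tensor K H H) (\<lambda>x. x) \<Delta> t =
    tensor_lift K (tensor K X (tensor K H H)) (\<lambda>x0 x1. tensor_lift K (tensor K X (tensor K H H)) (\<lambda>h1 h2.
        pure_tensor K X (tensor K H H) x0 (pure_tensor K H H h1 h2)) (\<Delta> x1)) t"
  unfolding tensor_map_def
proof (rule tensor_lift_cong[OF m d])
  fix x h assume x: "x \<in> carrier X" and h: "h \<in> carrier H"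
  let ?T = "tensor K X (tensor K H H)"
  have mm: "module K (tensor K H H)" "module K ?T" using m by auto
  have b: "bilin K H H ?T (\<lambda>h1 h2. pure_tensor K X (tensor K H H) x (pure_tensor K H H h1 h2))"
    by (assumption | rule x lin_rules m)+
  show "pure_tensor K X (tensor K H H) x (\<Delta> h) =
    tensor_lift K ?T (\<lambda>h1 h2. pure_tensor K X (tensor K H H) x (pure_tensor K H H h1 h2)) (\<Delta> h)"
    by (rule tensor_lin_eq[OF m(2,2) mm(2) _ tensor_lift_lin[OF m(2,2) mm(2) b] _ lin_maps_closed[OF c h]])
      (use x m mm in \<open>auto simp: tensor_lift_pure[OF m(2,2) mm(2) b] intro: bilin_right[OF pure_tensor_bilin]\<close>)
qed

lemma bialgebra_coacting_algebra:
  assumes "bialgebra K H" shows "coacting_algebra K H H (comult H)"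
proof -
  interpret bialgebra K H by fact
  note dh = lin_maps_closed[OF comult_linear]
  show ?thesis
    by (intro coacting_algebra.intro coacting_algebra_axioms.intro bialgebra_axioms unital_algebra_axioms
        comult_linear comult_mult comult_one)
      (simp add: tensor_assoc_coact[symmetric] tensor_map_comult[symmetric] module_H comult_linear dh coassoc)
qed

lemma yd_module_algebra_yd_algebra:
  assumes "yd_module_algebra K H V" shows "yd_algebra K H V (coact V) (act V)"
proof -
  interpret yd_module_algebra K H V by fact
  have mV: "module K V" by (rule unital_algebra_module) (rule V.unital_algebra_axioms)
  note dv = lin_maps_closed[OF coact_linear]
  have b: "bilin K H V V (act V)"
    by (intro bilinI lin_mapsI)
      (auto simp: act_add act_smult lin_maps_closed[OF act_linear] lin_maps_add[OF act_linear] lin_maps_smult[OF act_linear])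
  show ?thesis
    by (intro yd_algebra.intro coacting_algebra.intro acted_algebra.intro coacting_algebra_axioms.intro
        acted_algebra_axioms.intro yd_algebra_axioms.intro H.bialgebra_axioms V.unital_algebra_axioms
        coact_linear coact_mult coact_alg_one yetter_drinfeld b act_mult act_one act_alg_mult act_alg_one)
      (simp add: tensor_assoc_coact[symmetric] tensor_map_comult[symmetric] mV H.module_H H.comult_linear
        coact_linear dv coact_coassoc)
qed

section \<open>The dual of the bialgebra\<close>

lemma self_module_simps [simp]:
  "carrier (self_module K) = carrier K" "\<zero>\<^bsub>self_module K\<^esub> = \<zero>\<^bsub>K\<^esub>"
  "x \<oplus>\<^bsub>self_module K\<^esub> y = x \<oplus>\<^bsub>K\<^esub> y" "c \<odot>\<^bsub>self_module K\<^esub> x = c \<otimes>\<^bsub>K\<^esub> x"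
  by (simp_all add: self_module_def)

lemma self_module_module: "cring K \<Longrightarrow> module K (self_module K)"
proof -
  assume "cring K"
  then interpret cring K .
  show ?thesis
    by (rule moduleI) (auto intro!: abelian_groupI is_cring bexI[of _ "\<ominus>\<^bsub>K\<^esub> _"] simp: a_ac l_distr r_distr m_assoc r_neg)
qed

lemma self_module_mult_bilin:
  "cring K \<Longrightarrow> bilin K (self_module K) (self_module K) (self_module K) (\<lambda>x y. x \<otimes>\<^bsub>K\<^esub> y)"
proof -
  assume "cring K"
  then interpret cring K .
  show ?thesis by (intro bilinI lin_mapsI) (auto simp: l_distr r_distr m_ac)
qed

lemma finsum_self_module [simp]: "finsum (self_module K) f A = finsum K f A"
  by (simp add: finsum_def finprod_def self_module_def)

text \<open>
  Right translation of functionals.  For finite-dimensional \<open>H\<close> it is \<open>l\<^sub>1(h) l\<^sub>2\<close> in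
  Sweedler notation, as \<open>dual_comult_contract\<close> below shows.
\<close>

definition dual_act where
  "dual_act H h l = (\<lambda>x\<in>carrier H. l (x \<otimes>\<^bsub>H\<^esub> h))"

context bialgebra begin

abbreviation "D \<equiv> dual_algebra K H"
abbreviation "S \<equiv> self_module K"

lemma module_S: "module K S" by (rule self_module_module) (rule K.is_cring)

lemma S_mult_bilin: "bilin K S S S (\<lambda>x y. x \<otimes> y)"
  by (rule self_module_mult_bilin) (rule K.is_cring)

lemma dual_lin: "l \<in> carrier D \<Longrightarrow> l \<in> lin_maps K H S"
  by (simp add: dual_algebra_def)

lemma dual_eval_closed: "l \<in> carrier D \<Longrightarrow> h \<in> carrier H \<Longrightarrow> l h \<in> carrier K"
  using lin_maps_closed[OF dual_lin] by simp

lemma restrict_dual: "f \<in> lin_maps K H S \<Longrightarrow> restrict f (carrier H) \<in> carrier D"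
  using lin_cong[OF _ module_H, of f S "restrict f (carrier H)"] by (simp add: dual_algebra_def)

lemma dual_eqI: "l \<in> carrier D \<Longrightarrow> m \<in> carrier D \<Longrightarrow> (\<And>h. h \<in> carrier H \<Longrightarrow> l h = m h) \<Longrightarrow> l = m"
  by (auto simp: dual_algebra_def intro: extensionalityI)

lemma dual_simps:
  assumes "h \<in> carrier H"
  shows "(l \<oplus>\<^bsub>D\<^esub> m) h = l h \<oplus>\<^bsub>K\<^esub> m h" "(c \<odot>\<^bsub>D\<^esub> l) h = c \<otimes> l h" "\<zero>\<^bsub>D\<^esub> h = \<zero>\<^bsub>K\<^esub>" "\<one>\<^bsub>D\<^esub> h = counit H h"
    "(l \<otimes>\<^bsub>D\<^esub> m) h = tensor_lift K S (\<lambda>h1 h2. l h2 \<otimes> m h1) (comult H h)"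
  using assms by (simp_all add: dual_algebra_def)

lemma dual_add_closed: "l \<in> carrier D \<Longrightarrow> m \<in> carrier D \<Longrightarrow> l \<oplus>\<^bsub>D\<^esub> m \<in> carrier D"
proof -
  assume lm: "l \<in> carrier D" "m \<in> carrier D"
  have "(\<lambda>h. l h \<oplus>\<^bsub>K\<^esub> m h) \<in> lin_maps K H S"
    using lm[THEN dual_lin] unfolding lin_maps_def by (auto simp: Pi_iff K.r_distr K.add.m_ac)
  from restrict_dual[OF this] show ?thesis by (simp add: dual_algebra_def)
qed

lemma dual_smult_closed: "c \<in> carrier K \<Longrightarrow> l \<in> carrier D \<Longrightarrow> c \<odot>\<^bsub>D\<^esub> l \<in> carrier D"
proof -
  assume lm: "c \<in> carrier K" "l \<in> carrier D"
  have "(\<lambda>h. c \<otimes> l h) \<in> lin_maps K H S"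
    using dual_lin[OF lm(2)] lm(1) unfolding lin_maps_def by (auto simp: Pi_iff K.r_distr K.m_ac)
  from restrict_dual[OF this] show ?thesis by (simp add: dual_algebra_def)
qed

lemma dual_zero_closed: "\<zero>\<^bsub>D\<^esub> \<in> carrier D"
proof -
  have "(\<lambda>h. \<zero>\<^bsub>K\<^esub>) \<in> lin_maps K H S" by (rule lin_mapsI) auto
  from restrict_dual[OF this] show ?thesis by (simp add: dual_algebra_def)
qed

lemma dual_module: "module K D"
proof (rule moduleI)
  show "abelian_group D"
  proof (rule abelian_groupI)
    fix l assume l: "l \<in> carrier D"
    have m: "(\<ominus>\<^bsub>K\<^esub> \<one>\<^bsub>K\<^esub>) \<odot>\<^bsub>D\<^esub> l \<in> carrier D" by (rule dual_smult_closed[OF _ l]) simp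
    moreover have "(\<ominus>\<^bsub>K\<^esub> \<one>\<^bsub>K\<^esub>) \<odot>\<^bsub>D\<^esub> l \<oplus>\<^bsub>D\<^esub> l = \<zero>\<^bsub>D\<^esub>"
      by (rule dual_eqI[OF dual_add_closed[OF m l] dual_zero_closed])
        (simp add: dual_simps dual_eval_closed[OF l] K.l_minus K.l_neg)
    ultimately show "\<exists>m\<in>carrier D. m \<oplus>\<^bsub>D\<^esub> l = \<zero>\<^bsub>D\<^esub>" by blast
  qed (auto intro!: dual_eqI dual_add_closed dual_zero_closed simp: dual_simps dual_eval_closed K.add.m_ac)
qed (auto intro!: dual_eqI dual_add_closed dual_zero_closed dual_smult_closed K.is_cring
    simp: dual_simps dual_eval_closed K.add.m_ac K.m_ac K.l_distr K.r_distr)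

lemma dual_eval_lin: "h \<in> carrier H \<Longrightarrow> (\<lambda>l. l h) \<in> lin_maps K D S"
  by (rule lin_mapsI) (auto simp: dual_simps dual_eval_closed)

text \<open>
  Linearity of a map into the dual can be tested pointwise.  This reduces bilinearity of the product and of the
  action to linearity of Sweedler sums with values in the field.
\<close>

lemma lin_into_dual:
  assumes "module K V" "\<And>v. v \<in> carrier V \<Longrightarrow> F v \<in> carrier D" "\<And>h. h \<in> carrier H \<Longrightarrow> (\<lambda>v. F v h) \<in> lin_maps K V S"
  shows "F \<in> lin_maps K V D"
proof -
  interpret V: module K V by fact
  show ?thesis
    by (intro lin_mapsI dual_eqI)
      (auto simp: assms(2) dual_add_closed dual_smult_closed dual_simps lin_maps_add[OF assms(3)] lin_maps_smult[OF assms(3)])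
qed

lemmas S_rules = module_S lin_left[OF S_mult_bilin] lin_right[OF S_mult_bilin] bilin_closed[OF S_mult_bilin]

lemma dual_mult_summand_bilin:
  assumes "l \<in> carrier D" "m \<in> carrier D"
  shows "bilin K H H S (\<lambda>h1 h2. l h2 \<otimes> m h1)"
  by (assumption | rule lin_rules S_rules dual_lin[OF assms(1)] dual_lin[OF assms(2)]
      lin_maps_closed[OF dual_lin[OF assms(1)]] lin_maps_closed[OF dual_lin[OF assms(2)]])+

lemma dual_mult_closed: "l \<in> carrier D \<Longrightarrow> m \<in> carrier D \<Longrightarrow> l \<otimes>\<^bsub>D\<^esub> m \<in> carrier D"
proof -
  assume lm: "l \<in> carrier D" "m \<in> carrier D"
  have "(\<lambda>h. tensor_lift K S (\<lambda>h1 h2. l h2 \<otimes> m h1) (comult H h)) \<in> lin_maps K H S"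
    by (rule lin_comp[OF tensor_lift_lin comult_linear]) (intro module_H module_S dual_mult_summand_bilin lm)+
  from restrict_dual[OF this] show ?thesis by (simp add: dual_algebra_def)
qed

lemma dual_mult_bilin: "bilin K D D D (monoid.mult D)"
proof (intro bilinI lin_into_dual dual_module dual_mult_closed)
  fix l m h assume m: "m \<in> carrier D" and h: "h \<in> carrier H"
  note dh = lin_maps_closed[OF comult_linear h]
  show "(\<lambda>l. (l \<otimes>\<^bsub>D\<^esub> m) h) \<in> lin_maps K D S"
    unfolding dual_simps[OF h]
    by (rule lin_lift_param[OF dh module_H module_H module_S dual_mult_summand_bilin[OF _ m] _ dual_module])
      (assumption | rule lin_left[OF S_mult_bilin] dual_eval_lin lin_maps_closed[OF dual_lin[OF m]])+
  show "(\<lambda>l. (m \<otimes>\<^bsub>D\<^esub> l) h) \<in> lin_maps K D S"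
    unfolding dual_simps[OF h]
    by (rule lin_lift_param[OF dh module_H module_H module_S dual_mult_summand_bilin[OF m] _ dual_module])
      (assumption | rule lin_right[OF S_mult_bilin] dual_eval_lin lin_maps_closed[OF dual_lin[OF m]])+
qed

lemma dual_one_closed: "\<one>\<^bsub>D\<^esub> \<in> carrier D"
  using restrict_dual[OF counit_linear] by (simp add: dual_algebra_def)

lemma dual_rules_aux: "l \<in> carrier D \<Longrightarrow> f \<in> lin_maps K V H \<Longrightarrow> (\<lambda>x. l (f x)) \<in> lin_maps K V S"
  "l \<in> carrier D \<Longrightarrow> h \<in> carrier H \<Longrightarrow> l h \<in> carrier S"
  using lin_comp[OF dual_lin] lin_maps_closed[OF dual_lin] by blast+

text \<open>
  The product is opposite to convolution, so the axioms are those of the coalgebra \<open>H\<close>: associativity comes from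
  coassociativity, and the left and right unit laws from the right and left counit laws.
\<close>

lemma dual_unital_algebra: "unital_algebra K D"
proof -
  interpret HH: coacting_algebra K H H "comult H" by (rule bialgebra_coacting_algebra) (rule bialgebra_axioms)
  note dh = lin_maps_closed[OF comult_linear]
  note congh = tensor_lift_cong[OF module_H module_H dh]
  have assoc: "(l \<otimes>\<^bsub>D\<^esub> m) \<otimes>\<^bsub>D\<^esub> n = l \<otimes>\<^bsub>D\<^esub> (m \<otimes>\<^bsub>D\<^esub> n)"
    if lmn: "l \<in> carrier D" "m \<in> carrier D" "n \<in> carrier D" for l m n
  proof (rule dual_eqI)
    fix h assume h: "h \<in> carrier H"
    note rl = lin_rules H_rules S_rules dual_rules_aux[OF lmn(1)] dual_rules_aux[OF lmn(2)] dual_rules_aux[OF lmn(3)]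
    have "((l \<otimes>\<^bsub>D\<^esub> m) \<otimes>\<^bsub>D\<^esub> n) h =
      tensor_lift K S (\<lambda>h1 h2. tensor_lift K S (\<lambda>h21 h22. l h22 \<otimes> m h21) (comult H h2) \<otimes> n h1) (comult H h)"
      unfolding dual_simps(5)[OF h] by (rule congh[OF h]) (simp add: dual_simps)
    also have "\<dots> = tensor_lift K S (\<lambda>h1 h2. tensor_lift K S (\<lambda>h21 h22. (l h22 \<otimes> m h21) \<otimes> n h1) (comult H h2)) (comult H h)"
      by (rule congh[OF h], rule lin_tensor_lift[OF module_H module_H module_S module_S, where h = "\<lambda>s. s \<otimes> n _"])
        (assumption | rule rl)+
    also have "\<dots> = tensor_lift K S (\<lambda>h1 h2. tensor_lift K S (\<lambda>h11 h12. (l h2 \<otimes> m h12) \<otimes> n h11) (comult H h1)) (comult H h)"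
      by (rule HH.coassoc_sweedler[OF module_S _ _ _ h, symmetric]) (assumption | rule rl)+
    also have "\<dots> = tensor_lift K S (\<lambda>h1 h2. tensor_lift K S (\<lambda>h11 h12. l h2 \<otimes> (m h12 \<otimes> n h11)) (comult H h1)) (comult H h)"
      by (intro congh h) (simp_all add: K.m_assoc dual_eval_closed lmn)
    also have "\<dots> = tensor_lift K S (\<lambda>h1 h2. l h2 \<otimes> tensor_lift K S (\<lambda>h11 h12. m h12 \<otimes> n h11) (comult H h1)) (comult H h)"
      by (rule congh[OF h], rule lin_tensor_lift[symmetric, OF module_H module_H module_S module_S, where h = "\<lambda>s. l _ \<otimes> s"])
        (assumption | rule rl)+
    also have "\<dots> = (l \<otimes>\<^bsub>D\<^esub> (m \<otimes>\<^bsub>D\<^esub> n)) h"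
      unfolding dual_simps(5)[OF h] by (rule congh[OF h]) (simp add: dual_simps)
    finally show "((l \<otimes>\<^bsub>D\<^esub> m) \<otimes>\<^bsub>D\<^esub> n) h = (l \<otimes>\<^bsub>D\<^esub> (m \<otimes>\<^bsub>D\<^esub> n)) h" .
  qed (intro dual_mult_closed lmn)+
  have b: "bilin K H H H (\<lambda>h1 h2. counit H h1 \<odot>\<^bsub>H\<^esub> h2)"
    using counit_smult_bilin by (auto simp: bilin_def)
  have one_l: "\<one>\<^bsub>D\<^esub> \<otimes>\<^bsub>D\<^esub> l = l" if l: "l \<in> carrier D" for l
  proof (rule dual_eqI[OF dual_mult_closed[OF dual_one_closed l] l])
    fix h assume h: "h \<in> carrier H"
    have "(\<one>\<^bsub>D\<^esub> \<otimes>\<^bsub>D\<^esub> l) h = tensor_lift K S (\<lambda>h1 h2. l (counit H h2 \<odot>\<^bsub>H\<^esub> h1)) (comult H h)"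
      unfolding dual_simps(5)[OF h]
      by (rule congh[OF h]) (use lin_maps_smult[OF dual_lin[OF l]] in \<open>simp add: dual_simps counit_closed\<close>)
    also have "\<dots> = l (tensor_lift K H (\<lambda>h1 h2. counit H h2 \<odot>\<^bsub>H\<^esub> h1) (comult H h))"
      by (rule lin_tensor_lift[symmetric, OF module_H module_H module_H module_S dual_lin[OF l] counit_smult_bilin dh[OF h]])
    finally show "(\<one>\<^bsub>D\<^esub> \<otimes>\<^bsub>D\<^esub> l) h = l h" by (simp add: counit_right[OF h])
  qed
  have one_r: "l \<otimes>\<^bsub>D\<^esub> \<one>\<^bsub>D\<^esub> = l" if l: "l \<in> carrier D" for l
  proof (rule dual_eqI[OF dual_mult_closed[OF l dual_one_closed] l])
    fix h assume h: "h \<in> carrier H"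
    have "(l \<otimes>\<^bsub>D\<^esub> \<one>\<^bsub>D\<^esub>) h = tensor_lift K S (\<lambda>h1 h2. l (counit H h1 \<odot>\<^bsub>H\<^esub> h2)) (comult H h)"
      unfolding dual_simps(5)[OF h]
      by (rule congh[OF h]) (use lin_maps_smult[OF dual_lin[OF l]] in
          \<open>simp add: dual_simps counit_closed K.m_comm dual_eval_closed[OF l]\<close>)
    also have "\<dots> = l (tensor_lift K H (\<lambda>h1 h2. counit H h1 \<odot>\<^bsub>H\<^esub> h2) (comult H h))"
      by (rule lin_tensor_lift[symmetric, OF module_H module_H module_H module_S dual_lin[OF l] b dh[OF h]])
    finally show "(l \<otimes>\<^bsub>D\<^esub> \<one>\<^bsub>D\<^esub>) h = l h" by (simp add: counit_left[OF h])
  qed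
  interpret DM: module K D by (rule dual_module)
  note mb = dual_mult_bilin
  have "ring D"
    by (rule ringI[OF DM.M.abelian_group_axioms])
      (auto intro!: monoidI dual_mult_closed dual_one_closed assoc one_l one_r
        simp: lin_maps_add[OF bilin_left[OF mb]] lin_maps_add[OF bilin_right[OF mb]])
  then show ?thesis
    by (intro unital_algebra.intro unital_algebra_axioms.intro K.field_axioms dual_module)
      (auto simp: lin_maps_smult[OF bilin_left[OF mb]] lin_maps_smult[OF bilin_right[OF mb]])
qed

lemma dual_act_closed:
  assumes "h \<in> carrier H" "l \<in> carrier D" shows "dual_act H h l \<in> carrier D"
proof -
  have "(\<lambda>x. l (x \<otimes>\<^bsub>H\<^esub> h)) \<in> lin_maps K H S"
    by (rule lin_comp[OF dual_lin[OF assms(2)] bilin_left[OF H_mult_bilin assms(1)]])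
  from restrict_dual[OF this] show ?thesis by (simp add: dual_act_def)
qed

lemma dual_act_apply: "x \<in> carrier H \<Longrightarrow> dual_act H h l x = l (x \<otimes>\<^bsub>H\<^esub> h)"
  by (simp add: dual_act_def)

lemma dual_act_bilin: "bilin K H D D (dual_act H)"
proof (intro bilinI lin_into_dual dual_module module_H dual_act_closed)
  fix l x assume l: "l \<in> carrier D" and x: "x \<in> carrier H"
  show "(\<lambda>h. dual_act H h l x) \<in> lin_maps K H S"
    unfolding dual_act_apply[OF x]
    by (rule lin_comp[OF dual_lin[OF l] bilin_right[OF H_mult_bilin x]])
next
  fix h x assume h: "h \<in> carrier H" and x: "x \<in> carrier H"
  show "(\<lambda>l. dual_act H h l x) \<in> lin_maps K D S"
    unfolding dual_act_apply[OF x]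
    by (rule dual_eval_lin) (rule bilin_closed[OF H_mult_bilin x h])
qed

text \<open>
  Evaluating at \<open>x\<close>, the action on a product is multiplicativity of the comultiplication:
  \<open>(lm)(xh) = l(x\<^sub>2h\<^sub>2) m(x\<^sub>1h\<^sub>1)\<close>.
\<close>

lemma dual_acted_algebra: "acted_algebra K H D (dual_act H)"
proof (intro acted_algebra.intro acted_algebra_axioms.intro bialgebra_axioms dual_unital_algebra dual_act_bilin)
  interpret HH: coacting_algebra K H H "comult H" by (rule bialgebra_coacting_algebra) (rule bialgebra_axioms)
  note [simp] = bilin_closed[OF H_mult_bilin] dual_act_closed unital_algebra_one_closed[OF unital_algebra_axioms]
  note dh = lin_maps_closed[OF comult_linear]
  note congh = tensor_lift_cong[OF module_H module_H dh]
  note massoc = monoid.m_assoc[OF ring.is_monoid[OF unital_algebra_ring[OF unital_algebra_axioms]]]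
  note mone = monoid.r_one[OF ring.is_monoid[OF unital_algebra_ring[OF unital_algebra_axioms]]]
  show "dual_act H (h \<otimes>\<^bsub>H\<^esub> g) l = dual_act H h (dual_act H g l)"
    if "h \<in> carrier H" "g \<in> carrier H" "l \<in> carrier D" for h g l
    by (rule dual_eqI) (use that in \<open>auto simp: dual_act_apply massoc\<close>)
  show "dual_act H \<one>\<^bsub>H\<^esub> l = l" if "l \<in> carrier D" for l
    by (rule dual_eqI) (use that in \<open>auto simp: dual_act_apply mone\<close>)
  show "dual_act H h \<one>\<^bsub>D\<^esub> = counit H h \<odot>\<^bsub>D\<^esub> \<one>\<^bsub>D\<^esub>" if "h \<in> carrier H" for h
    by (rule dual_eqI) (use that in \<open>auto intro!: dual_smult_closed dual_one_closed dual_act_closed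
      simp: dual_act_apply dual_simps counit_mult counit_closed K.m_comm\<close>)
  fix h l m assume h: "h \<in> carrier H" and l: "l \<in> carrier D" and m: "m \<in> carrier D"
  note rl = lin_rules H_rules S_rules dual_rules_aux[OF l] dual_rules_aux[OF m] h l m dual_module
    lin_left[OF dual_mult_bilin] lin_right[OF dual_mult_bilin] bilin_closed[OF dual_mult_bilin]
    lin_left[OF dual_act_bilin] lin_right[OF dual_act_bilin] bilin_closed[OF dual_act_bilin]
  have b: "bilin K H H D (\<lambda>h1 h2. dual_act H h2 l \<otimes>\<^bsub>D\<^esub> dual_act H h1 m)"
    by (assumption | rule rl)+
  show "dual_act H h (l \<otimes>\<^bsub>D\<^esub> m) =
    tensor_lift K D (\<lambda>h1 h2. dual_act H h2 l \<otimes>\<^bsub>D\<^esub> dual_act H h1 m) (comult H h)"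
  proof (rule dual_eqI)
    show "dual_act H h (l \<otimes>\<^bsub>D\<^esub> m) \<in> carrier D" by (intro dual_act_closed dual_mult_closed h l m)
    show "tensor_lift K D (\<lambda>h1 h2. dual_act H h2 l \<otimes>\<^bsub>D\<^esub> dual_act H h1 m) (comult H h) \<in> carrier D"
      by (rule tensor_lift_closed[OF dh[OF h] module_H module_H dual_module b])
    fix x assume x: "x \<in> carrier H"
    have "dual_act H h (l \<otimes>\<^bsub>D\<^esub> m) x = tensor_lift K S (\<lambda>y1 y2. l y2 \<otimes> m y1) (comult H (x \<otimes>\<^bsub>H\<^esub> h))"
      using x h by (simp add: dual_act_apply dual_simps)
    also have "\<dots> = tensor_lift K S (\<lambda>x1 x2. tensor_lift K S (\<lambda>h1 h2. l (x2 \<otimes>\<^bsub>H\<^esub> h2) \<otimes> m (x1 \<otimes>\<^bsub>H\<^esub> h1)) (comult H h)) (comult H x)"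
      by (rule HH.coact_mult_sweedler[OF module_S dual_mult_summand_bilin[OF l m] x h])
    also have "\<dots> = tensor_lift K S (\<lambda>h1 h2. tensor_lift K S (\<lambda>x1 x2. l (x2 \<otimes>\<^bsub>H\<^esub> h2) \<otimes> m (x1 \<otimes>\<^bsub>H\<^esub> h1)) (comult H x)) (comult H h)"
      by (rule tensor_lift_swap[OF module_H module_H module_H module_H module_S dh[OF x] dh[OF h]]) (assumption | rule rl)+
    also have "\<dots> = tensor_lift K S (\<lambda>h1 h2. (dual_act H h2 l \<otimes>\<^bsub>D\<^esub> dual_act H h1 m) x) (comult H h)"
      unfolding dual_simps(5)[OF x] by (intro congh h x) (simp_all add: dual_act_apply)
    also have "\<dots> = tensor_lift K D (\<lambda>h1 h2. dual_act H h2 l \<otimes>\<^bsub>D\<^esub> dual_act H h1 m) (comult H h) x"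
      by (rule lin_tensor_lift[symmetric, OF module_H module_H dual_module module_S dual_eval_lin[OF x] b dh[OF h]])
    finally show "dual_act H h (l \<otimes>\<^bsub>D\<^esub> m) x =
      tensor_lift K D (\<lambda>h1 h2. dual_act H h2 l \<otimes>\<^bsub>D\<^esub> dual_act H h1 m) (comult H h) x" .
  qed
qed

lemma dual_pair_bilin:
  assumes "h \<in> carrier H" "h' \<in> carrier H"
  shows "bilin K D D S (\<lambda>l1 l2. l1 h' \<otimes> l2 h)"
  by (rule bilinI, rule lin_left[OF S_mult_bilin dual_eval_lin[OF assms(2)]], simp add: dual_eval_closed assms(1),
      rule lin_right[OF S_mult_bilin dual_eval_lin[OF assms(1)]], simp add: dual_eval_closed assms(2))

lemma dual_contract_bilin:
  assumes "h \<in> carrier H"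
  shows "bilin K D D D (\<lambda>l1 l2. l1 h \<odot>\<^bsub>D\<^esub> l2)"
proof -
  interpret DM: module K D by (rule dual_module)
  show ?thesis
    by (intro bilinI lin_mapsI)
      (auto simp: assms dual_simps dual_eval_closed DM.smult_l_distr DM.smult_r_distr DM.smult_assoc1[symmetric] K.m_comm)
qed

text \<open>
  The hypothesis is the equation that determines the comultiplication of \<open>l\<close>.  Evaluated at \<open>x\<close>, the contraction of
  the first factor of \<open>t\<close> with \<open>h\<close> is its right-hand side, that is \<open>l(xh)\<close>.
\<close>

lemma dual_contract_eq:
  assumes t: "t \<in> carrier (tensor K D D)" and l: "l \<in> carrier D" and h: "h \<in> carrier H"
    and p: "\<And>x. x \<in> carrier H \<Longrightarrow> l (x \<otimes>\<^bsub>H\<^esub> h) = tensor_lift K S (\<lambda>l1 l2. l1 h \<otimes> l2 x) t"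
  shows "tensor_lift K D (\<lambda>l1 l2. l1 h \<odot>\<^bsub>D\<^esub> l2) t = dual_act H h l"
proof (rule dual_eqI)
  note b = dual_contract_bilin[OF h]
  show "tensor_lift K D (\<lambda>l1 l2. l1 h \<odot>\<^bsub>D\<^esub> l2) t \<in> carrier D"
    by (rule tensor_lift_closed[OF t dual_module dual_module dual_module b])
  fix x assume x: "x \<in> carrier H"
  have "tensor_lift K D (\<lambda>l1 l2. l1 h \<odot>\<^bsub>D\<^esub> l2) t x = tensor_lift K S (\<lambda>l1 l2. (l1 h \<odot>\<^bsub>D\<^esub> l2) x) t"
    by (rule lin_tensor_lift[OF dual_module dual_module dual_module module_S dual_eval_lin[OF x] b t])
  then show "tensor_lift K D (\<lambda>l1 l2. l1 h \<odot>\<^bsub>D\<^esub> l2) t x = dual_act H h l x"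
    using p[OF x] x by (simp add: dual_simps dual_act_apply)
qed (rule dual_act_closed[OF h l])

text \<open>
  With a basis \<open>b\<close> of \<open>H\<close> and its dual basis \<open>e\<^sub>b\<close>, every tensor satisfies
  \<open>t = \<Sum>\<^sub>b e\<^sub>b \<otimes> t\<^sub>b\<close>, where \<open>t\<^sub>b\<close> is the contraction of the first factor of \<open>t\<close> with \<open>b\<close>.  By
  \<open>dual_contract_eq\<close> the only candidate is therefore \<open>\<Sum>\<^sub>b e\<^sub>b \<otimes> bl\<close>, and it does satisfy the equation because
  \<open>\<Sum>\<^sub>b e\<^sub>b(h') l(hb) = l(hh')\<close>.
\<close>

lemma dual_comult_ex1:
  assumes fd: "finite_dimensional K H" and l: "l \<in> carrier D"
  shows "\<exists>!t. t \<in> carrier (tensor K D D) \<and> (\<forall>h\<in>carrier H. \<forall>h'\<in>carrier H.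
    l (h \<otimes>\<^bsub>H\<^esub> h') = tensor_lift K S (\<lambda>l1 l2. l1 h' \<otimes> l2 h) t)"
proof -
  obtain B \<phi> where B: "finite B" "B \<subseteq> carrier H"
    and phi: "\<And>b. b \<in> B \<Longrightarrow> \<phi> b \<in> lin_maps K H S"
    and exp: "\<And>h. h \<in> carrier H \<Longrightarrow> h = (\<Oplus>\<^bsub>H\<^esub>b\<in>B. \<phi> b h \<odot>\<^bsub>H\<^esub> b)"
    by (rule dual_basis_exists[OF K.field_axioms module_H fd]) blast
  interpret DM: module K D by (rule dual_module)
  let ?T = "tensor K D D"
  have mT: "module K ?T" using dual_module by simp
  interpret TM: module K ?T by (rule mT)
  interpret SM: module K S by (rule module_S)
  have Bc: "b \<in> carrier H" if "b \<in> B" for b using B that by blast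
  define e where "e b = restrict (\<phi> b) (carrier H)" for b
  have e: "e b \<in> carrier D" if "b \<in> B" for b unfolding e_def by (rule restrict_dual[OF phi[OF that]])
  have ec: "e b h \<in> carrier K" if "b \<in> B" "h \<in> carrier H" for b h by (rule dual_eval_closed[OF e[OF that(1)] that(2)])
  have exp': "h = (\<Oplus>\<^bsub>H\<^esub>b\<in>B. e b h \<odot>\<^bsub>H\<^esub> b)" if "h \<in> carrier H" for h
    using exp[OF that] that by (simp add: e_def)
  have mexp: "m h = (\<Oplus>b\<in>B. e b h \<otimes> m b)" if m: "m \<in> lin_maps K H S" and h: "h \<in> carrier H" for m h
  proof -
    have "m h = m (\<Oplus>\<^bsub>H\<^esub>b\<in>B. e b h \<odot>\<^bsub>H\<^esub> b)" using exp'[OF h] by simp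
    also have "\<dots> = (\<Oplus>\<^bsub>S\<^esub>b\<in>B. m (e b h \<odot>\<^bsub>H\<^esub> b))"
      by (rule lin_finsum[OF module_H module_S m]) (use ec h Bc in auto)
    also have "\<dots> = (\<Oplus>\<^bsub>S\<^esub>b\<in>B. e b h \<otimes> m b)"
      by (rule SM.M.finsum_cong') (use ec h Bc lin_maps_closed[OF m] lin_maps_smult[OF m] in auto)
    finally show ?thesis by simp
  qed
  have dexp: "m = (\<Oplus>\<^bsub>D\<^esub>b\<in>B. m b \<odot>\<^bsub>D\<^esub> e b)" if m: "m \<in> carrier D" for m
  proof (rule dual_eqI[OF m])
    have c: "(\<lambda>b. m b \<odot>\<^bsub>D\<^esub> e b) \<in> B \<rightarrow> carrier D" using dual_eval_closed[OF m] e Bc by auto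
    show "(\<Oplus>\<^bsub>D\<^esub>b\<in>B. m b \<odot>\<^bsub>D\<^esub> e b) \<in> carrier D" by (rule DM.finsum_closed[OF c])
    fix h assume h: "h \<in> carrier H"
    have "(\<Oplus>\<^bsub>D\<^esub>b\<in>B. m b \<odot>\<^bsub>D\<^esub> e b) h = (\<Oplus>\<^bsub>S\<^esub>b\<in>B. (m b \<odot>\<^bsub>D\<^esub> e b) h)"
      by (rule lin_finsum[OF dual_module module_S dual_eval_lin[OF h] c])
    also have "\<dots> = (\<Oplus>\<^bsub>S\<^esub>b\<in>B. e b h \<otimes> m b)"
      by (rule SM.M.finsum_cong') (use h ec dual_eval_closed[OF m] Bc in \<open>auto simp: dual_simps K.m_comm\<close>)
    also have "\<dots> = m h" using mexp[OF dual_lin[OF m] h] by simp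
    finally show "m h = (\<Oplus>\<^bsub>D\<^esub>b\<in>B. m b \<odot>\<^bsub>D\<^esub> e b) h" by simp
  qed
  note pb = pure_tensor_bilin[OF dual_module dual_module]
  let ?C = "\<lambda>b. tensor_lift K D (\<lambda>l1 l2. l1 b \<odot>\<^bsub>D\<^esub> l2)"
  note Cb = dual_contract_bilin
  have Cl: "?C b \<in> lin_maps K ?T D" if "b \<in> B" for b
    by (rule tensor_lift_lin[OF dual_module dual_module dual_module Cb[OF Bc[OF that]]])
  have texp: "t = (\<Oplus>\<^bsub>?T\<^esub>b\<in>B. pure_tensor K D D (e b) (?C b t))" if t: "t \<in> carrier ?T" for t
  proof (rule tensor_lin_eq[OF dual_module dual_module mT lin_id _ _ t])
    show "(\<lambda>t. \<Oplus>\<^bsub>?T\<^esub>b\<in>B. pure_tensor K D D (e b) (?C b t)) \<in> lin_maps K ?T ?T"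
      by (rule lin_finsum_param[OF mT mT lin_right[OF pb Cl e]])
    fix l m assume lm: "l \<in> carrier D" "m \<in> carrier D"
    have "pure_tensor K D D l m = pure_tensor K D D (\<Oplus>\<^bsub>D\<^esub>b\<in>B. l b \<odot>\<^bsub>D\<^esub> e b) m" using dexp[OF lm(1)] by simp
    also have "\<dots> = (\<Oplus>\<^bsub>?T\<^esub>b\<in>B. pure_tensor K D D (l b \<odot>\<^bsub>D\<^esub> e b) m)"
      by (rule lin_finsum[OF dual_module mT bilin_left[OF pb lm(2)]]) (use lm e Bc dual_eval_closed in auto)
    also have "\<dots> = (\<Oplus>\<^bsub>?T\<^esub>b\<in>B. pure_tensor K D D (e b) (?C b (pure_tensor K D D l m)))"
    proof (rule TM.M.finsum_cong')
      have "pure_tensor K D D (l b \<odot>\<^bsub>D\<^esub> e b) m = pure_tensor K D D (e b) (l b \<odot>\<^bsub>D\<^esub> m)" if "b \<in> B" for b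
        using lm e[OF that] Bc[OF that] dual_eval_closed[OF lm(1)]
        by (simp add: lin_maps_smult[OF bilin_left[OF pb]] lin_maps_smult[OF bilin_right[OF pb]])
      then show "pure_tensor K D D (l b \<odot>\<^bsub>D\<^esub> e b) m = pure_tensor K D D (e b) (?C b (pure_tensor K D D l m))"
        if "b \<in> B" for b
        using lm that by (simp add: tensor_lift_pure[OF dual_module dual_module dual_module Cb[OF Bc[OF that]]])
    qed (use lm e lin_maps_closed[OF Cl] dual_module in auto)
    finally show "pure_tensor K D D l m = (\<Oplus>\<^bsub>?T\<^esub>b\<in>B. pure_tensor K D D (e b) (?C b (pure_tensor K D D l m)))" .
  qed
  let ?t = "\<Oplus>\<^bsub>?T\<^esub>b\<in>B. pure_tensor K D D (e b) (dual_act H b l)"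
  have tc: "(\<lambda>b. pure_tensor K D D (e b) (dual_act H b l)) \<in> B \<rightarrow> carrier ?T"
    using e dual_act_closed[OF Bc l] dual_module by auto
  show ?thesis
  proof (rule ex1I[of _ ?t]; (intro conjI ballI)?)
    show "?t \<in> carrier ?T" by (rule TM.M.finsum_closed[OF tc])
    fix h h' assume h: "h \<in> carrier H" "h' \<in> carrier H"
    note pl = tensor_lift_lin[OF dual_module dual_module module_S dual_pair_bilin[OF h]]
    have "tensor_lift K S (\<lambda>l1 l2. l1 h' \<otimes> l2 h) ?t =
      (\<Oplus>\<^bsub>S\<^esub>b\<in>B. tensor_lift K S (\<lambda>l1 l2. l1 h' \<otimes> l2 h) (pure_tensor K D D (e b) (dual_act H b l)))"
      by (rule lin_finsum[OF mT module_S pl tc])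
    also have "\<dots> = (\<Oplus>\<^bsub>S\<^esub>b\<in>B. e b h' \<otimes> l (h \<otimes>\<^bsub>H\<^esub> b))"
      by (rule SM.M.finsum_cong')
        (use e dual_act_closed[OF Bc l] h ec Bc dual_eval_closed[OF l] bilin_closed[OF H_mult_bilin] in
          \<open>auto simp: tensor_lift_pure[OF dual_module dual_module module_S dual_pair_bilin[OF h]] dual_act_apply\<close>)
    also have "\<dots> = l (h \<otimes>\<^bsub>H\<^esub> h')"
      using mexp[OF lin_comp[OF dual_lin[OF l] bilin_right[OF H_mult_bilin h(1)]] h(2)] by simp
    finally show "l (h \<otimes>\<^bsub>H\<^esub> h') = tensor_lift K S (\<lambda>l1 l2. l1 h' \<otimes> l2 h) ?t" by simp
  next
    fix t assume t: "t \<in> carrier ?T \<and> (\<forall>h\<in>carrier H. \<forall>h'\<in>carrier H.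
      l (h \<otimes>\<^bsub>H\<^esub> h') = tensor_lift K S (\<lambda>l1 l2. l1 h' \<otimes> l2 h) t)"
    have "?C b t = dual_act H b l" if "b \<in> B" for b
      by (rule dual_contract_eq[OF _ l Bc[OF that]]) (use t Bc[OF that] in auto)
    then have "(\<Oplus>\<^bsub>?T\<^esub>b\<in>B. pure_tensor K D D (e b) (?C b t)) = ?t"
      by (intro TM.M.finsum_cong') (use tc in auto)
    with texp[OF conjunct1[OF t]] show "t = ?t" by (rule trans)
  qed
qed

lemma dual_comult_spec:
  assumes "finite_dimensional K H" and "l \<in> carrier D"
  shows "dual_comult K H l \<in> carrier (tensor K D D)"
    and "h \<in> carrier H \<Longrightarrow> h' \<in> carrier H \<Longrightarrow>
      l (h \<otimes>\<^bsub>H\<^esub> h') = tensor_lift K S (\<lambda>l1 l2. l1 h' \<otimes> l2 h) (dual_comult K H l)"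
  using theI'[OF dual_comult_ex1[OF assms]] unfolding dual_comult_def by auto

lemma dual_comult_contract:
  assumes fd: "finite_dimensional K H" and l: "l \<in> carrier D" and h: "h \<in> carrier H"
    and U: "module K U" and F: "F \<in> lin_maps K D U"
  shows "tensor_lift K U (\<lambda>l1 l2. F (l1 h \<odot>\<^bsub>D\<^esub> l2)) (dual_comult K H l) = F (dual_act H h l)"
proof -
  note s = dual_comult_spec[OF fd l]
  have "tensor_lift K U (\<lambda>l1 l2. F (l1 h \<odot>\<^bsub>D\<^esub> l2)) (dual_comult K H l) =
      F (tensor_lift K D (\<lambda>l1 l2. l1 h \<odot>\<^bsub>D\<^esub> l2) (dual_comult K H l))"
    by (rule lin_tensor_lift[symmetric, OF dual_module dual_module dual_module U F dual_contract_bilin[OF h] s(1)])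
  also have "tensor_lift K D (\<lambda>l1 l2. l1 h \<odot>\<^bsub>D\<^esub> l2) (dual_comult K H l) = dual_act H h l"
    by (rule dual_contract_eq[OF s(1) l h]) (rule s(2)[OF _ h])
  finally show ?thesis .
qed

end

section \<open>The braided system\<close>

lemma cross_braid_image:
  assumes i: "inj_on i (carrier X)" and j: "inj_on j (carrier Y)"
    and X: "coacting_algebra K H X \<delta>" and Y: "acted_algebra K H Y \<alpha>"
    and x: "x \<in> carrier X" and y: "y \<in> carrier Y"
  shows "cross_braid K (image_module i X) (image_coact K H i X \<delta>) (image_module j Y) (image_act j Y \<alpha>)
      (pure_tensor K (image_module i X) (image_module j Y) (i x) (j y)) =
    tensor_lift K (tensor K (image_module j Y) (image_module i X))
      (\<lambda>x0 x1. pure_tensor K (image_module j Y) (image_module i X) (j (\<alpha> x1 y)) (i x0)) (\<delta> x)"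
proof -
  interpret X: coacting_algebra K H X \<delta> by (rule X)
  interpret Y: acted_algebra K H Y \<alpha> by (rule Y)
  let ?X = "image_module i X" and ?Y = "image_module j Y"
  note mX = image_module_module[OF i X.module_X] and mY = image_module_module[OF j Y.module_Y]
  note dl = image_coact_lin[OF i X.module_X X.H.module_H X.coact_lin]
  note ab = image_act_bilin[OF j Y.module_Y X.H.module_H Y.act_bilin]
  have ix: "i x \<in> carrier ?X" and jy: "j y \<in> carrier ?Y" using x y by (simp_all add: image_module_carrier)
  have "cross_braid K ?X (image_coact K H i X \<delta>) ?Y (image_act j Y \<alpha>) (pure_tensor K ?X ?Y (i x) (j y)) =
    tensor_lift K (tensor K ?Y ?X) (\<lambda>x0 x1. pure_tensor K ?Y ?X (image_act j Y \<alpha> x1 (j y)) x0) (image_coact K H i X \<delta> (i x))"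
    by (rule cross_braid_pure[OF mX X.H.module_H mY dl ab ix jy])
  also have "\<dots> = tensor_lift K (tensor K ?Y ?X) (\<lambda>x0 x1. pure_tensor K ?Y ?X (image_act j Y \<alpha> x1 (j y)) (i x0)) (\<delta> x)"
    by (rule lift_image_coact[OF i X.module_X X.H.module_H tensor_module[OF mY mX] X.coact_lin
          cross_bilin(1)[OF mX X.H.module_H mY dl ab jy] x])
  finally show ?thesis by (simp add: image_act_image[OF j y])
qed

text \<open>
  Rewrites translates of \<open>l\<close> inside a Sweedler sum as \<open>l\<^sub>1(h) l\<^sub>2\<close>, the form in which the braidings with the
  dual are specified.
\<close>

lemma dual_comult_sweedler:
  assumes H: "bialgebra K H" and fd: "finite_dimensional K H" and l: "l \<in> carrier (dual_algebra K H)"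
    and m: "module K X" "module K W" and t: "t \<in> carrier (tensor K X H)"
    and j: "j \<in> lin_maps K (dual_algebra K H) Y" and mY: "module K Y"
    and i: "\<And>x. x \<in> carrier X \<Longrightarrow> i x \<in> carrier W"
  shows "tensor_lift K (tensor K Y W) (\<lambda>x h. pure_tensor K Y W (j (dual_act H h l)) (i x)) t =
    tensor_lift K (tensor K Y W) (\<lambda>x h. tensor_lift K (tensor K Y W) (\<lambda>l1 l2.
      pure_tensor K Y W (j (l1 h \<odot>\<^bsub>dual_algebra K H\<^esub> l2)) (i x)) (dual_comult K H l)) t"
proof -
  interpret H: bialgebra K H by (rule H)
  show ?thesis
  proof (rule tensor_lift_cong[OF m(1) H.module_H t])
    fix x h assume x: "x \<in> carrier X" and h: "h \<in> carrier H"
    have F: "(\<lambda>l. pure_tensor K Y W (j l) (i x)) \<in> lin_maps K (dual_algebra K H) (tensor K Y W)"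
      by (rule lin_left[OF pure_tensor_bilin[OF mY m(2)] j i[OF x]])
    show "pure_tensor K Y W (j (dual_act H h l)) (i x) = tensor_lift K (tensor K Y W) (\<lambda>l1 l2.
      pure_tensor K Y W (j (l1 h \<odot>\<^bsub>dual_algebra K H\<^esub> l2)) (i x)) (dual_comult K H l)"
      by (rule H.dual_comult_contract[OF fd l h tensor_module[OF mY m(2)] F, symmetric])
  qed
qed

theorem corollary3p9:
  fixes K :: "('k, 'c) ring_scheme"
    and H :: "('k, 'h, 'x) bialgebra_scheme"
    and M :: "nat \<Rightarrow> ('k, 'h, 'm, 'y) yd_module_algebra_scheme"
    and r :: nat
  assumes "field K"
    and "bialgebra K H"
    and "finite_dimensional K H"
    and "\<And>i. 1 \<le> i \<Longrightarrow> i \<le> r \<Longrightarrow> yd_module_algebra K H (M i)"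
  shows
    "let D = dual_algebra K H;
         V = yd_system K H r M;
         T = (\<lambda>i j. tensor K (V i) (V j));
         t = (\<lambda>i j. pure_tensor K (V i) (V j))
     in \<exists>\<sigma>. braided_system K (r + 2) V \<sigma> \<and>
       (\<forall>h1\<in>carrier H. \<forall>h2\<in>carrier H.
          \<sigma> 0 0 (t 0 0 (InH h1) (InH h2)) = t 0 0 (InH (h1 \<otimes>\<^bsub>H\<^esub> h2)) (InH \<one>\<^bsub>H\<^esub>)) \<and>
       (\<forall>l1\<in>carrier D. \<forall>l2\<in>carrier D.
          \<sigma> (r + 1) (r + 1) (t (r + 1) (r + 1) (InDual l1) (InDual l2)) =
          t (r + 1) (r + 1) (InDual \<one>\<^bsub>D\<^esub>) (InDual (l1 \<otimes>\<^bsub>D\<^esub> l2))) \<and>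
       (\<forall>h\<in>carrier H. \<forall>l\<in>carrier D.
          \<sigma> 0 (r + 1) (t 0 (r + 1) (InH h) (InDual l)) =
          tensor_lift K (T (r + 1) 0) (\<lambda>h1 h2.
            tensor_lift K (T (r + 1) 0) (\<lambda>l1 l2.
              t (r + 1) 0 (InDual (l1 h2 \<odot>\<^bsub>D\<^esub> l2)) (InH h1)) (dual_comult K H l)) (comult H h)) \<and>
       (\<forall>i\<in>{1..r}. \<forall>m1\<in>carrier (M i). \<forall>m2\<in>carrier (M i).
          \<sigma> i i (t i i (InM m1) (InM m2)) =
          t i i (InM \<one>\<^bsub>M i\<^esub>) (InM (m1 \<otimes>\<^bsub>M i\<^esub> m2))) \<and>
       (\<forall>i\<in>{1..r}. \<forall>j\<in>{1..r}. i < j \<longrightarrow> (\<forall>m\<in>carrier (M i). \<forall>n\<in>carrier (M j).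
          \<sigma> i j (t i j (InM m) (InM n)) =
          tensor_lift K (T j i) (\<lambda>m0 m1.
            t j i (InM (act (M j) m1 n)) (InM m0)) (coact (M i) m))) \<and>
       (\<forall>i\<in>{1..r}. \<forall>h\<in>carrier H. \<forall>m\<in>carrier (M i).
          \<sigma> 0 i (t 0 i (InH h) (InM m)) =
          tensor_lift K (T i 0) (\<lambda>h1 h2.
            t i 0 (InM (act (M i) h2 m)) (InH h1)) (comult H h)) \<and>
       (\<forall>i\<in>{1..r}. \<forall>m\<in>carrier (M i). \<forall>l\<in>carrier D.
          \<sigma> i (r + 1) (t i (r + 1) (InM m) (InDual l)) =
          tensor_lift K (T (r + 1) i) (\<lambda>m0 m1.
            tensor_lift K (T (r + 1) i) (\<lambda>l1 l2.
              t (r + 1) i (InDual (l1 m1 \<odot>\<^bsub>D\<^esub> l2)) (InM m0)) (dual_comult K H l)) (coact (M i) m))"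
proof -
  interpret H: bialgebra K H by (rule assms(2))
  (* the family C is meaningful at positions 0 to r, the family A at positions 1 to r + 1 *)
  define V where "V = yd_system K H r M"
  let ?D = "dual_algebra K H"
  define C :: "nat \<Rightarrow> ('k, 'h, 'm) member \<Rightarrow> ('k, ('k, 'h, 'm) member, 'h) tensor" where "C i = (if i = 0 then image_coact K H InH H (comult H)
    else image_coact K H InM (M i) (coact (M i)))" for i
  define A :: "nat \<Rightarrow> 'h \<Rightarrow> ('k, 'h, 'm) member \<Rightarrow> ('k, 'h, 'm) member" where "A j = (if j \<le> r then image_act InM (M j) (act (M j)) else image_act InDual ?D (dual_act H))" for j
  define \<sigma> where "\<sigma> i j = (if i \<noteq> j then cross_braid K (V i) (C i) (V j) (A j)
    else if i = 0 then mult_unit_braid K (V i) else unit_mult_braid K (V i))" for i j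
  have inj: "inj_on InH S" "inj_on InM S'" "inj_on InDual S''"
    for S :: "'h set" and S' :: "'m set" and S'' :: "('h \<Rightarrow> 'k) set" by (auto simp: inj_on_def)
  have V0: "V 0 = image_module InH H" and Vi: "\<And>i. 1 \<le> i \<Longrightarrow> i \<le> r \<Longrightarrow> V i = image_module InM (M i)"
    and Vr: "V (r + 1) = image_module InDual ?D"
    by (auto simp: V_def yd_system_def)
  note HC = bialgebra_coacting_algebra[OF assms(2)] and DA = H.dual_acted_algebra
  have MY: "yd_algebra K H (M i) (coact (M i)) (act (M i))" if "1 \<le> i" "i \<le> r" for i
    by (rule yd_module_algebra_yd_algebra[OF assms(4)[OF that]])
  note MC = yd_algebra.axioms(1)[OF MY] and MA = yd_algebra.axioms(2)[OF MY]
  have yd: "yd_algebra K H (V i) (C i) (A i)" if "1 \<le> i" "i \<le> r" for i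
    using image_yd_algebra[OF inj(2) MY[OF that]] that by (simp add: Vi C_def A_def)
  have co: "coacting_algebra K H (V i) (C i)" if "i \<le> r" for i
    using image_coacting_algebra[OF inj(1) HC] yd_algebra.axioms(1)[OF yd[of i]] that
    by (cases "i = 0") (simp_all add: V0 C_def)
  have ac: "acted_algebra K H (V j) (A j)" if "1 \<le> j" "j \<le> r + 1" for j
    using image_acted_algebra[OF inj(3) DA] yd_algebra.axioms(2)[OF yd[of j]] that Vr
    by (cases "j = r + 1") (simp_all add: A_def)
  have un: "unital_algebra K (V i)" if "i \<le> r + 1" for i
    using co[of i] ac[of i] that by (cases "i \<le> r") (simp_all add: coacting_algebra_def acted_algebra_def)
  have mo: "module K (V i)" if "i \<le> r + 1" for i
    by (rule unital_algebra_module[OF un[OF that]])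
  have lin: "\<sigma> i j \<in> lin_maps K (tensor K (V i) (V j)) (tensor K (V j) (V i))" if "i \<le> j" "j \<le> r + 1" for i j
  proof (cases "i = j")
    case True
    then show ?thesis using that un[of i]
      by (auto simp: \<sigma>_def intro: unit_mult_braid_lin mult_unit_braid_lin)
  next
    case False
    then have "i \<le> r" "1 \<le> j" using that by auto
    then show ?thesis using False that cross_braid_lin[OF mo H.module_H mo
          coacting_algebra.coact_lin[OF co] acted_algebra.act_bilin[OF ac]] by (simp add: \<sigma>_def)
  qed
  have ybe: "ybe K (V i) (V j) (V k) (\<sigma> i j) (\<sigma> i k) (\<sigma> j k)" if ijk: "i \<le> j" "j \<le> k" "k \<le> r + 1" for i j k
  proof -
    consider "i = j" "j = k" | "i = j" "j < k" | "i < j" "j = k" | "i < j" "j < k" using ijk by linarith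
    then show ?thesis
    proof cases
      case 1
      then show ?thesis using un[of i] ijk by (auto simp: \<sigma>_def intro: ybe_unit_mult ybe_mult_unit)
    next
      case 2
      then have "\<sigma> i i \<in> {unit_mult_braid K (V i), mult_unit_braid K (V i)}" by (simp add: \<sigma>_def)
      from coacting_algebra.ybe_cross_left[OF co ac this, of k] show ?thesis
        using 2 ijk by (simp add: \<sigma>_def)
    next
      case 3
      then show ?thesis
        using coacting_algebra.ybe_cross_right[OF co[of i] ac[of k]] ijk by (simp add: \<sigma>_def)
    next
      case 4
      then show ?thesis
        using coacting_algebra.ybe_cross_cross[OF co[of i] yd[of j] ac[of k]] ijk by (simp add: \<sigma>_def)
    qed
  qed
  let ?T = "\<lambda>i j. tensor K (V i) (V j)" and ?t = "\<lambda>i j. pure_tensor K (V i) (V j)"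
  have bs: "braided_system K (r + 2) V \<sigma>"
    unfolding braided_system_def using mo lin ybe[unfolded ybe_def] by auto
  have braid_H_H: "\<sigma> 0 0 (?t 0 0 (InH h1) (InH h2)) =
      ?t 0 0 (InH (h1 \<otimes>\<^bsub>H\<^esub> h2)) (InH \<one>\<^bsub>H\<^esub>)"
    if "h1 \<in> carrier H" "h2 \<in> carrier H" for h1 h2
    using that mult_unit_braid_pure[OF un[of 0]]
    by (simp add: \<sigma>_def V0 image_module_carrier image_module_simps[OF inj(1)])
  have braid_D_D: "\<sigma> (r + 1) (r + 1) (?t (r + 1) (r + 1) (InDual l1) (InDual l2)) =
      ?t (r + 1) (r + 1) (InDual \<one>\<^bsub>?D\<^esub>) (InDual (l1 \<otimes>\<^bsub>?D\<^esub> l2))"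
    if "l1 \<in> carrier ?D" "l2 \<in> carrier ?D" for l1 l2
    using that unit_mult_braid_pure[OF un[of "r + 1"]] Vr
    by (simp add: \<sigma>_def image_module_carrier image_module_simps[OF inj(3)])
  have braid_M_same: "\<sigma> i i (?t i i (InM m1) (InM m2)) =
      ?t i i (InM \<one>\<^bsub>M i\<^esub>) (InM (m1 \<otimes>\<^bsub>M i\<^esub> m2))"
    if "i \<in> {1..r}" "m1 \<in> carrier (M i)" "m2 \<in> carrier (M i)" for i m1 m2
    using that unit_mult_braid_pure[OF un[of i]]
    by (simp add: \<sigma>_def Vi image_module_carrier image_module_simps[OF inj(2)])
  have braid_M_M: "\<sigma> i j (?t i j (InM m) (InM n)) =
      tensor_lift K (?T j i) (\<lambda>m0 m1. ?t j i (InM (act (M j) m1 n)) (InM m0)) (coact (M i) m)"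
    if "i \<in> {1..r}" "j \<in> {1..r}" "i < j" "m \<in> carrier (M i)" "n \<in> carrier (M j)" for i j m n
    using that cross_braid_image[OF inj(2) inj(2) MC[of i] MA[of j]]
    by (simp add: \<sigma>_def Vi C_def A_def)
  have braid_H_M: "\<sigma> 0 i (?t 0 i (InH h) (InM m)) =
      tensor_lift K (?T i 0) (\<lambda>h1 h2. ?t i 0 (InM (act (M i) h2 m)) (InH h1)) (comult H h)"
    if "i \<in> {1..r}" "h \<in> carrier H" "m \<in> carrier (M i)" for i h m
    using that cross_braid_image[OF inj(1) inj(2) HC MA[of i]]
    by (simp add: \<sigma>_def V0 Vi C_def A_def)
  have braid_H_D: "\<sigma> 0 (r + 1) (?t 0 (r + 1) (InH h) (InDual l)) =
      tensor_lift K (?T (r + 1) 0) (\<lambda>h1 h2. tensor_lift K (?T (r + 1) 0) (\<lambda>l1 l2.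
        ?t (r + 1) 0 (InDual (l1 h2 \<odot>\<^bsub>?D\<^esub> l2)) (InH h1)) (dual_comult K H l)) (comult H h)" (is "_ = ?rhs")
    if "h \<in> carrier H" "l \<in> carrier ?D" for h l
  proof -
    have "\<sigma> 0 (r + 1) (?t 0 (r + 1) (InH h) (InDual l)) =
      tensor_lift K (?T (r + 1) 0) (\<lambda>h1 h2.
        ?t (r + 1) 0 (InDual (dual_act H h2 l)) (InH h1)) (comult H h)"
      using cross_braid_image[OF inj(1) inj(3) HC DA that] Vr by (simp add: \<sigma>_def V0 C_def A_def)
    also have "\<dots> = ?rhs"
      by (rule dual_comult_sweedler[OF assms(2,3) that(2) H.module_H mo lin_maps_closed[OF H.comult_linear that(1)] _ mo])
        (simp_all only: Vr V0 image_module_lin[OF inj(3)] image_module_carrier imageI le0 order_refl)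
    finally show ?thesis .
  qed
  have braid_M_D: "\<sigma> i (r + 1) (?t i (r + 1) (InM m) (InDual l)) =
      tensor_lift K (?T (r + 1) i) (\<lambda>m0 m1. tensor_lift K (?T (r + 1) i) (\<lambda>l1 l2.
        ?t (r + 1) i (InDual (l1 m1 \<odot>\<^bsub>?D\<^esub> l2)) (InM m0)) (dual_comult K H l)) (coact (M i) m)" (is "_ = ?rhs")
    if i: "i \<in> {1..r}" and m: "m \<in> carrier (M i)" and l: "l \<in> carrier ?D" for i m l
  proof -
    have i': "1 \<le> i" "i \<le> r" "i \<le> r + 1" "r + 1 \<le> r + 1" using i by auto
    interpret Mi: coacting_algebra K H "M i" "coact (M i)" by (rule MC[OF i'(1,2)])
    have "\<sigma> i (r + 1) (?t i (r + 1) (InM m) (InDual l)) =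
      tensor_lift K (?T (r + 1) i) (\<lambda>m0 m1.
        ?t (r + 1) i (InDual (dual_act H m1 l)) (InM m0)) (coact (M i) m)"
      using cross_braid_image[OF inj(2) inj(3) MC[OF i'(1,2)] DA m l] Vr i' by (simp add: \<sigma>_def Vi C_def A_def)
    also have "\<dots> = ?rhs"
      by (rule dual_comult_sweedler[OF assms(2,3) l Mi.module_X mo[OF i'(3)] lin_maps_closed[OF Mi.coact_lin m] _ mo[OF i'(4)]])
        (simp_all only: Vr Vi[OF i'(1,2)] image_module_lin[OF inj(3)] image_module_carrier imageI)
    finally show ?thesis .
  qed
  show ?thesis
    unfolding Let_def V_def[symmetric]
    by (rule exI[of _ \<sigma>], intro conjI ballI impI bs braid_H_H braid_D_D braid_M_same braid_M_M braid_H_M braid_H_D braid_M_D)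
qed

end
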